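(* Let $X$ be a Banach space, let $p\in\mathbb{N}\cup\{\infty\}$, and let $U\subset X$ be a $C^p$-smooth closed convex body whose characteristic cone $\operatorname{cc} U$ is not a linear subspace, normalized so that $0\in\operatorname{Int}U$. Let $y$, $\varphi$, $Z$, $\lambda$, $\gamma$, $c$, $\Phi$, $\Psi$ be as in the context, and let $H:X\to X$ be the map given by $H=\Phi\circ\Psi\circ\Phi^{-1}$ on $X\setminus\big((\operatorname{cc}U\cap\operatorname{Ker}\varphi)+[0,+\infty)y\big)$ and by the identity on $(\operatorname{cc}U\cap\operatorname{Ker}\varphi)+[0,+\infty)y$; this $H$ is a homeomorphism of $X$ onto itself which maps $U$ onto the half-space $\varphi^{-1}([-1,+\infty))$. Then $H$ is a $C^p$-diffeomorphism.
   Context: Scalars are real. A closed convex body is a closed convex set with nonempty interior; it is $C^p$-smooth if its boundary is a $C^p$-smooth submanifold of $X$ of codimension one. The characteristic cone $\operatorname{cc}U$ is the set of all $x\in X$ such that $a+[0,+\infty)x\subset U$ for some $a\in U$. For a convex set $V$ with $0\in\operatorname{Int}V$, $w_V(x)=\inf\{t>0: x\in tV\}$ is its Minkowski functional. Construction of $H$. Since $\operatorname{cc}U$ is not a linear subspace, one can choose $y\in\operatorname{cc}U$ with $-y\notin\operatorname{cc}U$, scaled so that $-y\in\partial U$. By the Hahn–Banach theorem there is a continuous linear functional $\varphi$ on $X$ with $\varphi(-y)=-1$ and $\varphi(x)\ge-1$ for all $x\in U$; fix one. Put $Z=\{x\in X:\varphi(x)=-1\}$. Fix $C^\infty$ functions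 $\lambda,\gamma:\mathbb{R}\to\mathbb{R}$ such that: $\lambda$ is non-decreasing, $\lambda=0$ on $(-\infty,\frac12]$, $\lambda=1$ on $[1,+\infty)$; $\gamma=0$ on $(-\infty,\frac12]$, $\lim_{t\to\infty}\gamma(t)=+\infty$, and $0\le\gamma'(t)<\frac1t(\gamma(t)+1)$ for $t>0$. For $z\in Z$ put $c(z)=\gamma(w_U(y+z))\,y$. Define, for $(\alpha,z)\in(0,+\infty)\times Z$, $$\Phi(\alpha,z)=c(z)+\alpha(z-c(z)),$$ $$\Psi(\alpha,z)=\Big(\alpha\,\lambda\big(\alpha\, w_{U-c(z)}(z-c(z))\big)\big(w_{U-c(z)}(z-c(z))-1\big)+\alpha,\ z\Big).$$ The map $\Phi$ is a homeomorphism of $(0,+\infty)\times Z$ onto $X\setminus\big((\operatorname{cc}U\cap\operatorname{Ker}\varphi)+[0,+\infty)y\big)$, and $\Psi$ is a homeomorphism of $(0,+\infty)\times Z$ onto itself. A $C^p$-diffeomorphism of $X$ is a bijection $X\to X$ which is $C^p$-smooth together with its inverse. *)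

theory Defs
  imports "HOL-Analysis.Analysis" "HOL-Library.Extended_Nat"
begin

section \<open>Maps of class C^p between normed spaces\<close>

text \<open>The type of the n-th Frechet derivative L(X, L(X, ..., Y)) depends on n, so it is represented
  through the usual isometry with the bounded n-linear maps, whose arguments are the vectors of a
  list of length n. The predicate \<open>multi_norm_le n M K\<close> says that the operator norm of M is at
  most K (for K \<ge> 0). Lists of any other length are irrelevant.\<close>

definition multi_norm_le ::
    "nat \<Rightarrow> ('a::real_normed_vector list \<Rightarrow> 'b::real_normed_vector) \<Rightarrow> real \<Rightarrow> bool" where
  "multi_norm_le n M K \<longleftrightarrow>
     (\<forall>vs. length vs = n \<longrightarrow> norm (M vs) \<le> K * prod_list (map norm vs))"

definition bounded_multilinear ::
    "nat \<Rightarrow> ('a::real_normed_vector list \<Rightarrow> 'b::real_normed_vector) \<Rightarrow> bool" where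
  "bounded_multilinear n M \<longleftrightarrow>
     (\<forall>vs i. length vs = n \<longrightarrow> i < n \<longrightarrow> linear (\<lambda>v. M (vs[i := v]))) \<and>
     (\<exists>K. multi_norm_le n M K)"

text \<open>\<open>D n x\<close> is the n-th derivative of f at x. The last two conditions are Frechet
  differentiability of the n-th derivative (n < k), respectively continuity of the k-th one, both
  for the operator norm. The new direction is the first argument of the next derivative. Only open
  sets S are meant.\<close>

definition Ck_on ::
    "nat \<Rightarrow> ('a::real_normed_vector \<Rightarrow> 'b::real_normed_vector) \<Rightarrow> 'a set \<Rightarrow> bool" where
  "Ck_on k f S \<longleftrightarrow> (\<exists>D :: nat \<Rightarrow> 'a \<Rightarrow> 'a list \<Rightarrow> 'b.
     (\<forall>x\<in>S. D 0 x [] = f x) \<and>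
     (\<forall>n\<le>k. \<forall>x\<in>S. bounded_multilinear n (D n x)) \<and>
     (\<forall>n<k. \<forall>x\<in>S. \<forall>e>0. \<forall>\<^sub>F x' in at x.
        multi_norm_le n (\<lambda>vs. D n x' vs - D n x vs - D (Suc n) x ((x' - x) # vs))
          (e * norm (x' - x))) \<and>
     (\<forall>x\<in>S. \<forall>e>0. \<forall>\<^sub>F x' in at x. multi_norm_le k (\<lambda>vs. D k x' vs - D k x vs) e))"

definition Cp_on ::
    "enat \<Rightarrow> ('a::real_normed_vector \<Rightarrow> 'b::real_normed_vector) \<Rightarrow> 'a set \<Rightarrow> bool" where
  "Cp_on p f S \<longleftrightarrow> (\<forall>k. enat k \<le> p \<longrightarrow> Ck_on k f S)"

definition Cp_diffeomorphism ::
    "enat \<Rightarrow> ('a::real_normed_vector \<Rightarrow> 'b::real_normed_vector) \<Rightarrow> 'a set \<Rightarrow> 'b set \<Rightarrow> bool" where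
  "Cp_diffeomorphism p f S T \<longleftrightarrow>
     open S \<and> open T \<and> bij_betw f S T \<and> Cp_on p f S \<and> Cp_on p (inv_into S f) T"

section \<open>Smooth convex bodies\<close>

text \<open>Closed subspaces of codimension one are exactly the kernels of the nonzero continuous linear
  functionals.\<close>

definition Cp_hypersurface :: "enat \<Rightarrow> 'a::real_normed_vector set \<Rightarrow> bool" where
  "Cp_hypersurface p M \<longleftrightarrow> (\<forall>a\<in>M. \<exists>W V (\<theta> :: 'a \<Rightarrow> 'a) (\<psi> :: 'a \<Rightarrow> real).
     a \<in> W \<and> Cp_diffeomorphism p \<theta> W V \<and> bounded_linear \<psi> \<and> \<psi> \<noteq> (\<lambda>x. 0) \<and>
     \<theta> ` (W \<inter> M) = V \<inter> {v. \<psi> v = 0})"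

definition closed_convex_body :: "'a::real_normed_vector set \<Rightarrow> bool" where
  "closed_convex_body U \<longleftrightarrow> closed U \<and> convex U \<and> interior U \<noteq> {}"

definition Cp_smooth_body :: "enat \<Rightarrow> 'a::real_normed_vector set \<Rightarrow> bool" where
  "Cp_smooth_body p U \<longleftrightarrow> closed_convex_body U \<and> Cp_hypersurface p (frontier U)"

definition char_cone :: "'a::real_vector set \<Rightarrow> 'a set" where
  "char_cone U = {x. \<exists>a\<in>U. \<forall>t\<ge>0. a + t *\<^sub>R x \<in> U}"

definition minkowski_functional :: "'a::real_vector set \<Rightarrow> 'a \<Rightarrow> real" where
  "minkowski_functional V x = Inf {t. 0 < t \<and> x \<in> (\<lambda>v. t *\<^sub>R v) ` V}"

section \<open>The map H\<close>

definition Z_plane :: "('a::real_vector \<Rightarrow> real) \<Rightarrow> 'a set" where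
  "Z_plane \<phi> = {x. \<phi> x = -1}"

definition c_map :: "'a::real_vector set \<Rightarrow> 'a \<Rightarrow> (real \<Rightarrow> real) \<Rightarrow> 'a \<Rightarrow> 'a" where
  "c_map U y \<gamma> z = \<gamma> (minkowski_functional U (y + z)) *\<^sub>R y"

definition w_shift :: "'a::real_vector set \<Rightarrow> 'a \<Rightarrow> (real \<Rightarrow> real) \<Rightarrow> 'a \<Rightarrow> real" where
  "w_shift U y \<gamma> z =
     minkowski_functional ((\<lambda>u. u - c_map U y \<gamma> z) ` U) (z - c_map U y \<gamma> z)"

definition Phi_map :: "'a::real_vector set \<Rightarrow> 'a \<Rightarrow> (real \<Rightarrow> real) \<Rightarrow> real \<times> 'a \<Rightarrow> 'a" where
  "Phi_map U y \<gamma> = (\<lambda>(\<alpha>, z). c_map U y \<gamma> z + \<alpha> *\<^sub>R (z - c_map U y \<gamma> z))"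

definition Psi_map ::
    "'a::real_vector set \<Rightarrow> 'a \<Rightarrow> (real \<Rightarrow> real) \<Rightarrow> (real \<Rightarrow> real) \<Rightarrow> real \<times> 'a \<Rightarrow> real \<times> 'a" where
  "Psi_map U y \<gamma> lam = (\<lambda>(\<alpha>, z).
     (\<alpha> * lam (\<alpha> * w_shift U y \<gamma> z) * (w_shift U y \<gamma> z - 1) + \<alpha>, z))"

definition fixed_part :: "'a::real_vector set \<Rightarrow> 'a \<Rightarrow> ('a \<Rightarrow> real) \<Rightarrow> 'a set" where
  "fixed_part U y \<phi> = {u + s *\<^sub>R y | u s. u \<in> char_cone U \<and> \<phi> u = 0 \<and> 0 \<le> s}"

definition H_map ::
    "'a::real_vector set \<Rightarrow> 'a \<Rightarrow> ('a \<Rightarrow> real) \<Rightarrow> (real \<Rightarrow> real) \<Rightarrow> (real \<Rightarrow> real) \<Rightarrow> 'a \<Rightarrow> 'a" where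
  "H_map U y \<phi> \<gamma> lam x =
     (if x \<in> fixed_part U y \<phi> then x
      else Phi_map U y \<gamma> (Psi_map U y \<gamma> lam
             (inv_into ({0<..} \<times> Z_plane \<phi>) (Phi_map U y \<gamma>) x)))"

end

(* In the coordinates (alpha, z) the map H only changes alpha, and all data are roots of scalar
   equations with nonzero derivative in the unknown: w = w_U solves f(x / w) = 0 for a local
   defining function f of the boundary, alpha solves gamma(w(u / alpha)) (1 - alpha) - alpha = phi(x)
   where u is the projection of x to Ker phi along y, the shifted functional W solves
   w_U(c + (z - c) / W) = 1, and the inverse of H is found from the inverse of the increasing map
   t -> t + t lambda(t W) (W - 1). Hence a C^p implicit function argument, for unknowns already
   known to be continuous, gives smoothness off the fixed part; near the fixed part alpha W <= 1/2,
   so lambda vanishes there and H is the identity. *)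
theory Submission
  imports Defs
begin

text \<open>Every root is unique because its equation is strictly monotone in the unknown, and each
  strict sign has its own source. For \<alpha> it is the growth bound \<gamma>'(t) < (\<gamma>(t) +
  1) / t. For w it is the homogeneity of w along rays, which keeps the boundary transversal to them.
  For W it is convexity: c is a nonnegative multiple of y, a direction in which w cannot increase,
  while w grows at unit rate along the ray through a boundary point. For the stretch it is the
  monotonicity of \<lambda> together with W \<ge> 1. The signs of the equations off their roots also
  give the continuity of the roots, so no fixed point argument occurs.

  The delicate place is the fixed part: \<alpha> may tend to 0 there, and c may be large. The
  condition \<alpha> W \<le> 1/2 says that 2 x - c lies in U; the equation for \<alpha> itself
  bounds \<gamma> by 2 \<phi>(x) + 1/2, so 2 x - c has a component along y of at least -1/2.

  Derivatives are used in two forms. Slots serve composition; maps into bounded linear operators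
  serve products and implicit functions, where the order k is raised one step at a time.\<close>

section \<open>Multilinear fields\<close>

text \<open>Differentiating a composition repeatedly produces multilinear maps into ever new spaces, which
  no induction at fixed types can follow. So multilinear maps are handled here as functions of an
  assignment v of vectors to slots, multilinear in the slots of a finite set A: in a derivative the
  new direction occupies a fresh slot b, and compositions and products become substitutions into
  slots, all at the same types. As with bound variables, b is only required to avoid a finite set
  E, which leaves room for renaming.\<close>

definition fld_norm_le ::
    "nat set \<Rightarrow> ((nat \<Rightarrow> 'a::real_normed_vector) \<Rightarrow> 'b::real_normed_vector) \<Rightarrow> real \<Rightarrow> bool" where
  "fld_norm_le A M K \<longleftrightarrow> (\<forall>v. norm (M v) \<le> K * (\<Prod>i\<in>A. norm (v i)))"

definition fld_multilinear ::
    "nat set \<Rightarrow> ((nat \<Rightarrow> 'a::real_normed_vector) \<Rightarrow> 'b::real_normed_vector) \<Rightarrow> bool" where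
  "fld_multilinear A M \<longleftrightarrow>
     (\<forall>v. \<forall>i\<in>A. linear (\<lambda>x. M (v(i := x)))) \<and>
     (\<forall>v v'. (\<forall>i\<in>A. v i = v' i) \<longrightarrow> M v = M v') \<and>
     (\<exists>K. fld_norm_le A M K)"

text \<open>The filter is \<open>nhds x\<close> rather than \<open>at x\<close>: a substitution s
  may take the value s x at points other than x, and with \<open>nhds\<close> the estimates can be
  composed with any continuous s.\<close>

definition fld_cont ::
    "nat set \<Rightarrow> ('a \<Rightarrow> (nat \<Rightarrow> 'a::real_normed_vector) \<Rightarrow> 'b::real_normed_vector) \<Rightarrow> 'a set \<Rightarrow> bool" where
  "fld_cont A F S \<longleftrightarrow> (\<forall>x\<in>S. fld_multilinear A (F x)) \<and>
     (\<forall>x\<in>S. \<forall>e>0. \<forall>\<^sub>F x' in nhds x. fld_norm_le A (\<lambda>v. F x' v - F x v) e)"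

definition fld_deriv ::
    "nat \<Rightarrow> nat set \<Rightarrow> ('a \<Rightarrow> (nat \<Rightarrow> 'a::real_normed_vector) \<Rightarrow> 'b::real_normed_vector) \<Rightarrow>
     ('a \<Rightarrow> (nat \<Rightarrow> 'a) \<Rightarrow> 'b) \<Rightarrow> 'a set \<Rightarrow> bool" where
  "fld_deriv b A F F' S \<longleftrightarrow> (\<forall>x\<in>S. \<forall>e>0. \<forall>\<^sub>F x' in nhds x.
     fld_norm_le A (\<lambda>v. F x' v - F x v - F' x (v(b := x' - x))) (e * norm (x' - x)))"

primrec fld_C ::
    "nat \<Rightarrow> nat set \<Rightarrow> ('a \<Rightarrow> (nat \<Rightarrow> 'a::real_normed_vector) \<Rightarrow> 'b::real_normed_vector) \<Rightarrow>
     'a set \<Rightarrow> bool" where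
  "fld_C 0 A F S = fld_cont A F S"
| "fld_C (Suc k) A F S = (fld_cont A F S \<and>
     (\<exists>E. finite E \<and> (\<forall>b. b \<notin> E \<longrightarrow> (\<exists>F'. fld_deriv b A F F' S \<and> fld_C k (insert b A) F' S))))"

section \<open>Norm bounds and multilinearity of sums and substitutions\<close>

lemma fld_norm_le_mono: "fld_norm_le A M K \<Longrightarrow> K \<le> K' \<Longrightarrow> fld_norm_le A M K'"
  unfolding fld_norm_le_def by (meson mult_right_mono norm_ge_zero order_trans prod_nonneg)

lemma fld_norm_le_add:
  assumes "fld_norm_le A M K" "fld_norm_le A N L"
  shows "fld_norm_le A (\<lambda>v. M v + N v) (K + L)"
  unfolding fld_norm_le_def
proof
  fix v
  have "norm (M v + N v) \<le> norm (M v) + norm (N v)" by (rule norm_triangle_ineq)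
  also have "\<dots> \<le> K * (\<Prod>i\<in>A. norm (v i)) + L * (\<Prod>i\<in>A. norm (v i))"
    using assms unfolding fld_norm_le_def by (meson add_mono)
  finally show "norm (M v + N v) \<le> (K + L) * (\<Prod>i\<in>A. norm (v i))"
    by (simp add: algebra_simps)
qed

lemma fld_multilinear_bound:
  assumes "fld_multilinear A M"
  obtains K where "K \<ge> 0" "fld_norm_le A M K"
proof -
  obtain K where "fld_norm_le A M K" using assms unfolding fld_multilinear_def by blast
  then have "fld_norm_le A M (max K 0)" by (rule fld_norm_le_mono) simp
  then show thesis by (intro that[of "max K 0"]) auto
qed

text \<open>The substitution frees slot a, so B may contain a again; \<open>fld_C_pullback\<close>
  relies on this when it replaces the direction in a slot by its image under a derivative.\<close>

lemma fld_norm_le_plug: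
  assumes "fld_norm_le A N K" "fld_norm_le B L K'" "K \<ge> 0"
    and "finite A" "finite B" "a \<in> A" "(A - {a}) \<inter> B = {}"
  shows "fld_norm_le ((A - {a}) \<union> B) (\<lambda>v. N (v(a := L v))) (K * K')"
  unfolding fld_norm_le_def
proof
  fix v :: "nat \<Rightarrow> 'a"
  let ?P = "\<Prod>i\<in>A - {a}. norm (v i)" and ?Q = "\<Prod>i\<in>B. norm (v i)"
  have P: "?P \<ge> 0" by (simp add: prod_nonneg)
  have "norm (N (v(a := L v))) \<le> K * (\<Prod>i\<in>A. norm ((v(a := L v)) i))"
    using assms(1) unfolding fld_norm_le_def by blast
  also have "(\<Prod>i\<in>A. norm ((v(a := L v)) i)) = norm (L v) * (\<Prod>i\<in>A - {a}. norm ((v(a := L v)) i))"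
    using assms by (simp add: prod.remove)
  also have "(\<Prod>i\<in>A - {a}. norm ((v(a := L v)) i)) = ?P" by (rule prod.cong) auto
  also have "K * (norm (L v) * ?P) \<le> K * ((K' * ?Q) * ?P)"
    using assms(2,3) P unfolding fld_norm_le_def by (intro mult_left_mono mult_right_mono) auto
  also have "\<dots> = K * K' * (\<Prod>i\<in>(A - {a}) \<union> B. norm (v i))"
    using assms by (subst prod.union_disjoint) (auto simp: algebra_simps)
  finally show "norm (N (v(a := L v))) \<le> K * K' * (\<Prod>i\<in>(A - {a}) \<union> B. norm (v i))" .
qed

lemma fld_norm_le_fix:
  assumes "fld_norm_le (insert b A) M K" "b \<notin> A" "finite A"
  shows "fld_norm_le A (\<lambda>v. M (v(b := h))) (K * norm h)"
  unfolding fld_norm_le_def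
proof
  fix v
  have "norm (M (v(b := h))) \<le> K * (\<Prod>i\<in>insert b A. norm ((v(b := h)) i))"
    using assms(1) unfolding fld_norm_le_def by blast
  also have "\<dots> = K * (norm h * (\<Prod>i\<in>A. norm ((v(b := h)) i)))" using assms by simp
  also have "(\<Prod>i\<in>A. norm ((v(b := h)) i)) = (\<Prod>i\<in>A. norm (v i))"
    using assms(2) by (intro prod.cong) auto
  finally show "norm (M (v(b := h))) \<le> K * norm h * (\<Prod>i\<in>A. norm (v i))"
    by (simp only: mult.assoc)
qed

lemma fld_multilinear_linear:
  "fld_multilinear A M \<Longrightarrow> i \<in> A \<Longrightarrow> linear (\<lambda>x. M (v(i := x)))"
  unfolding fld_multilinear_def by blast

lemma fld_multilinear_diff:
  "fld_multilinear A M \<Longrightarrow> i \<in> A \<Longrightarrow> M (v(i := x - x')) = M (v(i := x)) - M (v(i := x'))"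
  by (rule linear_diff[OF fld_multilinear_linear])

lemma fld_multilinear_cong:
  "fld_multilinear A M \<Longrightarrow> (\<And>i. i \<in> A \<Longrightarrow> v i = v' i) \<Longrightarrow> M v = M v'"
  unfolding fld_multilinear_def by blast

lemma fld_multilinear_add:
  assumes "fld_multilinear A M" "fld_multilinear A N"
  shows "fld_multilinear A (\<lambda>v. M v + N v)"
proof -
  obtain K where K: "fld_norm_le A M K" using assms(1) unfolding fld_multilinear_def by blast
  obtain L where L: "fld_norm_le A N L" using assms(2) unfolding fld_multilinear_def by blast
  show ?thesis
    unfolding fld_multilinear_def
  proof (intro conjI allI ballI impI exI)
    show "fld_norm_le A (\<lambda>v. M v + N v) (K + L)" using K L by (rule fld_norm_le_add)
    show "linear (\<lambda>x. M (v(i := x)) + N (v(i := x)))" if "i \<in> A" for v i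
      using fld_multilinear_linear[OF assms(1) that, of v] fld_multilinear_linear[OF assms(2) that, of v]
      by (rule linear_compose_add)
    show "M v + N v = M v' + N v'" if "\<forall>i\<in>A. v i = v' i" for v v'
      using assms that unfolding fld_multilinear_def by metis
  qed
qed

lemma fld_multilinear_plug:
  assumes N: "fld_multilinear A N" and L: "fld_multilinear B L"
    and fin: "finite A" "finite B" and a: "a \<in> A" and disj: "(A - {a}) \<inter> B = {}"
  shows "fld_multilinear ((A - {a}) \<union> B) (\<lambda>v. N (v(a := L v)))"
proof -
  obtain K where K: "K \<ge> 0" "fld_norm_le A N K" using N by (rule fld_multilinear_bound)
  obtain K' where K': "K' \<ge> 0" "fld_norm_le B L K'" using L by (rule fld_multilinear_bound)
  show ?thesis
    unfolding fld_multilinear_def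
  proof (intro conjI allI ballI impI exI)
    show "fld_norm_le ((A - {a}) \<union> B) (\<lambda>v. N (v(a := L v))) (K * K')"
      by (rule fld_norm_le_plug) (use K K' fin a disj in auto)
  next
    fix v i assume i: "i \<in> (A - {a}) \<union> B"
    show "linear (\<lambda>x. N ((v(i := x))(a := L (v(i := x)))))"
    proof (cases "i \<in> B")
      case True
      then have "(\<lambda>x. N ((v(i := x))(a := L (v(i := x))))) = (\<lambda>x. N (v(a := L (v(i := x)))))"
        using disj by (intro ext fld_multilinear_cong[OF N]) auto
      moreover have "linear ((\<lambda>x. N (v(a := x))) \<circ> (\<lambda>x. L (v(i := x))))"
        using fld_multilinear_linear[OF L True] fld_multilinear_linear[OF N a] by (rule linear_compose)
      ultimately show ?thesis by (simp add: o_def)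
    next
      case False
      then have "L (v(i := x)) = L v" for x by (intro fld_multilinear_cong[OF L]) auto
      then have "(\<lambda>x. N ((v(i := x))(a := L (v(i := x))))) = (\<lambda>x. N ((v(a := L v))(i := x)))"
        using i False by (auto simp: fun_upd_twist)
      then show ?thesis using fld_multilinear_linear[OF N] i False by auto
    qed
  next
    fix v v' :: "nat \<Rightarrow> 'a" assume eq: "\<forall>i\<in>(A - {a}) \<union> B. v i = v' i"
    have "L v = L v'" by (rule fld_multilinear_cong[OF L]) (use eq in auto)
    then show "N (v(a := L v)) = N (v'(a := L v'))"
      by (intro fld_multilinear_cong[OF N]) (use eq in auto)
  qed
qed

section \<open>The classes of fields, and their sums\<close>

lemma fld_cont_multilinear: "fld_cont A F S \<Longrightarrow> x \<in> S \<Longrightarrow> fld_multilinear A (F x)"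
  unfolding fld_cont_def by blast

lemma fld_cont_eventually:
  "fld_cont A F S \<Longrightarrow> x \<in> S \<Longrightarrow> e > 0 \<Longrightarrow> \<forall>\<^sub>F x' in nhds x. fld_norm_le A (\<lambda>v. F x' v - F x v) e"
  unfolding fld_cont_def by blast

lemma fld_deriv_eventually:
  "fld_deriv b A F F' S \<Longrightarrow> x \<in> S \<Longrightarrow> e > 0 \<Longrightarrow> \<forall>\<^sub>F x' in nhds x.
     fld_norm_le A (\<lambda>v. F x' v - F x v - F' x (v(b := x' - x))) (e * norm (x' - x))"
  unfolding fld_deriv_def by blast

lemma fld_C_cont: "fld_C k A F S \<Longrightarrow> fld_cont A F S"
  by (cases k) auto

lemma fld_C_SucE:
  assumes "fld_C (Suc k) A F S"
  obtains E where "finite E" "fld_cont A F S"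
    "\<And>b. b \<notin> E \<Longrightarrow> \<exists>F'. fld_deriv b A F F' S \<and> fld_C k (insert b A) F' S"
  using assms by auto

lemma fld_C_SucI:
  assumes "finite E" "fld_cont A F S"
    "\<And>b. b \<notin> E \<Longrightarrow> \<exists>F'. fld_deriv b A F F' S \<and> fld_C k (insert b A) F' S"
  shows "fld_C (Suc k) A F S"
  using assms by auto

lemma fld_C_SucD: "fld_C (Suc k) A F S \<Longrightarrow> fld_C k A F S"
proof (induction k arbitrary: A F)
  case 0 then show ?case by simp
next
  case (Suc k)
  from Suc.prems obtain E where E: "finite E" "fld_cont A F S"
    "\<And>b. b \<notin> E \<Longrightarrow> \<exists>F'. fld_deriv b A F F' S \<and> fld_C (Suc k) (insert b A) F' S"
    by (rule fld_C_SucE) blast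
  show ?case
  proof (rule fld_C_SucI[OF E(1,2)])
    fix b assume "b \<notin> E"
    then obtain F' where "fld_deriv b A F F' S" "fld_C (Suc k) (insert b A) F' S" using E(3) by blast
    then show "\<exists>F'. fld_deriv b A F F' S \<and> fld_C k (insert b A) F' S" using Suc.IH by blast
  qed
qed

lemma fld_cont_add:
  assumes F: "fld_cont A F S" and G: "fld_cont A G S"
  shows "fld_cont A (\<lambda>x v. F x v + G x v) S"
  unfolding fld_cont_def
proof (intro conjI ballI allI impI)
  show "fld_multilinear A (\<lambda>v. F x v + G x v)" if "x \<in> S" for x
    using assms that by (intro fld_multilinear_add fld_cont_multilinear)
  fix x and e :: real assume x: "x \<in> S" and e: "e > 0"
  show "\<forall>\<^sub>F x' in nhds x. fld_norm_le A (\<lambda>v. F x' v + G x' v - (F x v + G x v)) e"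
    using fld_cont_eventually[OF F x half_gt_zero[OF e]] fld_cont_eventually[OF G x half_gt_zero[OF e]]
  proof eventually_elim
    case (elim x')
    from fld_norm_le_add[OF elim] show ?case by (simp add: algebra_simps)
  qed
qed

lemma fld_deriv_add:
  assumes F: "fld_deriv b A F F' S" and G: "fld_deriv b A G G' S"
  shows "fld_deriv b A (\<lambda>x v. F x v + G x v) (\<lambda>x v. F' x v + G' x v) S"
  unfolding fld_deriv_def
proof (intro ballI allI impI)
  fix x and e :: real assume x: "x \<in> S" and e: "e > 0"
  show "\<forall>\<^sub>F x' in nhds x. fld_norm_le A
     (\<lambda>v. F x' v + G x' v - (F x v + G x v) - (F' x (v(b := x' - x)) + G' x (v(b := x' - x)))) (e * norm (x' - x))"
    using fld_deriv_eventually[OF F x half_gt_zero[OF e]] fld_deriv_eventually[OF G x half_gt_zero[OF e]]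
  proof eventually_elim
    case (elim x')
    from fld_norm_le_add[OF elim] show ?case by (simp add: algebra_simps)
  qed
qed

lemma fld_C_add:
  "fld_C k A F S \<Longrightarrow> fld_C k A G S \<Longrightarrow> fld_C k A (\<lambda>x v. F x v + G x v) S"
proof (induction k arbitrary: A F G)
  case 0 then show ?case by (simp add: fld_cont_add)
next
  case (Suc k)
  from Suc.prems(1) obtain E where E: "finite E" "fld_cont A F S"
    "\<And>b. b \<notin> E \<Longrightarrow> \<exists>F'. fld_deriv b A F F' S \<and> fld_C k (insert b A) F' S" by (rule fld_C_SucE) blast
  from Suc.prems(2) obtain D where D: "finite D" "fld_cont A G S"
    "\<And>b. b \<notin> D \<Longrightarrow> \<exists>F'. fld_deriv b A G F' S \<and> fld_C k (insert b A) F' S" by (rule fld_C_SucE) blast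
  show ?case
  proof (rule fld_C_SucI[of "E \<union> D"])
    show "fld_cont A (\<lambda>x v. F x v + G x v) S" using E(2) D(2) by (rule fld_cont_add)
    show "finite (E \<union> D)" using E(1) D(1) by simp
    fix b assume "b \<notin> E \<union> D"
    then obtain F' G' where "fld_deriv b A F F' S" "fld_C k (insert b A) F' S"
      "fld_deriv b A G G' S" "fld_C k (insert b A) G' S" using E(3) D(3) by blast
    then show "\<exists>H. fld_deriv b A (\<lambda>x v. F x v + G x v) H S \<and> fld_C k (insert b A) H S"
      using Suc.IH fld_deriv_add by blast
  qed
qed

section \<open>Substitution into a slot\<close>

lemma fld_cont_plug:
  assumes N: "fld_cont A N S" and L: "fld_cont B L S"
    and fin: "finite A" "finite B" and a: "a \<in> A" and disj: "(A - {a}) \<inter> B = {}"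
  shows "fld_cont ((A - {a}) \<union> B) (\<lambda>x v. N x (v(a := L x v))) S"
  unfolding fld_cont_def
proof (intro conjI ballI allI impI)
  show "fld_multilinear (A - {a} \<union> B) (\<lambda>v. N x (v(a := L x v)))" if "x \<in> S" for x
    using assms that by (intro fld_multilinear_plug fld_cont_multilinear)
  fix x and e :: real assume x: "x \<in> S" and e: "e > 0"
  have Nx: "fld_multilinear A (N x)" using N x by (rule fld_cont_multilinear)
  obtain K where K: "K \<ge> 0" "fld_norm_le A (N x) K" using Nx by (rule fld_multilinear_bound)
  obtain K' where K': "K' \<ge> 0" "fld_norm_le B (L x) K'"
    using fld_cont_multilinear[OF L x] by (rule fld_multilinear_bound)
  \<comment> \<open>The difference is split at N x (L x'). Near x the bound of L x' is 1 + K', so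
    the two terms cost d * (1 + K') and K * d, which add up to e.\<close>
  define d where "d = e / (K' + 1 + K)"
  have d: "d > 0" using K K' e unfolding d_def by (auto intro!: divide_pos_pos)
  have "d * (K' + 1 + K) = e" using K K' by (simp add: d_def)
  then have de: "d * (1 + K') + K * d = e" by (simp add: algebra_simps)
  show "\<forall>\<^sub>F x' in nhds x. fld_norm_le (A - {a} \<union> B)
          (\<lambda>v. N x' (v(a := L x' v)) - N x (v(a := L x v))) e"
    using fld_cont_eventually[OF N x d] fld_cont_eventually[OF L x d]
      fld_cont_eventually[OF L x zero_less_one]
  proof eventually_elim
    case (elim x')
    have L1: "fld_norm_le B (L x') (1 + K')"
      using fld_norm_le_add[OF elim(3) K'(2)] by simp
    have 1: "fld_norm_le (A - {a} \<union> B) (\<lambda>v. N x' (v(a := L x' v)) - N x (v(a := L x' v))) (d * (1 + K'))"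
      using d by (intro fld_norm_le_plug[OF elim(1) L1 _ fin a disj]) auto
    have 2: "fld_norm_le (A - {a} \<union> B) (\<lambda>v. N x (v(a := L x' v - L x v))) (K * d)"
      by (intro fld_norm_le_plug[OF K(2) elim(2) _ fin a disj]) (use K in auto)
    show ?case
      using fld_norm_le_add[OF 1 2] unfolding fld_multilinear_diff[OF Nx a] de by simp
  qed
qed

text \<open>Leibniz rule. The remainder splits into the remainder of N taken at L x', the remainder
  of L inserted into N x, and N' x in direction h applied to L x' - L x. The last is o(h) because it
  is already of order h and L is continuous.\<close>

lemma fld_deriv_plug:
  assumes N: "fld_cont A N S" and L: "fld_cont B L S"
    and N'c: "fld_cont (insert b A) N' S" and L'c: "fld_cont (insert b B) L' S"
    and N': "fld_deriv b A N N' S" and L': "fld_deriv b B L L' S"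
    and fin: "finite A" "finite B" and a: "a \<in> A" and disj: "(A - {a}) \<inter> B = {}"
    and b: "b \<notin> A \<union> B"
  shows "fld_deriv b ((A - {a}) \<union> B) (\<lambda>x v. N x (v(a := L x v)))
           (\<lambda>x v. N' x (v(a := L x v)) + N x (v(a := L' x v))) S"
  unfolding fld_deriv_def
proof (intro ballI allI impI)
  fix x and e :: real assume x: "x \<in> S" and e: "e > 0"
  have Nx: "fld_multilinear A (N x)" using N x by (rule fld_cont_multilinear)
  have Lx: "fld_multilinear B (L x)" using L x by (rule fld_cont_multilinear)
  have N'x: "fld_multilinear (insert b A) (N' x)" using N'c x by (rule fld_cont_multilinear)
  obtain K where K: "K \<ge> 0" "fld_norm_le A (N x) K" using Nx by (rule fld_multilinear_bound)
  obtain M where M: "M \<ge> 0" "fld_norm_le (insert b A) (N' x) M"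
    using N'x by (rule fld_multilinear_bound)
  obtain K' where K': "K' \<ge> 0" "fld_norm_le B (L x) K'"
    using Lx by (rule fld_multilinear_bound)
  define d where "d = e / (K' + 1 + K + M)"
  have d: "d > 0" using K K' M e unfolding d_def by (auto intro!: divide_pos_pos)
  have "d * (K' + 1 + K + M) = e" using K K' M by (simp add: d_def)
  then have de: "d * (1 + K') + K * d + M * d = e" by (simp add: algebra_simps)
  have ba: "b \<noteq> a" using a b by auto
  show "\<forall>\<^sub>F x' in nhds x. fld_norm_le (A - {a} \<union> B)
         (\<lambda>v. N x' (v(a := L x' v)) - N x (v(a := L x v)) -
           (N' x ((v(b := x' - x))(a := L x (v(b := x' - x)))) +
            N x ((v(b := x' - x))(a := L' x (v(b := x' - x))))))
         (e * norm (x' - x))"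
    using fld_deriv_eventually[OF N' x d] fld_deriv_eventually[OF L' x d]
      fld_cont_eventually[OF L x d] fld_cont_eventually[OF L x zero_less_one]
  proof eventually_elim
    case (elim x')
    let ?h = "x' - x"
    have L1: "fld_norm_le B (L x') (1 + K')"
      using fld_norm_le_add[OF elim(4) K'(2)] by simp
    have 1: "fld_norm_le (A - {a} \<union> B) (\<lambda>v. N x' (v(a := L x' v)) - N x (v(a := L x' v)) -
        N' x (v(a := L x' v, b := ?h))) (d * norm ?h * (1 + K'))"
      using d by (intro fld_norm_le_plug[OF elim(1) L1 _ fin a disj]) auto
    have 2: "fld_norm_le (A - {a} \<union> B)
        (\<lambda>v. N x (v(a := L x' v - L x v - L' x (v(b := ?h))))) (K * (d * norm ?h))"
      by (intro fld_norm_le_plug[OF K(2) elim(2) _ fin a disj]) (use K in auto)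
    have "fld_norm_le A (\<lambda>v. N' x (v(b := ?h))) (M * norm ?h)"
      using M(2) by (rule fld_norm_le_fix) (use b fin in auto)
    then have 3: "fld_norm_le (A - {a} \<union> B) (\<lambda>v. N' x ((v(a := L x' v - L x v))(b := ?h)))
        (M * norm ?h * d)"
      by (rule fld_norm_le_plug[OF _ elim(3) _ fin a disj]) (use M in auto)
    have K4: "d * norm ?h * (1 + K') + K * (d * norm ?h) + M * norm ?h * d = e * norm ?h"
      unfolding de[symmetric] by (simp add: algebra_simps)
    have e4: "v(a := u, b := ?h) = v(b := ?h, a := u)" for v u
      using ba by auto
    have e1: "N' x ((v(b := ?h))(a := L x' v - L x v)) =
        N' x ((v(b := ?h))(a := L x' v)) - N' x ((v(b := ?h))(a := L x v))" for v
      by (rule fld_multilinear_diff[OF N'x]) (use a in simp)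
    have e2: "L x (v(b := ?h)) = L x v" for v
      by (rule fld_multilinear_cong[OF Lx]) (use b in auto)
    have e3: "N x ((v(b := ?h))(a := u)) = N x (v(a := u))" for v u
      by (rule fld_multilinear_cong[OF Nx]) (use b in auto)
    show ?case
      using fld_norm_le_add[OF fld_norm_le_add[OF 1 2] 3]
      unfolding K4 fld_multilinear_diff[OF Nx a] e1 e2 e3 e4 by (simp add: algebra_simps)
  qed
qed

text \<open>Both terms of the Leibniz rule are again substitutions, with b added to the slots of one
  factor, so the induction closes. The undifferentiated factor gives up one order by
  \<open>fld_C_SucD\<close>.\<close>

lemma fld_C_plug:
  "fld_C k A N S \<Longrightarrow> fld_C k B L S \<Longrightarrow> finite A \<Longrightarrow> finite B \<Longrightarrow> a \<in> A \<Longrightarrow> (A - {a}) \<inter> B = {} \<Longrightarrow>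
   fld_C k ((A - {a}) \<union> B) (\<lambda>x v. N x (v(a := L x v))) S"
proof (induction k arbitrary: A B N L)
  case 0 then show ?case unfolding fld_C.simps by (rule fld_cont_plug)
next
  case (Suc k)
  note fin = Suc.prems(3,4) and a = Suc.prems(5) and disj = Suc.prems(6)
  from Suc.prems(1) obtain E where E: "finite E" "fld_cont A N S"
    "\<And>b. b \<notin> E \<Longrightarrow> \<exists>F'. fld_deriv b A N F' S \<and> fld_C k (insert b A) F' S" by (rule fld_C_SucE) blast
  from Suc.prems(2) obtain D where D: "finite D" "fld_cont B L S"
    "\<And>b. b \<notin> D \<Longrightarrow> \<exists>F'. fld_deriv b B L F' S \<and> fld_C k (insert b B) F' S" by (rule fld_C_SucE) blast
  show ?case
  proof (rule fld_C_SucI[of "E \<union> D \<union> A \<union> B"])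
    show "fld_cont ((A - {a}) \<union> B) (\<lambda>x v. N x (v(a := L x v))) S"
      using E(2) D(2) fin a disj by (rule fld_cont_plug)
    show "finite (E \<union> D \<union> A \<union> B)" using E(1) D(1) fin by simp
    fix b assume b: "b \<notin> E \<union> D \<union> A \<union> B"
    then obtain N' L' where N': "fld_deriv b A N N' S" "fld_C k (insert b A) N' S"
      and L': "fld_deriv b B L L' S" "fld_C k (insert b B) L' S" using E(3) D(3) by blast
    have eq: "(insert b A - {a}) \<union> B = insert b ((A - {a}) \<union> B)"
      "(A - {a}) \<union> insert b B = insert b ((A - {a}) \<union> B)" using b a by auto
    have "fld_C k ((insert b A - {a}) \<union> B) (\<lambda>x v. N' x (v(a := L x v))) S"
      by (rule Suc.IH[OF N'(2) fld_C_SucD[OF Suc.prems(2)]]) (use b fin a disj in auto)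
    moreover have "fld_C k ((A - {a}) \<union> insert b B) (\<lambda>x v. N x (v(a := L' x v))) S"
      by (rule Suc.IH[OF fld_C_SucD[OF Suc.prems(1)] L'(2)]) (use b fin a disj in auto)
    ultimately have "fld_C k (insert b ((A - {a}) \<union> B))
        (\<lambda>x v. N' x (v(a := L x v)) + N x (v(a := L' x v))) S"
      unfolding eq by (rule fld_C_add)
    moreover have "fld_deriv b ((A - {a}) \<union> B) (\<lambda>x v. N x (v(a := L x v)))
           (\<lambda>x v. N' x (v(a := L x v)) + N x (v(a := L' x v))) S"
      by (rule fld_deriv_plug)
        (use E(2) D(2) N' L' b fin a disj in \<open>auto dest: fld_C_cont\<close>)
    ultimately show "\<exists>F'. fld_deriv b (A - {a} \<union> B) (\<lambda>x v. N x (v(a := L x v))) F' S \<and>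
              fld_C k (insert b (A - {a} \<union> B)) F' S"
      by blast
  qed
qed

section \<open>Change of the base point\<close>

lemma fld_cont_pullback:
  assumes G: "fld_cont A G T" and s: "fld_cont {} (\<lambda>x v. s x) S" and sT: "s ` S \<subseteq> T"
  shows "fld_cont A (\<lambda>x v. G (s x) v) S"
  unfolding fld_cont_def
proof (intro conjI ballI allI impI)
  show "fld_multilinear A (G (s x))" if "x \<in> S" for x
    using that sT by (intro fld_cont_multilinear[OF G]) auto
  fix x and e :: real assume x: "x \<in> S" and e: "e > 0"
  have "(s \<longlongrightarrow> s x) (nhds x)"
  proof (rule tendstoI)
    fix e :: real assume "e > 0"
    then show "\<forall>\<^sub>F x' in nhds x. dist (s x') (s x) < e"
      using fld_cont_eventually[OF s x half_gt_zero[OF \<open>e > 0\<close>]]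
      by (auto simp: fld_norm_le_def dist_norm elim!: eventually_mono)
  qed
  moreover have "\<forall>\<^sub>F y in nhds (s x). fld_norm_le A (\<lambda>v. G y v - G (s x) v) e"
    using x sT by (intro fld_cont_eventually[OF G _ e]) auto
  ultimately show "\<forall>\<^sub>F x' in nhds x. fld_norm_le A (\<lambda>v. G (s x') v - G (s x) v) e"
    by (rule eventually_compose_filterlim[rotated])
qed

lemma fld_deriv_pullback:
  assumes G': "fld_deriv b A G G' T" and G'c: "fld_cont (insert b A) G' T"
    and s': "fld_deriv b {} (\<lambda>x v. s x) s' S" and s'c: "fld_cont {b} s' S"
    and s: "fld_cont {} (\<lambda>x v. s x) S" and sT: "s ` S \<subseteq> T" and b: "b \<notin> A" and fin: "finite A"
  shows "fld_deriv b A (\<lambda>x v. G (s x) v) (\<lambda>x v. G' (s x) (v(b := s' x v))) S"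
  unfolding fld_deriv_def
proof (intro ballI allI impI)
  fix x and e :: real assume x: "x \<in> S" and e: "e > 0"
  have sx: "s x \<in> T" using x sT by auto
  have G'x: "fld_multilinear (insert b A) (G' (s x))" using G'c sx by (rule fld_cont_multilinear)
  obtain K where K: "K \<ge> 0" "fld_norm_le (insert b A) (G' (s x)) K"
    using G'x by (rule fld_multilinear_bound)
  obtain M where M: "M \<ge> 0" "fld_norm_le {b} (s' x) M"
    using fld_cont_multilinear[OF s'c x] by (rule fld_multilinear_bound)
  \<comment> \<open>1 + M is a Lipschitz constant of s at x. The remainder of G then costs d * (1 +
    M), and the remainder of s, after G' (s x), costs K * d.\<close>
  define d where "d = e / (1 + M + K)"
  have d: "d > 0" using K M e unfolding d_def by (auto intro!: divide_pos_pos)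
  have "d * (1 + M + K) = e" using K M by (simp add: d_def)
  then have de: "d * (1 + M) + K * d = e" by (simp add: algebra_simps)
  have lim: "(s \<longlongrightarrow> s x) (nhds x)"
  proof (rule tendstoI)
    fix e :: real assume "e > 0"
    then show "\<forall>\<^sub>F x' in nhds x. dist (s x') (s x) < e"
      using fld_cont_eventually[OF s x half_gt_zero[OF \<open>e > 0\<close>]]
      by (auto simp: fld_norm_le_def dist_norm elim!: eventually_mono)
  qed
  have ev: "\<forall>\<^sub>F x' in nhds x. fld_norm_le A
      (\<lambda>v. G (s x') v - G (s x) v - G' (s x) (v(b := s x' - s x))) (d * norm (s x' - s x))"
    using fld_deriv_eventually[OF G' sx d] lim by (rule eventually_compose_filterlim)
  show "\<forall>\<^sub>F x' in nhds x. fld_norm_le A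
         (\<lambda>v. G (s x') v - G (s x) v - G' (s x) ((v(b := x' - x))(b := s' x (v(b := x' - x)))))
         (e * norm (x' - x))"
    using ev fld_deriv_eventually[OF s' x d] fld_deriv_eventually[OF s' x zero_less_one]
  proof eventually_elim
    case (elim x')
    let ?h = "x' - x"
    have s'h: "s' x (v(b := ?h)) = s' x (\<lambda>_. ?h)" for v
      by (rule fld_multilinear_cong[OF fld_cont_multilinear[OF s'c x]]) auto
    have r: "norm (s x' - s x - s' x (\<lambda>_. ?h)) \<le> d * norm ?h"
      "norm (s x' - s x - s' x (\<lambda>_. ?h)) \<le> norm ?h"
      using elim(2,3) unfolding s'h by (auto simp: fld_norm_le_def)
    have "norm (s' x (\<lambda>_. ?h)) \<le> M * norm ?h"
      using M(2) unfolding fld_norm_le_def by (auto dest: spec[of _ "\<lambda>_. ?h"])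
    then have "norm (s x' - s x) \<le> (1 + M) * norm ?h"
      using r(2) norm_triangle_ineq[of "s x' - s x - s' x (\<lambda>_. ?h)" "s' x (\<lambda>_. ?h)"]
      by (simp add: algebra_simps)
    then have 1: "fld_norm_le A
      (\<lambda>v. G (s x') v - G (s x) v - G' (s x) (v(b := s x' - s x))) (d * ((1 + M) * norm ?h))"
      using d by (intro fld_norm_le_mono[OF elim(1)] mult_left_mono) auto
    have "fld_norm_le A (\<lambda>v. G' (s x) (v(b := s x' - s x - s' x (\<lambda>_. ?h))))
        (K * norm (s x' - s x - s' x (\<lambda>_. ?h)))"
      using K(2) b fin by (rule fld_norm_le_fix)
    then have 2: "fld_norm_le A (\<lambda>v. G' (s x) (v(b := s x' - s x - s' x (\<lambda>_. ?h)))) (K * (d * norm ?h))"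
      by (rule fld_norm_le_mono) (use K r in \<open>auto intro: mult_left_mono\<close>)
    have K4: "d * ((1 + M) * norm ?h) + K * (d * norm ?h) = e * norm ?h"
      unfolding de[symmetric] by (simp add: algebra_simps)
    have bb: "b \<in> insert b A" by simp
    show ?case
      using fld_norm_le_add[OF 1 2] unfolding K4 s'h fld_multilinear_diff[OF G'x bb]
      by (simp add: algebra_simps)
  qed
qed

text \<open>Chain rule. A has to be arbitrary because the derivative is the pullback of G', which
  has the further slot b; into that slot the derivative of s is substituted.\<close>

lemma fld_C_pullback:
  "fld_C k A G T \<Longrightarrow> fld_C k {} (\<lambda>x v. s x) S \<Longrightarrow> s ` S \<subseteq> T \<Longrightarrow> finite A \<Longrightarrow>
   fld_C k A (\<lambda>x v. G (s x) v) S"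
proof (induction k arbitrary: A G)
  case 0 then show ?case using fld_cont_pullback[of A G T s S] by simp
next
  case (Suc k)
  from Suc.prems(1) obtain E where E: "finite E" "fld_cont A G T"
    "\<And>b. b \<notin> E \<Longrightarrow> \<exists>F'. fld_deriv b A G F' T \<and> fld_C k (insert b A) F' T" by (rule fld_C_SucE) blast
  from Suc.prems(2) obtain D where D: "finite D" "fld_cont {} (\<lambda>x v. s x) S"
    "\<And>b. b \<notin> D \<Longrightarrow> \<exists>F'. fld_deriv b {} (\<lambda>x v. s x) F' S \<and> fld_C k {b} F' S" by (rule fld_C_SucE) blast
  show ?case
  proof (rule fld_C_SucI[of "E \<union> D \<union> A"])
    show "fld_cont A (\<lambda>x v. G (s x) v) S"
      using E(2) D(2) Suc.prems(3) by (rule fld_cont_pullback)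
    show "finite (E \<union> D \<union> A)" using E(1) D(1) Suc.prems(4) by simp
    fix b assume b: "b \<notin> E \<union> D \<union> A"
    then obtain G' s' where G': "fld_deriv b A G G' T" "fld_C k (insert b A) G' T"
      and s': "fld_deriv b {} (\<lambda>x v. s x) s' S" "fld_C k {b} s' S" using E(3) D(3) by blast
    have 1: "fld_deriv b A (\<lambda>x v. G (s x) v) (\<lambda>x v. G' (s x) (v(b := s' x v))) S"
      by (rule fld_deriv_pullback)
        (use E(2) D(2) G' s' b Suc.prems(3,4) in \<open>auto dest: fld_C_cont\<close>)
    have "fld_C k (insert b A) (\<lambda>x v. G' (s x) v) S"
      by (rule Suc.IH[OF G'(2) fld_C_SucD[OF Suc.prems(2)]]) (use Suc.prems(3,4) in auto)
    then have "fld_C k (insert b A - {b} \<union> {b}) (\<lambda>x v. G' (s x) (v(b := s' x v))) S"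
      by (rule fld_C_plug[OF _ s'(2)]) (use Suc.prems(3,4) in auto)
    moreover have "insert b A - {b} \<union> {b} = insert b A" by auto
    ultimately show "\<exists>F'. fld_deriv b A (\<lambda>x v. G (s x) v) F' S \<and> fld_C k (insert b A) F' S"
      using 1 by auto
  qed
qed

section \<open>Maps of class C^k as fields\<close>

definition Ck_witness ::
    "nat \<Rightarrow> (nat \<Rightarrow> 'a::real_normed_vector \<Rightarrow> 'a list \<Rightarrow> 'b::real_normed_vector) \<Rightarrow> 'a \<Rightarrow> bool" where
  "Ck_witness k D x \<longleftrightarrow>
     (\<forall>n\<le>k. bounded_multilinear n (D n x)) \<and>
     (\<forall>n<k. \<forall>e>0. \<forall>\<^sub>F x' in at x.
        multi_norm_le n (\<lambda>vs. D n x' vs - D n x vs - D (Suc n) x ((x' - x) # vs))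
          (e * norm (x' - x))) \<and>
     (\<forall>e>0. \<forall>\<^sub>F x' in at x. multi_norm_le k (\<lambda>vs. D k x' vs - D k x vs) e)"

lemma Ck_on_iff_witness:
  "Ck_on k f S \<longleftrightarrow> (\<exists>D. (\<forall>x\<in>S. D 0 x [] = f x) \<and> (\<forall>x\<in>S. Ck_witness k D x))"
  unfolding Ck_on_def Ck_witness_def by (intro iff_exI iffI conjI ballI allI impI; elim conjE; simp)

lemma multi_norm_le_cong:
  "(\<And>vs. length vs = n \<Longrightarrow> M vs = M' vs) \<Longrightarrow> multi_norm_le n M K \<longleftrightarrow> multi_norm_le n M' K"
  unfolding multi_norm_le_def by auto

lemma bounded_multilinear_cong:
  assumes "\<And>vs. length vs = n \<Longrightarrow> M vs = M' vs"
  shows "bounded_multilinear n M \<longleftrightarrow> bounded_multilinear n M'"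
proof -
  have "multi_norm_le n M = multi_norm_le n M'"
    using multi_norm_le_cong[OF assms] by (intro ext)
  then show ?thesis unfolding bounded_multilinear_def using assms by simp
qed

lemma prod_list_norm_nonneg: "0 \<le> prod_list (map norm vs)"
  by (induction vs) auto

lemma multi_norm_le_mono:
  assumes "multi_norm_le n M K" "K \<le> K'"
  shows "multi_norm_le n M K'"
  unfolding multi_norm_le_def
proof (intro allI impI)
  fix vs :: "'a list" assume "length vs = n"
  then have "norm (M vs) \<le> K * prod_list (map norm vs)"
    using assms(1) unfolding multi_norm_le_def by blast
  also have "\<dots> \<le> K' * prod_list (map norm vs)"
    using assms(2) prod_list_norm_nonneg by (rule mult_right_mono)
  finally show "norm (M vs) \<le> K' * prod_list (map norm vs)" .
qed

lemma multi_norm_le_add: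
  assumes "multi_norm_le n M K" "multi_norm_le n N L"
  shows "multi_norm_le n (\<lambda>vs. M vs + N vs) (K + L)"
  unfolding multi_norm_le_def
proof (intro allI impI)
  fix vs :: "'a list" assume "length vs = n"
  then have "norm (M vs) + norm (N vs) \<le> K * prod_list (map norm vs) + L * prod_list (map norm vs)"
    using assms unfolding multi_norm_le_def by (intro add_mono) blast+
  then show "norm (M vs + N vs) \<le> (K + L) * prod_list (map norm vs)"
    using norm_triangle_ineq[of "M vs" "N vs"] by (simp add: algebra_simps)
qed

lemma bounded_multilinear_bound:
  assumes "bounded_multilinear n M"
  obtains K where "K \<ge> 0" "multi_norm_le n M K"
proof -
  obtain K where "multi_norm_le n M K" using assms unfolding bounded_multilinear_def by blast
  then have "multi_norm_le n M (max K 0)" by (rule multi_norm_le_mono) simp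
  then show thesis by (intro that[of "max K 0"]) auto
qed

lemma multi_norm_le_Cons:
  assumes "multi_norm_le (Suc n) M K"
  shows "multi_norm_le n (\<lambda>vs. M (h # vs)) (K * norm h)"
  unfolding multi_norm_le_def
proof (intro allI impI)
  fix vs :: "'a list" assume "length vs = n"
  then have "norm (M (h # vs)) \<le> K * prod_list (map norm (h # vs))"
    using assms unfolding multi_norm_le_def by (metis length_Cons)
  then show "norm (M (h # vs)) \<le> K * norm h * prod_list (map norm vs)" by (simp add: mult.assoc)
qed

text \<open>Continuity is part of the definition for the top order only. A derivative of lower order
  is differentiable, hence satisfies a Lipschitz estimate at x with constant 1 + K.\<close>

lemma Ck_witness_cont:
  assumes W: "Ck_witness k D x" and n: "n \<le> k" and e: "e > 0"
  shows "\<forall>\<^sub>F x' in at x. multi_norm_le n (\<lambda>vs. D n x' vs - D n x vs) e"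
proof (cases "n = k")
  case True
  then show ?thesis using W e unfolding Ck_witness_def by blast
next
  case False
  then have n: "n < k" using n by simp
  then have "bounded_multilinear (Suc n) (D (Suc n) x)" using W unfolding Ck_witness_def by auto
  then obtain K where K: "K \<ge> 0" "multi_norm_le (Suc n) (D (Suc n) x) K"
    by (rule bounded_multilinear_bound)
  have "\<forall>\<^sub>F x' in at x. dist x' x < e / (1 + K)"
    unfolding eventually_at using K e by (intro exI[of _ "e / (1 + K)"]) (auto intro: divide_pos_pos)
  moreover have "\<forall>\<^sub>F x' in at x. multi_norm_le n
      (\<lambda>vs. D n x' vs - D n x vs - D (Suc n) x ((x' - x) # vs)) (1 * norm (x' - x))"
    using W n unfolding Ck_witness_def by (meson zero_less_one)
  ultimately show ?thesis
  proof eventually_elim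
    case (elim x')
    have "(1 + K) * norm (x' - x) \<le> e" using elim(1) K by (simp add: dist_norm field_simps)
    then show ?case
      using multi_norm_le_mono[OF multi_norm_le_add[OF elim(2) multi_norm_le_Cons[OF K(2), of "x' - x"]], of e]
      by (simp add: algebra_simps)
  qed
qed

lemma Ck_witness_has_derivative:
  assumes W: "Ck_witness k D x" and n: "n < k" and len: "length vs = n"
  shows "((\<lambda>x. D n x vs) has_derivative (\<lambda>h. D (Suc n) x (h # vs))) (at x)"
  unfolding has_derivative_within_alt2
proof (intro conjI allI impI)
  have B: "bounded_multilinear (Suc n) (D (Suc n) x)" using W n unfolding Ck_witness_def by auto
  then obtain K where K: "multi_norm_le (Suc n) (D (Suc n) x) K"
    unfolding bounded_multilinear_def by blast
  have "linear (\<lambda>h. D (Suc n) x (((0::'a) # vs)[0 := h]))"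
    using B len unfolding bounded_multilinear_def by (metis length_Cons zero_less_Suc)
  moreover have "norm (D (Suc n) x (h # vs)) \<le> norm h * (K * prod_list (map norm vs))" for h
    using multi_norm_le_Cons[OF K, of h] len unfolding multi_norm_le_def by (simp add: algebra_simps)
  ultimately show "bounded_linear (\<lambda>h. D (Suc n) x (h # vs))"
    unfolding bounded_linear_def bounded_linear_axioms_def linear_iff by auto
  fix e :: real assume e: "e > 0"
  define P where "P = prod_list (map norm vs)"
  have P: "P \<ge> 0" unfolding P_def by (rule prod_list_norm_nonneg)
  \<comment> \<open>The denominator is 1 + P because P = 0 as soon as some entry of vs is 0.\<close>
  then have "e / (1 + P) > 0" using e by (auto intro: divide_pos_pos)
  then have "\<forall>\<^sub>F x' in at x. multi_norm_le n
      (\<lambda>vs. D n x' vs - D n x vs - D (Suc n) x ((x' - x) # vs)) (e / (1 + P) * norm (x' - x))"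
    using W n unfolding Ck_witness_def by blast
  then show "\<forall>\<^sub>F y in at x. norm (D n y vs - D n x vs - D (Suc n) x ((y - x) # vs)) \<le> e * norm (y - x)"
  proof eventually_elim
    case (elim x')
    then have "norm (D n x' vs - D n x vs - D (Suc n) x ((x' - x) # vs)) \<le> e / (1 + P) * norm (x' - x) * P"
      using len unfolding multi_norm_le_def P_def by blast
    also have "\<dots> = (e * norm (x' - x)) * (P / (1 + P))" by simp
    also have "\<dots> \<le> e * norm (x' - x) * 1"
      using e P by (intro mult_left_mono) auto
    finally show ?case by simp
  qed
qed

lemma Ck_witness_cong:
  assumes "open S" "x \<in> S"
    and eq: "\<And>x n vs. x \<in> S \<Longrightarrow> n \<le> k \<Longrightarrow> length vs = n \<Longrightarrow> D n x vs = D' n x vs"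
    and W: "Ck_witness k D x"
  shows "Ck_witness k D' x"
  unfolding Ck_witness_def
proof (intro conjI allI impI)
  have S: "\<forall>\<^sub>F x' in at x. x' \<in> S"
    using assms(1,2) by (auto simp: eventually_at_topological)
  show "bounded_multilinear n (D' n x)" if "n \<le> k" for n
  proof -
    have "bounded_multilinear n (D n x)" using W that unfolding Ck_witness_def by blast
    then show ?thesis using bounded_multilinear_cong[of n "D n x" "D' n x"] eq assms(2) that by blast
  qed
  show "\<forall>\<^sub>F x' in at x. multi_norm_le n (\<lambda>vs. D' n x' vs - D' n x vs - D' (Suc n) x ((x' - x) # vs)) (e * norm (x' - x))"
    if n: "n < k" and e: "0 < e" for n e
  proof -
    have "\<forall>\<^sub>F x' in at x. multi_norm_le n (\<lambda>vs. D n x' vs - D n x vs - D (Suc n) x ((x' - x) # vs)) (e * norm (x' - x))"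
      using W n e unfolding Ck_witness_def by blast
    then show ?thesis using S
    proof eventually_elim
      case (elim x')
      have "D n x' vs - D n x vs - D (Suc n) x ((x' - x) # vs)
          = D' n x' vs - D' n x vs - D' (Suc n) x ((x' - x) # vs)" if "length vs = n" for vs
        using eq[of x' n vs] eq[of x n vs] eq[of x "Suc n" "(x' - x) # vs"] elim(2) assms(2) n that by simp
      then show ?case using elim(1) multi_norm_le_cong by (smt (verit, best) multi_norm_le_def)
    qed
  qed
  show "\<forall>\<^sub>F x' in at x. multi_norm_le k (\<lambda>vs. D' k x' vs - D' k x vs) e" if e: "0 < e" for e
  proof -
    have "\<forall>\<^sub>F x' in at x. multi_norm_le k (\<lambda>vs. D k x' vs - D k x vs) e"
      using W e unfolding Ck_witness_def by blast
    then show ?thesis using S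
    proof eventually_elim
      case (elim x')
      then show ?case using eq[of x' k] eq[of x k] assms(2) by (simp add: multi_norm_le_def)
    qed
  qed
qed

text \<open>A canonical choice of the derivatives, which makes \<open>Ck_on\<close> on open sets a pointwise
  condition and hence a local property.\<close>

primrec iterated_deriv ::
    "('a::real_normed_vector \<Rightarrow> 'b::real_normed_vector) \<Rightarrow> nat \<Rightarrow> 'a \<Rightarrow> 'a list \<Rightarrow> 'b" where
  "iterated_deriv f 0 = (\<lambda>x vs. f x)"
| "iterated_deriv f (Suc n) =
     (\<lambda>x vs. frechet_derivative (\<lambda>x. iterated_deriv f n x (tl vs)) (at x) (hd vs))"

text \<open>For a fixed list of earlier directions the next derivative is an ordinary Frechet
  derivative, which is unique. Hence all witnesses agree on lists of the right length.\<close>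

lemma Ck_witness_unique:
  assumes "open S" and D0: "\<And>x. x \<in> S \<Longrightarrow> D 0 x [] = f x" and W: "\<And>x. x \<in> S \<Longrightarrow> Ck_witness k D x"
  shows "n \<le> k \<Longrightarrow> x \<in> S \<Longrightarrow> length vs = n \<Longrightarrow> D n x vs = iterated_deriv f n x vs"
proof (induction n arbitrary: x vs)
  case 0 then show ?case using D0 by simp
next
  case (Suc n)
  then obtain h us where vs: "vs = h # us" and us: "length us = n" by (metis length_Suc_conv)
  have "((\<lambda>x. D n x us) has_derivative (\<lambda>h. D (Suc n) x (h # us))) (at x)"
    using W Suc.prems us by (intro Ck_witness_has_derivative) auto
  then have "((\<lambda>x. iterated_deriv f n x us) has_derivative (\<lambda>h. D (Suc n) x (h # us))) (at x)"
    by (rule has_derivative_transform_within_open[OF _ assms(1) Suc.prems(2)])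
      (use Suc us in auto)
  then have "(\<lambda>h. D (Suc n) x (h # us)) = frechet_derivative (\<lambda>x. iterated_deriv f n x us) (at x)"
    by (rule frechet_derivative_at)
  then show ?case unfolding vs by (simp add: fun_eq_iff)
qed

lemma Ck_on_iff_iterated_deriv:
  assumes "open S"
  shows "Ck_on k f S \<longleftrightarrow> (\<forall>x\<in>S. Ck_witness k (iterated_deriv f) x)"
proof
  assume "Ck_on k f S"
  then obtain D where D: "\<And>x. x \<in> S \<Longrightarrow> D 0 x [] = f x" "\<And>x. x \<in> S \<Longrightarrow> Ck_witness k D x"
    unfolding Ck_on_iff_witness by blast
  show "\<forall>x\<in>S. Ck_witness k (iterated_deriv f) x"
    using Ck_witness_cong[OF assms _ Ck_witness_unique[OF assms D] D(2)] by blast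
next
  assume "\<forall>x\<in>S. Ck_witness k (iterated_deriv f) x"
  then show "Ck_on k f S"
    unfolding Ck_on_iff_witness by (intro exI[of _ "iterated_deriv f"]) simp
qed

lemma Ck_on_local:
  assumes "open S" "\<And>x. x \<in> S \<Longrightarrow> \<exists>T. open T \<and> x \<in> T \<and> Ck_on k f T"
  shows "Ck_on k f S"
  using assms Ck_on_iff_iterated_deriv by metis

lemma Ck_on_subset: "Ck_on k f S \<Longrightarrow> T \<subseteq> S \<Longrightarrow> Ck_on k f T"
  unfolding Ck_on_iff_witness by blast

lemma Ck_on_cong:
  assumes "Ck_on k f S" "\<And>x. x \<in> S \<Longrightarrow> f x = g x"
  shows "Ck_on k g S"
  using assms unfolding Ck_on_iff_witness by fastforce

section \<open>From lists to slots and back\<close>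

lemma fld_norm_le_map:
  assumes "multi_norm_le n M K" and as: "distinct as" "length as = n"
  shows "fld_norm_le (set as) (\<lambda>v. M (map v as)) K"
  unfolding fld_norm_le_def
proof
  fix v :: "nat \<Rightarrow> 'a"
  have "norm (M (map v as)) \<le> K * prod_list (map norm (map v as))"
    using assms unfolding multi_norm_le_def by (metis length_map)
  then show "norm (M (map v as)) \<le> K * (\<Prod>i\<in>set as. norm (v i))"
    using as by (simp add: prod.distinct_set_conv_list o_def)
qed

lemma fld_multilinear_map:
  assumes M: "bounded_multilinear n M" and as: "distinct as" "length as = n"
  shows "fld_multilinear (set as) (\<lambda>v. M (map v as))"
  unfolding fld_multilinear_def
proof (intro conjI allI ballI impI)
  fix v :: "nat \<Rightarrow> 'a" and i assume "i \<in> set as"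
  then obtain j where j: "j < n" "as ! j = i" using as by (metis in_set_conv_nth)
  have "map (v(i := x)) as = (map v as)[j := x]" for x
    using j as by (intro nth_equalityI) (auto simp: nth_list_update nth_eq_iff_index_eq)
  then show "linear (\<lambda>x. M (map (v(i := x)) as))"
    using M j as unfolding bounded_multilinear_def by simp
next
  show "M (map v as) = M (map v' as)" if "\<forall>i\<in>set as. v i = v' i" for v v' :: "nat \<Rightarrow> 'a"
    using that by (metis map_cong)
next
  show "\<exists>K. fld_norm_le (set as) (\<lambda>v. M (map v as)) K"
    using M as fld_norm_le_map unfolding bounded_multilinear_def by blast
qed

text \<open>The list \<open>as\<close> records which slot holds which argument. A new slot goes to
  its front because the newest direction is the head of the argument list.\<close>

lemma fld_C_map:
  assumes W: "\<And>x. x \<in> S \<Longrightarrow> Ck_witness k D x"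
  shows "distinct as \<Longrightarrow> length as + j \<le> k \<Longrightarrow> fld_C j (set as) (\<lambda>x v. D (length as) x (map v as)) S"
proof (induction j arbitrary: as)
  have cont: "fld_cont (set as) (\<lambda>x v. D (length as) x (map v as)) S"
    if as: "distinct as" "length as \<le> k" for as
    unfolding fld_cont_def
  proof (intro conjI ballI allI impI)
    show "fld_multilinear (set as) (\<lambda>v. D (length as) x (map v as))" if "x \<in> S" for x
      using W[OF that] as unfolding Ck_witness_def by (intro fld_multilinear_map) auto
    fix x and e :: real assume x: "x \<in> S" and e: "e > 0"
    have "\<forall>\<^sub>F x' in at x. fld_norm_le (set as)
        (\<lambda>v. D (length as) x' (map v as) - D (length as) x (map v as)) e"
      using Ck_witness_cont[OF W[OF x] as(2) e]
      by eventually_elim (use fld_norm_le_map as(1) in blast)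
    then show "\<forall>\<^sub>F x' in nhds x. fld_norm_le (set as)
        (\<lambda>v. D (length as) x' (map v as) - D (length as) x (map v as)) e"
      using e by (simp add: eventually_nhds_conv_at fld_norm_le_def prod_nonneg)
  qed
  {
    case 0 then show ?case using cont by simp
  next
    case (Suc j)
    show ?case
    proof (rule fld_C_SucI[of "set as"])
      show "fld_cont (set as) (\<lambda>x v. D (length as) x (map v as)) S" using cont Suc.prems by simp
      fix b assume b: "b \<notin> set as"
      let ?F' = "\<lambda>x v. D (length (b # as)) x (map v (b # as))"
      have "fld_C j (set (b # as)) ?F' S" using Suc.IH[of "b # as"] Suc.prems b by simp
      moreover have "fld_deriv b (set as) (\<lambda>x v. D (length as) x (map v as)) ?F' S"
        unfolding fld_deriv_def
      proof (intro ballI allI impI)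
        fix x and e :: real assume x: "x \<in> S" and e: "e > 0"
        have eq: "map (v(b := h)) (b # as) = h # map v as" for v h
          using b by simp
        have "\<forall>\<^sub>F x' in at x. multi_norm_le (length as)
            (\<lambda>vs. D (length as) x' vs - D (length as) x vs - D (Suc (length as)) x ((x' - x) # vs))
            (e * norm (x' - x))"
          using W[OF x] Suc.prems e unfolding Ck_witness_def by simp
        then have "\<forall>\<^sub>F x' in at x. fld_norm_le (set as)
            (\<lambda>v. D (length as) x' (map v as) - D (length as) x (map v as) -
              ?F' x (v(b := x' - x))) (e * norm (x' - x))"
          unfolding eq length_Cons by eventually_elim (use fld_norm_le_map Suc.prems in blast)
        \<comment> \<open>The filter \<open>at x\<close> omits x' = x, where the remainder is minus
          the derivative in direction 0; this has to vanish for the passage to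
          \<open>nhds x\<close>.\<close>
        moreover have "D (Suc (length as)) x (0 # map v as) = 0" for v
        proof -
          have "bounded_multilinear (Suc (length as)) (D (Suc (length as)) x)"
            using W[OF x] Suc.prems unfolding Ck_witness_def by simp
          then obtain K where "multi_norm_le (Suc (length as)) (D (Suc (length as)) x) K"
            by (rule bounded_multilinear_bound)
          then show ?thesis unfolding multi_norm_le_def
            by (auto dest!: spec[of _ "0 # map v as"])
        qed
        ultimately show "\<forall>\<^sub>F x' in nhds x. fld_norm_le (set as)
            (\<lambda>v. D (length as) x' (map v as) - D (length as) x (map v as) -
              ?F' x (v(b := x' - x))) (e * norm (x' - x))"
          unfolding eventually_nhds_conv_at eq by (simp add: fld_norm_le_def)
      qed
      ultimately show "\<exists>F'. fld_deriv b (set as) (\<lambda>x v. D (length as) x (map v as)) F' S \<and>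
          fld_C j (insert b (set as)) F' S" by auto
    qed simp
  }
qed

text \<open>A right inverse of evaluating an assignment along \<open>as\<close>. The default 0 is
  invisible to fields that are multilinear in \<open>set as\<close>, since these read no other
  slot.\<close>

definition assign :: "nat list \<Rightarrow> 'a::zero list \<Rightarrow> nat \<Rightarrow> 'a" where
  "assign as vs i = (case map_of (zip as vs) i of None \<Rightarrow> 0 | Some v \<Rightarrow> v)"

lemma assign_Cons: "assign (b # as) (h # vs) = (assign as vs)(b := h)"
  unfolding assign_def by (auto simp: fun_eq_iff)

lemma assign_nth:
  "distinct as \<Longrightarrow> length vs = length as \<Longrightarrow> j < length as \<Longrightarrow> assign as vs (as ! j) = vs ! j"
  unfolding assign_def by (simp add: map_of_zip_nth)

lemma map_assign: "distinct as \<Longrightarrow> length vs = length as \<Longrightarrow> map (assign as vs) as = vs"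
  by (intro nth_equalityI) (auto simp: assign_nth)

lemma multi_norm_le_assign:
  assumes "fld_norm_le (set as) M K" "distinct as"
  shows "multi_norm_le (length as) (\<lambda>vs. M (assign as vs)) K"
  unfolding multi_norm_le_def
proof (intro allI impI)
  fix vs :: "'a list" assume len: "length vs = length as"
  have "(\<Prod>i\<in>set as. norm (assign as vs i)) = prod_list (map norm (map (assign as vs) as))"
    using assms(2) by (simp add: prod.distinct_set_conv_list o_def)
  also have "\<dots> = prod_list (map norm vs)" using map_assign[OF assms(2) len] by simp
  finally show "norm (M (assign as vs)) \<le> K * prod_list (map norm vs)"
    using assms(1) unfolding fld_norm_le_def by metis
qed

lemma bounded_multilinear_assign:
  assumes M: "fld_multilinear (set as) M" and as: "distinct as"
  shows "bounded_multilinear (length as) (\<lambda>vs. M (assign as vs))"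
  unfolding bounded_multilinear_def
proof (intro conjI allI impI)
  show "\<exists>K. multi_norm_le (length as) (\<lambda>vs. M (assign as vs)) K"
    using M as multi_norm_le_assign unfolding fld_multilinear_def by blast
  fix vs :: "'a list" and i assume len: "length vs = length as" and i: "i < length as"
  have "M (assign as (vs[i := v])) = M ((assign as vs)(as ! i := v))" for v
  proof (rule fld_multilinear_cong[OF M])
    fix a assume "a \<in> set as"
    then obtain j where "j < length as" "a = as ! j" by (metis in_set_conv_nth)
    then show "assign as (vs[i := v]) a = ((assign as vs)(as ! i := v)) a"
      using as len i by (auto simp: assign_nth nth_eq_iff_index_eq)
  qed
  then show "linear (\<lambda>v. M (assign as (vs[i := v])))"
    using fld_multilinear_linear[OF M, of "as ! i"] i by simp
qed

text \<open>A witness that starts at order m. In the induction below each derivative of a field has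
  one slot more than the field, so the starting order has to vary.\<close>

definition Ck_tail_witness ::
    "nat \<Rightarrow> nat \<Rightarrow> (nat \<Rightarrow> 'a::real_normed_vector \<Rightarrow> 'a list \<Rightarrow> 'b::real_normed_vector) \<Rightarrow> 'a \<Rightarrow> bool" where
  "Ck_tail_witness m k D x \<longleftrightarrow>
     (\<forall>n\<le>k. bounded_multilinear (m + n) (D n x)) \<and>
     (\<forall>n<k. \<forall>e>0. \<forall>\<^sub>F x' in at x.
        multi_norm_le (m + n) (\<lambda>vs. D n x' vs - D n x vs - D (Suc n) x ((x' - x) # vs))
          (e * norm (x' - x))) \<and>
     (\<forall>e>0. \<forall>\<^sub>F x' in at x. multi_norm_le (m + k) (\<lambda>vs. D k x' vs - D k x vs) e)"

lemma fld_C_imp_tail_witness: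
  "fld_C k (set as) F S \<Longrightarrow> distinct as \<Longrightarrow>
   \<exists>D. D 0 = (\<lambda>x vs. F x (assign as vs)) \<and> (\<forall>x\<in>S. Ck_tail_witness (length as) k D x)"
proof (induction k arbitrary: as F)
  case 0
  let ?D = "\<lambda>n::nat. (\<lambda>x vs. F x (assign as vs))"
  have "Ck_tail_witness (length as) 0 ?D x" if x: "x \<in> S" for x
    unfolding Ck_tail_witness_def
  proof (intro conjI allI impI)
    show "bounded_multilinear (length as + n) (\<lambda>vs. F x (assign as vs))" if "n \<le> 0" for n
      using 0 x that by (auto intro!: bounded_multilinear_assign fld_cont_multilinear)
    show "\<forall>\<^sub>F x' in at x. multi_norm_le (length as + 0) (\<lambda>vs. F x' (assign as vs) - F x (assign as vs)) e"
      if e: "0 < e" for e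
    proof -
      have "\<forall>\<^sub>F x' in nhds x. fld_norm_le (set as) (\<lambda>v. F x' v - F x v) e"
        using 0 x e by (intro fld_cont_eventually) auto
      then have "\<forall>\<^sub>F x' in at x. fld_norm_le (set as) (\<lambda>v. F x' v - F x v) e"
        unfolding eventually_nhds_conv_at by blast
      then show ?thesis by eventually_elim (use multi_norm_le_assign 0 in force)
    qed
  qed simp
  then show ?case by (intro exI[of _ ?D]) simp
next
  case (Suc k)
  obtain E where E: "finite E" "fld_cont (set as) F S"
    "\<And>b. b \<notin> E \<Longrightarrow> \<exists>F'. fld_deriv b (set as) F F' S \<and> fld_C k (insert b (set as)) F' S"
    using Suc.prems(1) by (rule fld_C_SucE) blast
  have "finite (E \<union> set as)" using E(1) by simp
  \<comment> \<open>Lists carry no slot names, so one fresh slot is enough although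
    \<open>fld_C\<close> provides a derivative for all but finitely many.\<close>
  then obtain b where b: "b \<notin> E \<union> set as" using ex_new_if_finite infinite_UNIV_nat by blast
  then obtain F' where F': "fld_deriv b (set as) F F' S" "fld_C k (set (b # as)) F' S"
    using E(3) by auto
  then obtain D' where D'0: "D' 0 = (\<lambda>x vs. F' x (assign (b # as) vs))"
    and D': "\<And>x. x \<in> S \<Longrightarrow> Ck_tail_witness (Suc (length as)) k D' x"
    using Suc.IH[of "b # as" F'] b Suc.prems(2) by auto
  define D where "D = case_nat (\<lambda>x vs. F x (assign as vs)) D'"
  have D0: "D 0 = (\<lambda>x vs. F x (assign as vs))" and DS: "\<And>n. D (Suc n) = D' n"
    by (simp_all add: D_def)
  have "Ck_tail_witness (length as) (Suc k) D x" if x: "x \<in> S" for x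
    unfolding Ck_tail_witness_def
  proof (intro conjI allI impI)
    note W = D'[OF x, unfolded Ck_tail_witness_def]
    show "bounded_multilinear (length as + n) (D n x)" if "n \<le> Suc k" for n
    proof (cases n)
      case 0
      then show ?thesis using E(2) x Suc.prems(2)
        by (auto simp: D0 intro!: bounded_multilinear_assign fld_cont_multilinear)
    next
      case (Suc n')
      then show ?thesis using W that by (auto simp: DS)
    qed
    show "\<forall>\<^sub>F x' in at x. multi_norm_le (length as + n)
        (\<lambda>vs. D n x' vs - D n x vs - D (Suc n) x ((x' - x) # vs)) (e * norm (x' - x))"
      if n: "n < Suc k" and e: "0 < e" for n e
    proof (cases n)
      case 0
      have "\<forall>\<^sub>F x' in nhds x. fld_norm_le (set as)
          (\<lambda>v. F x' v - F x v - F' x (v(b := x' - x))) (e * norm (x' - x))"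
        using F'(1) x e by (rule fld_deriv_eventually)
      then have "\<forall>\<^sub>F x' in at x. fld_norm_le (set as)
          (\<lambda>v. F x' v - F x v - F' x (v(b := x' - x))) (e * norm (x' - x))"
        unfolding eventually_nhds_conv_at by blast
      then have "\<forall>\<^sub>F x' in at x. multi_norm_le (length as)
          (\<lambda>vs. F x' (assign as vs) - F x (assign as vs) - F' x ((assign as vs)(b := x' - x))) (e * norm (x' - x))"
        by eventually_elim (use multi_norm_le_assign Suc.prems(2) in force)
      then show ?thesis unfolding 0 DS D0 D'0 assign_Cons by simp
    next
      case (Suc n')
      then show ?thesis using W n e by (simp add: DS)
    qed
    show "\<forall>\<^sub>F x' in at x. multi_norm_le (length as + Suc k) (\<lambda>vs. D (Suc k) x' vs - D (Suc k) x vs) e"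
      if "0 < e" for e
      using W that by (simp add: DS)
  qed
  then show ?case using D0 by blast
qed

lemma Ck_on_imp_fld_C:
  assumes "open S" "Ck_on k f S"
  shows "fld_C k {} (\<lambda>x v. f x) S"
  using fld_C_map[of S k "iterated_deriv f" "[]" k] assms Ck_on_iff_iterated_deriv[of S k f] by simp

lemma fld_C_imp_Ck_on:
  assumes "fld_C k {} (\<lambda>x v. f x) S"
  shows "Ck_on k f S"
proof -
  obtain D where "D 0 = (\<lambda>x vs. f x)" "\<forall>x\<in>S. Ck_tail_witness 0 k D x"
    using fld_C_imp_tail_witness[of k "[]" "\<lambda>x v. f x" S] assms by auto
  then show ?thesis
    unfolding Ck_on_iff_witness Ck_tail_witness_def Ck_witness_def by (intro exI[of _ D]) simp
qed

text \<open>f has to stay within one type because the slots of the fields of f and of g are filled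
  from the same assignment.\<close>

lemma Ck_on_compose_same:
  fixes f :: "'a::real_normed_vector \<Rightarrow> 'a" and g :: "'a \<Rightarrow> 'b::real_normed_vector"
  assumes "open S" "open T" "Ck_on k f S" "Ck_on k g T" "f ` S \<subseteq> T"
  shows "Ck_on k (\<lambda>x. g (f x)) S"
  using fld_C_pullback[OF Ck_on_imp_fld_C[OF assms(2,4)] Ck_on_imp_fld_C[OF assms(1,3)] assms(5)]
  by (intro fld_C_imp_Ck_on) simp

section \<open>Composition\<close>

lemma fld_cont_linear_pre:
  assumes L: "bounded_linear L" and fin: "finite A" and F: "fld_cont A F T"
  shows "fld_cont A (\<lambda>x v. F (L x) (\<lambda>i. L (v i))) (L -` T)"
proof -
  interpret L: bounded_linear L by (rule L)
  obtain B where B: "B > 0" "\<And>x. norm (L x) \<le> norm x * B" using L.pos_bounded by blast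
  have upd: "(\<lambda>j. L ((v(i := u)) j)) = (\<lambda>j. L (v j))(i := L u)" for v i u by auto
  have nrm: "fld_norm_le A (\<lambda>v. M (\<lambda>i. L (v i))) (K * B ^ card A)"
    if M: "fld_norm_le A M K" and K: "K \<ge> 0" for M :: "(nat \<Rightarrow> 'b) \<Rightarrow> 'c" and K
    unfolding fld_norm_le_def
  proof
    fix v :: "nat \<Rightarrow> 'a"
    have "norm (M (\<lambda>i. L (v i))) \<le> K * (\<Prod>i\<in>A. norm (L (v i)))"
      using M unfolding fld_norm_le_def by blast
    also have "\<dots> \<le> K * (\<Prod>i\<in>A. norm (v i) * B)"
      using B(2) K by (intro mult_left_mono prod_mono) auto
    also have "\<dots> = K * B ^ card A * (\<Prod>i\<in>A. norm (v i))"
      by (simp add: prod.distrib)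
    finally show "norm (M (\<lambda>i. L (v i))) \<le> K * B ^ card A * (\<Prod>i\<in>A. norm (v i))" .
  qed
  show ?thesis
    unfolding fld_cont_def
  proof (intro conjI ballI allI impI)
    fix x assume "x \<in> L -` T"
    then have M: "fld_multilinear A (F (L x))" using fld_cont_multilinear[OF F] by auto
    obtain K where K: "K \<ge> 0" "fld_norm_le A (F (L x)) K" using M by (rule fld_multilinear_bound)
    show "fld_multilinear A (\<lambda>v. F (L x) (\<lambda>i. L (v i)))"
      unfolding fld_multilinear_def
    proof (intro conjI allI ballI impI exI)
      show "fld_norm_le A (\<lambda>v. F (L x) (\<lambda>i. L (v i))) (K * B ^ card A)" by (rule nrm) (use K in auto)
      show "F (L x) (\<lambda>i. L (v i)) = F (L x) (\<lambda>i. L (v' i))" if "\<forall>i\<in>A. v i = v' i" for v v'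
        by (rule fld_multilinear_cong[OF M]) (use that in auto)
      fix v i assume i: "i \<in> A"
      have "linear (\<lambda>u. F (L x) ((\<lambda>j. L (v j))(i := L u)))"
        using linear_compose[OF L.linear_axioms fld_multilinear_linear[OF M i]] by (simp add: o_def)
      then show "linear (\<lambda>u. F (L x) (\<lambda>j. L ((v(i := u)) j)))" unfolding upd .
    qed
  next
    fix x and e :: real assume x: "x \<in> L -` T" and e: "e > 0"
    have "\<forall>\<^sub>F y in nhds (L x). fld_norm_le A (\<lambda>v. F y v - F (L x) v) (e / B ^ card A)"
      using x e B by (intro fld_cont_eventually[OF F]) auto
    then have "\<forall>\<^sub>F x' in nhds x. fld_norm_le A (\<lambda>v. F (L x') v - F (L x) v) (e / B ^ card A)"
      using L.tendsto[OF tendsto_ident_at[of x UNIV]] unfolding tendsto_at_iff_tendsto_nhds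
      by (rule eventually_compose_filterlim)
    then show "\<forall>\<^sub>F x' in nhds x. fld_norm_le A
        (\<lambda>v. F (L x') (\<lambda>i. L (v i)) - F (L x) (\<lambda>i. L (v i))) e"
    proof eventually_elim
      case (elim x')
      from nrm[OF elim] show ?case using B e by simp
    qed
  qed
qed

lemma fld_deriv_linear_pre:
  assumes L: "bounded_linear L" and fin: "finite A" and F: "fld_deriv b A F F' T"
  shows "fld_deriv b A (\<lambda>x v. F (L x) (\<lambda>i. L (v i))) (\<lambda>x v. F' (L x) (\<lambda>i. L (v i))) (L -` T)"
  unfolding fld_deriv_def
proof (intro ballI allI impI)
  interpret L: bounded_linear L by (rule L)
  obtain B where B: "B > 0" "\<And>x. norm (L x) \<le> norm x * B" using L.pos_bounded by blast
  have upd: "(\<lambda>j. L ((v(i := u)) j)) = (\<lambda>j. L (v j))(i := L u)" for v i u by auto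
  fix x and e :: real assume x: "x \<in> L -` T" and e: "e > 0"
  have "\<forall>\<^sub>F y in nhds (L x). fld_norm_le A (\<lambda>v. F y v - F (L x) v - F' (L x) (v(b := y - L x)))
      (e / B ^ Suc (card A) * norm (y - L x))"
    using x e B by (intro fld_deriv_eventually[OF F]) auto
  then have "\<forall>\<^sub>F x' in nhds x. fld_norm_le A (\<lambda>v. F (L x') v - F (L x) v - F' (L x) (v(b := L x' - L x)))
      (e / B ^ Suc (card A) * norm (L x' - L x))"
    using L.tendsto[OF tendsto_ident_at[of x UNIV]] unfolding tendsto_at_iff_tendsto_nhds
    by (rule eventually_compose_filterlim)
  then show "\<forall>\<^sub>F x' in nhds x. fld_norm_le A
      (\<lambda>v. F (L x') (\<lambda>i. L (v i)) - F (L x) (\<lambda>i. L (v i)) - F' (L x) (\<lambda>i. L ((v(b := x' - x)) i)))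
      (e * norm (x' - x))"
  proof eventually_elim
    case (elim x')
    show ?case
      unfolding fld_norm_le_def
    proof
      fix v :: "nat \<Rightarrow> 'a"
      let ?M = "\<lambda>v. F (L x') v - F (L x) v - F' (L x) (v(b := L x' - L x))"
      have "norm (?M (\<lambda>i. L (v i))) \<le> e / B ^ Suc (card A) * norm (L x' - L x) * (\<Prod>i\<in>A. norm (L (v i)))"
        using elim unfolding fld_norm_le_def by blast
      also have "\<dots> \<le> e / B ^ Suc (card A) * (norm (x' - x) * B) * (\<Prod>i\<in>A. norm (v i) * B)"
        using B e unfolding L.diff[symmetric]
        by (intro mult_mono prod_mono) (auto intro!: prod_nonneg)
      also have "\<dots> = e * norm (x' - x) * (\<Prod>i\<in>A. norm (v i))"
        using B by (simp add: prod.distrib)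
      finally show "norm (F (L x') (\<lambda>i. L (v i)) - F (L x) (\<lambda>i. L (v i)) - F' (L x) (\<lambda>i. L ((v(b := x' - x)) i)))
          \<le> e * norm (x' - x) * (\<Prod>i\<in>A. norm (v i))"
        unfolding upd L.diff .
    qed
  qed
qed

text \<open>This is the operation that changes the type from which the slots are filled: L is
  applied in every slot, so no derivative of L has to be substituted.\<close>

lemma fld_C_linear_pre:
  assumes L: "bounded_linear L"
  shows "finite A \<Longrightarrow> fld_C k A F T \<Longrightarrow> fld_C k A (\<lambda>x v. F (L x) (\<lambda>i. L (v i))) (L -` T)"
proof (induction k arbitrary: A F)
  case 0 then show ?case by (simp add: fld_cont_linear_pre[OF L])
next
  case (Suc k)
  from Suc.prems(2) obtain E where E: "finite E" "fld_cont A F T"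
    "\<And>b. b \<notin> E \<Longrightarrow> \<exists>F'. fld_deriv b A F F' T \<and> fld_C k (insert b A) F' T"
    by (rule fld_C_SucE) blast
  show ?case
  proof (rule fld_C_SucI[OF E(1)])
    show "fld_cont A (\<lambda>x v. F (L x) (\<lambda>i. L (v i))) (L -` T)"
      using L Suc.prems(1) E(2) by (rule fld_cont_linear_pre)
    fix b assume "b \<notin> E"
    then obtain F' where F': "fld_deriv b A F F' T" "fld_C k (insert b A) F' T" using E(3) by blast
    have "fld_C k (insert b A) (\<lambda>x v. F' (L x) (\<lambda>i. L (v i))) (L -` T)"
      by (rule Suc.IH[OF _ F'(2)]) (use Suc.prems in simp)
    then show "\<exists>F'. fld_deriv b A (\<lambda>x v. F (L x) (\<lambda>i. L (v i))) F' (L -` T) \<and>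
        fld_C k (insert b A) F' (L -` T)"
      using fld_deriv_linear_pre[OF L Suc.prems(1) F'(1)] by blast
  qed
qed

lemma Ck_on_linear_pre:
  assumes "bounded_linear L" "open T" "Ck_on k f T"
  shows "Ck_on k (\<lambda>x. f (L x)) (L -` T)"
  using fld_C_linear_pre[OF assms(1) _ Ck_on_imp_fld_C[OF assms(2,3)]]
  by (intro fld_C_imp_Ck_on) simp

section \<open>Closure properties of C^k, and composition between arbitrary spaces\<close>

lemma Ck_on_SucD: "open S \<Longrightarrow> Ck_on (Suc k) f S \<Longrightarrow> Ck_on k f S"
  by (rule fld_C_imp_Ck_on, rule fld_C_SucD, rule Ck_on_imp_fld_C)

lemma Ck_on_mono: "open S \<Longrightarrow> Ck_on k f S \<Longrightarrow> j \<le> k \<Longrightarrow> Ck_on j f S"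
  by (induction k) (auto simp: le_Suc_eq dest: Ck_on_SucD)

lemma Ck_on_add:
  "open S \<Longrightarrow> Ck_on k f S \<Longrightarrow> Ck_on k g S \<Longrightarrow> Ck_on k (\<lambda>x. f x + g x) S"
  by (rule fld_C_imp_Ck_on, rule fld_C_add; rule Ck_on_imp_fld_C)

lemma Ck_on_linear_post:
  fixes f :: "'a::real_normed_vector \<Rightarrow> 'b::real_normed_vector" and L :: "'b \<Rightarrow> 'c::real_normed_vector"
  assumes L: "bounded_linear L" and f: "Ck_on k f S"
  shows "Ck_on k (\<lambda>x. L (f x)) S"
proof -
  interpret L: bounded_linear L by (rule L)
  obtain B where B: "B > 0" "\<And>x. norm (L x) \<le> norm x * B" using L.pos_bounded by blast
  have nrm: "multi_norm_le n (\<lambda>vs. L (M vs)) K" if "multi_norm_le n M (K / B)"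
    for n K and M :: "'a list \<Rightarrow> 'b"
    unfolding multi_norm_le_def
  proof (intro allI impI)
    fix vs :: "'a list" assume "length vs = n"
    then have "norm (M vs) * B \<le> (K / B * prod_list (map norm vs)) * B"
      using that B(1) unfolding multi_norm_le_def by (intro mult_right_mono) auto
    then show "norm (L (M vs)) \<le> K * prod_list (map norm vs)"
      using B(1) B(2)[of "M vs"] by (simp add: mult.commute)
  qed
  obtain D where D: "\<forall>x\<in>S. D 0 x [] = f x" and W: "\<And>x. x \<in> S \<Longrightarrow> Ck_witness k D x"
    using f unfolding Ck_on_iff_witness by blast
  have "Ck_witness k (\<lambda>n x vs. L (D n x vs)) x" if x: "x \<in> S" for x
    unfolding Ck_witness_def
  proof (intro conjI allI impI)
    note W = W[OF x, unfolded Ck_witness_def]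
    show "bounded_multilinear n (\<lambda>vs. L (D n x vs))" if "n \<le> k" for n
    proof -
      have M: "bounded_multilinear n (D n x)" using W that by blast
      then obtain K where "multi_norm_le n (D n x) K" unfolding bounded_multilinear_def by blast
      then have "multi_norm_le n (\<lambda>vs. L (D n x vs)) (K * B)" using B by (intro nrm) simp
      moreover have "linear (\<lambda>v. L (D n x (vs[i := v])))" if "length vs = n" "i < n" for vs i
      proof -
        have "linear (\<lambda>v. D n x (vs[i := v]))"
          using M that unfolding bounded_multilinear_def by blast
        from linear_compose[OF this L.linear_axioms] show ?thesis by (simp add: o_def)
      qed
      ultimately show ?thesis unfolding bounded_multilinear_def by blast
    qed
    show "\<forall>\<^sub>F x' in at x. multi_norm_le n
        (\<lambda>vs. L (D n x' vs) - L (D n x vs) - L (D (Suc n) x ((x' - x) # vs))) (e * norm (x' - x))"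
      if "n < k" "0 < e" for n e
    proof -
      have "e / B > 0" using that B by simp
      then have "\<forall>\<^sub>F x' in at x. multi_norm_le n
        (\<lambda>vs. D n x' vs - D n x vs - D (Suc n) x ((x' - x) # vs)) (e / B * norm (x' - x))"
        using W that by blast
      then show ?thesis
        by eventually_elim (unfold L.diff[symmetric], rule nrm, simp)
    qed
    show "\<forall>\<^sub>F x' in at x. multi_norm_le k (\<lambda>vs. L (D k x' vs) - L (D k x vs)) e" if "0 < e" for e
    proof -
      have "e / B > 0" using that B by simp
      then have "\<forall>\<^sub>F x' in at x. multi_norm_le k (\<lambda>vs. D k x' vs - D k x vs) (e / B)"
        using W by blast
      then show ?thesis
        by eventually_elim (unfold L.diff[symmetric], rule nrm, simp)
    qed
  qed
  then show ?thesis
    unfolding Ck_on_iff_witness using D by (intro exI[of _ "\<lambda>n x vs. L (D n x vs)"]) simp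
qed

lemma Ck_on_affine:
  assumes L: "bounded_linear L"
  shows "Ck_on k (\<lambda>x. L x + c) S"
proof -
  interpret L: bounded_linear L by (rule L)
  obtain B where B: "B > 0" "\<And>x. norm (L x) \<le> norm x * B" using L.pos_bounded by blast
  define D where "D = (\<lambda>n x vs. if n = 0 then L x + c else if n = Suc 0 then L (hd vs) else 0)"
  have cont: "\<forall>\<^sub>F x' in at x. norm (L x' - L x) \<le> e" if "e > 0" for x and e :: real
  proof -
    have "\<forall>\<^sub>F x' in at x. dist (L x') (L x) < e"
      using L.tendsto[OF tendsto_ident_at[of x UNIV]] that by (rule tendstoD)
    then show ?thesis by eventually_elim (simp add: dist_norm)
  qed
  have "Ck_witness k D x" for x
    unfolding Ck_witness_def
  proof (intro conjI allI impI)
    show "bounded_multilinear n (D n x)" for n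
    proof -
      consider "n = 0" | "n = Suc 0" | "n \<ge> 2" by linarith
      then show ?thesis
      proof cases
        case 1
        then show ?thesis
          by (auto simp: bounded_multilinear_def multi_norm_le_def D_def intro!: exI[of _ "norm (L x + c)"])
      next
        case 2
        have "L (hd (vs[0 := v])) = L v" if "length vs = Suc 0" for vs v
          using that by (cases vs) auto
        then show ?thesis
          using 2 B L.linear_axioms
          by (auto simp: bounded_multilinear_def multi_norm_le_def D_def length_Suc_conv mult.commute
              intro!: exI[of _ B])
      next
        case 3
        then show ?thesis
          by (auto simp: bounded_multilinear_def multi_norm_le_def D_def linear_zero intro!: exI[of _ 0])
      qed
    qed
    show "\<forall>\<^sub>F x' in at x. multi_norm_le n (\<lambda>vs. D n x' vs - D n x vs - D (Suc n) x ((x' - x) # vs)) (e * norm (x' - x))"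
      if "0 < e" for n e
      using that by (auto simp: multi_norm_le_def D_def L.diff prod_list_norm_nonneg)
    show "\<forall>\<^sub>F x' in at x. multi_norm_le k (\<lambda>vs. D k x' vs - D k x vs) e" if "0 < e" for e
      using that cont[OF that, of x]
      by (auto simp: multi_norm_le_def D_def prod_list_norm_nonneg elim!: eventually_mono)
  qed
  then show ?thesis
    unfolding Ck_on_iff_witness by (intro exI[of _ D]) (simp add: D_def)
qed

lemma Ck_on_linear: "bounded_linear L \<Longrightarrow> Ck_on k L S"
  using Ck_on_affine[of L k 0 S] by simp

lemma Ck_on_const: "Ck_on k (\<lambda>x. c) S"
  using Ck_on_affine[OF bounded_linear_zero, of k c S] by simp

lemma Ck_on_ident: "Ck_on k (\<lambda>x. x) S"
  by (intro Ck_on_linear bounded_linear_ident)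

text \<open>Composition on the single type \<open>'a \<times> 'b\<close>, applied to \<open>(x, y) \<mapsto> (0, f x)\<close> and
  \<open>(x, y) \<mapsto> g y\<close>, gives the general case.\<close>

lemma Ck_on_compose:
  fixes f :: "'a::real_normed_vector \<Rightarrow> 'b::real_normed_vector" and g :: "'b \<Rightarrow> 'c::real_normed_vector"
  assumes S: "open S" and T: "open T" and f: "Ck_on k f S" and g: "Ck_on k g T" and fS: "f ` S \<subseteq> T"
  shows "Ck_on k (\<lambda>x. g (f x)) S"
proof -
  have S': "open (S \<times> (UNIV :: 'b set))" and T': "open ((UNIV :: 'a set) \<times> T)"
    using S T by (simp_all add: open_Times)
  have "Ck_on k (\<lambda>p :: 'a \<times> 'b. f (fst p)) (fst -` S)"
    using bounded_linear_fst S f by (rule Ck_on_linear_pre)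
  then have "Ck_on k (\<lambda>p :: 'a \<times> 'b. (0 :: 'a, f (fst p))) (fst -` S)"
    by (rule Ck_on_linear_post[rotated]) (intro bounded_linear_Pair bounded_linear_zero bounded_linear_ident)
  moreover have "fst -` S = S \<times> (UNIV :: 'b set)" by auto
  ultimately have F: "Ck_on k (\<lambda>p :: 'a \<times> 'b. (0 :: 'a, f (fst p))) (S \<times> UNIV)" by simp
  have "Ck_on k (\<lambda>p :: 'a \<times> 'b. g (snd p)) (snd -` T)"
    using bounded_linear_snd T g by (rule Ck_on_linear_pre)
  moreover have "snd -` T = (UNIV :: 'a set) \<times> T" by auto
  ultimately have G: "Ck_on k (\<lambda>p :: 'a \<times> 'b. g (snd p)) (UNIV \<times> T)" by simp
  have "Ck_on k (\<lambda>p :: 'a \<times> 'b. g (snd (0 :: 'a, f (fst p)))) (S \<times> UNIV)"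
    using S' T' F G by (rule Ck_on_compose_same) (use fS in auto)
  then have "Ck_on k (\<lambda>x. g (snd (0 :: 'a, f (fst (x, 0 :: 'b))))) ((\<lambda>x. (x, 0 :: 'b)) -` (S \<times> UNIV))"
    using S' by (intro Ck_on_linear_pre[where L = "\<lambda>x. (x, 0 :: 'b)"] bounded_linear_Pair
      bounded_linear_zero bounded_linear_ident)
  moreover have "(\<lambda>x. (x, 0 :: 'b)) -` (S \<times> UNIV) = S" by auto
  ultimately show ?thesis by simp
qed

lemma Ck_on_Pair:
  assumes "open S" "Ck_on k f S" "Ck_on k g S"
  shows "Ck_on k (\<lambda>x. (f x, g x)) S"
proof -
  have "Ck_on k (\<lambda>x. (f x, 0) + (0, g x)) S"
    using assms by (intro Ck_on_add Ck_on_linear_post[where L = "\<lambda>y. (y, 0)"]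
      Ck_on_linear_post[where L = "\<lambda>y. (0, y)"] bounded_linear_Pair bounded_linear_zero bounded_linear_ident)
  then show ?thesis by simp
qed

lemma Ck_on_0: "Ck_on 0 f S" if "open S" "continuous_on S f"
proof -
  have "Ck_witness 0 (\<lambda>n x vs. f x) x" if x: "x \<in> S" for x
    unfolding Ck_witness_def
  proof (intro conjI allI impI)
    show "bounded_multilinear n (\<lambda>vs. f x)" if "n \<le> 0" for n
      using that by (auto simp: bounded_multilinear_def multi_norm_le_def intro!: exI[of _ "norm (f x)"])
    have "(f \<longlongrightarrow> f x) (at x)"
      using x \<open>open S\<close> \<open>continuous_on S f\<close> by (meson continuous_on_eq_continuous_at isCont_def)
    then show "\<forall>\<^sub>F x' in at x. multi_norm_le 0 (\<lambda>vs. f x' - f x) e" if "e > 0" for e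
      using tendstoD[OF \<open>(f \<longlongrightarrow> f x) (at x)\<close> that]
      by (auto simp: multi_norm_le_def dist_norm elim!: eventually_mono)
  qed simp
  then show ?thesis
    unfolding Ck_on_iff_witness by (intro exI[of _ "\<lambda>n x vs. f x"]) simp
qed

lemma Ck_on_0D:
  assumes "open S" "Ck_on k f S"
  shows "continuous_on S f"
proof -
  have "(f \<longlongrightarrow> f x) (at x)" if "x \<in> S" for x
  proof (rule tendstoI)
    fix e :: real assume e: "e > 0"
    have "\<forall>\<^sub>F x' in at x. multi_norm_le 0 (\<lambda>vs. iterated_deriv f 0 x' vs - iterated_deriv f 0 x vs) (e/2)"
      using assms that e Ck_on_iff_iterated_deriv[of S k f] by (intro Ck_witness_cont[of k]) auto
    then show "\<forall>\<^sub>F x' in at x. dist (f x') (f x) < e"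
      by eventually_elim (use e in \<open>auto simp: multi_norm_le_def dist_norm\<close>)
  qed
  then show ?thesis using assms(1) by (simp add: continuous_on_eq_continuous_at isCont_def)
qed

section \<open>Products and implicit functions\<close>

lemma multi_norm_le_blinfun_uncurry:
  fixes N :: "'a::real_normed_vector list \<Rightarrow> ('a \<Rightarrow>\<^sub>L 'b::real_normed_vector)"
  assumes "multi_norm_le n N K"
  shows "multi_norm_le (Suc n) (\<lambda>vs. N (butlast vs) (last vs)) K"
  unfolding multi_norm_le_def
proof (intro allI impI)
  fix vs :: "'a list" assume "length vs = Suc n"
  then obtain us u where vs: "vs = us @ [u]" "length us = n"
    by (metis length_Suc_conv_rev)
  have "norm (N us u) \<le> norm (N us) * norm u" by (rule norm_blinfun)
  also have "\<dots> \<le> (K * prod_list (map norm us)) * norm u"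
    using assms vs(2) unfolding multi_norm_le_def by (intro mult_right_mono) auto
  finally show "norm (N (butlast vs) (last vs)) \<le> K * prod_list (map norm vs)"
    using vs by (simp add: mult.assoc)
qed

lemma bounded_multilinear_blinfun_uncurry:
  fixes N :: "'a::real_normed_vector list \<Rightarrow> ('a \<Rightarrow>\<^sub>L 'b::real_normed_vector)"
  assumes N: "bounded_multilinear n N"
  shows "bounded_multilinear (Suc n) (\<lambda>vs. N (butlast vs) (last vs))"
  unfolding bounded_multilinear_def
proof (intro conjI allI impI)
  show "\<exists>K. multi_norm_le (Suc n) (\<lambda>vs. N (butlast vs) (last vs)) K"
    using N multi_norm_le_blinfun_uncurry unfolding bounded_multilinear_def by blast
  fix vs :: "'a list" and i assume "length vs = Suc n" and i: "i < Suc n"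
  then obtain us u where vs: "vs = us @ [u]" "length us = n"
    by (metis length_Suc_conv_rev)
  show "linear (\<lambda>v. N (butlast (vs[i := v])) (last (vs[i := v])))"
  proof (cases "i < n")
    case True
    then have "linear (\<lambda>v. N (us[i := v]))" using N vs unfolding bounded_multilinear_def by blast
    then have "linear (\<lambda>v. N (us[i := v]) u)"
      by (auto simp: linear_iff blinfun.add_left blinfun.scaleR_left)
    then show ?thesis using True vs by (simp add: list_update_append)
  next
    case False
    then have "i = length us" using i vs by simp
    then show ?thesis using vs bounded_linear.linear[OF blinfun.bounded_linear_right] by (simp add: list_update_append)
  qed
qed

text \<open>Directions are listed from the newest to the oldest, so the argument of the operator f'
  x is the last entry; this is why the derivatives of f' are uncurried by \<open>butlast\<close> and
  \<open>last\<close>.\<close>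

lemma Ck_on_SucI:
  fixes f :: "'a::real_normed_vector \<Rightarrow> 'b::real_normed_vector"
  assumes f': "\<And>x. x \<in> S \<Longrightarrow> (f has_derivative blinfun_apply (f' x)) (at x)"
    and C: "Ck_on k f' S"
  shows "Ck_on (Suc k) f S"
proof -
  obtain D' where D'0: "\<And>x. x \<in> S \<Longrightarrow> D' 0 x [] = f' x" and W: "\<And>x. x \<in> S \<Longrightarrow> Ck_witness k D' x"
    using C unfolding Ck_on_iff_witness by blast
  define D where "D = case_nat (\<lambda>x vs. f x) (\<lambda>n x vs. blinfun_apply (D' n x (butlast vs)) (last vs))"
  have D0: "D 0 = (\<lambda>x vs. f x)"
    and DS: "\<And>n. D (Suc n) = (\<lambda>x vs. blinfun_apply (D' n x (butlast vs)) (last vs))"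
    by (simp_all add: D_def)
  have "Ck_witness (Suc k) D x" if x: "x \<in> S" for x
    unfolding Ck_witness_def
  proof (intro conjI allI impI)
    note W = W[OF x, unfolded Ck_witness_def]
    show "bounded_multilinear n (D n x)" if "n \<le> Suc k" for n
    proof (cases n)
      case 0
      then show ?thesis
        by (auto simp: D0 bounded_multilinear_def multi_norm_le_def intro!: exI[of _ "norm (f x)"])
    next
      case (Suc m)
      then have "bounded_multilinear m (D' m x)" using W that by simp
      then show ?thesis unfolding Suc DS by (rule bounded_multilinear_blinfun_uncurry)
    qed
    show "\<forall>\<^sub>F x' in at x. multi_norm_le n (\<lambda>vs. D n x' vs - D n x vs - D (Suc n) x ((x' - x) # vs)) (e * norm (x' - x))"
      if n: "n < Suc k" and e: "0 < e" for n e
    proof (cases n)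
      case 0
      have "\<forall>\<^sub>F x' in at x. norm (f x' - f x - f' x (x' - x)) \<le> e * norm (x' - x)"
        using f'[OF x] e unfolding has_derivative_within_alt2 by blast
      then show ?thesis
        unfolding 0 D0 DS by eventually_elim (use D'0[OF x] in \<open>simp add: multi_norm_le_def\<close>)
    next
      case (Suc m)
      then have "\<forall>\<^sub>F x' in at x. multi_norm_le m (\<lambda>vs. D' m x' vs - D' m x vs - D' (Suc m) x ((x' - x) # vs))
          (e * norm (x' - x))" using W n e by simp
      then show ?thesis
        unfolding Suc DS
      proof eventually_elim
        case (elim x')
        have "D' m x' (butlast vs) (last vs) - D' m x (butlast vs) (last vs) -
          D' (Suc m) x (butlast ((x' - x) # vs)) (last ((x' - x) # vs)) =
          (D' m x' (butlast vs) - D' m x (butlast vs) - D' (Suc m) x ((x' - x) # butlast vs)) (last vs)"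
          if "length vs = Suc m" for vs
          using that by (cases vs) (auto simp: blinfun.diff_left)
        then show ?case
          using multi_norm_le_blinfun_uncurry[OF elim]
          unfolding multi_norm_le_def by simp
      qed
    qed
    show "\<forall>\<^sub>F x' in at x. multi_norm_le (Suc k) (\<lambda>vs. D (Suc k) x' vs - D (Suc k) x vs) e" if "0 < e" for e
    proof -
      have "\<forall>\<^sub>F x' in at x. multi_norm_le k (\<lambda>vs. D' k x' vs - D' k x vs) e" using W that by blast
      then show ?thesis
        unfolding DS blinfun.diff_left[symmetric]
        by eventually_elim (rule multi_norm_le_blinfun_uncurry)
    qed
  qed
  then show ?thesis
    unfolding Ck_on_iff_witness using D0 by (intro exI[of _ D]) simp
qed

lemma bounded_multilinear_snoc:
  assumes M: "bounded_multilinear (Suc n) M" and len: "length vs = n"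
  shows "bounded_linear (\<lambda>u. M (vs @ [u]))"
proof -
  obtain K where K: "multi_norm_le (Suc n) M K" using M unfolding bounded_multilinear_def by blast
  have "linear (\<lambda>u. M ((vs @ [0])[n := u]))"
    using M len unfolding bounded_multilinear_def by simp
  then have "linear (\<lambda>u. M (vs @ [u]))" using len by (simp add: list_update_append)
  moreover have "norm (M (vs @ [u])) \<le> norm u * (K * prod_list (map norm vs))" for u
    using K len unfolding multi_norm_le_def by (auto dest!: spec[of _ "vs @ [u]"] simp: algebra_simps)
  ultimately show ?thesis
    unfolding bounded_linear_def bounded_linear_axioms_def linear_iff by auto
qed

lemma multi_norm_le_blinfun_curry:
  fixes N :: "'a::real_normed_vector list \<Rightarrow> ('a \<Rightarrow>\<^sub>L 'b::real_normed_vector)"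
  assumes M: "multi_norm_le (Suc n) M K" and K: "K \<ge> 0"
    and N: "\<And>vs u. length vs = n \<Longrightarrow> N vs u = M (vs @ [u])"
  shows "multi_norm_le n N K"
  unfolding multi_norm_le_def
proof (intro allI impI)
  fix vs :: "'a list" assume len: "length vs = n"
  show "norm (N vs) \<le> K * prod_list (map norm vs)"
  proof (rule norm_blinfun_bound)
    show "0 \<le> K * prod_list (map norm vs)" using K prod_list_norm_nonneg by (rule mult_nonneg_nonneg)
    fix u
    have "norm (M (vs @ [u])) \<le> K * prod_list (map norm (vs @ [u]))"
      using M len unfolding multi_norm_le_def by (auto dest: spec[of _ "vs @ [u]"])
    then show "norm (N vs u) \<le> K * prod_list (map norm vs) * norm u"
      using N[OF len] by (simp add: mult.assoc)
  qed
qed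

text \<open>Converse of \<open>Ck_on_SucI\<close>: currying the last argument of the derivative of
  order n + 1 of f gives the derivative of order n of f', with the same norm bound.\<close>

lemma Ck_on_SucE:
  fixes f :: "'a::real_normed_vector \<Rightarrow> 'b::real_normed_vector"
  assumes S: "open S" and f: "Ck_on (Suc k) f S"
  obtains f' where "\<And>x. x \<in> S \<Longrightarrow> (f has_derivative blinfun_apply (f' x)) (at x)" "Ck_on k f' S"
proof -
  define D where "D = iterated_deriv f"
  have W: "Ck_witness (Suc k) D x" if "x \<in> S" for x
    using f that Ck_on_iff_iterated_deriv[OF S] D_def by blast
  define D' where "D' = (\<lambda>n x vs. Blinfun (\<lambda>u. D (Suc n) x (vs @ [u])))"
  have D': "D' n x vs u = D (Suc n) x (vs @ [u])"
    if "x \<in> S" "n \<le> k" "length vs = n" for n x vs u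
  proof -
    have "bounded_multilinear (Suc n) (D (Suc n) x)"
      using W[OF that(1)] that(2) unfolding Ck_witness_def by simp
    then show ?thesis
      unfolding D'_def using bounded_multilinear_snoc[OF _ that(3)] bounded_linear_Blinfun_apply by metis
  qed
  have "(f has_derivative blinfun_apply (D' 0 x [])) (at x)" if x: "x \<in> S" for x
  proof -
    have "((\<lambda>x. D 0 x []) has_derivative (\<lambda>h. D (Suc 0) x (h # []))) (at x)"
      using W[OF x] by (rule Ck_witness_has_derivative) auto
    moreover have "blinfun_apply (D' 0 x []) = (\<lambda>h. D (Suc 0) x [h])" using D'[OF x, of 0 "[]"] by auto
    ultimately show ?thesis by (simp add: D_def)
  qed
  moreover have "Ck_witness k D' x" if x: "x \<in> S" for x
    unfolding Ck_witness_def
  proof (intro conjI allI impI)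
    have inS: "\<forall>\<^sub>F x' in at x. x' \<in> S" using S x by (auto simp: eventually_at_topological)
    note Wx = W[OF x, unfolded Ck_witness_def]
    show "bounded_multilinear n (D' n x)" if n: "n \<le> k" for n
    proof -
      have M: "bounded_multilinear (Suc n) (D (Suc n) x)" using Wx n by simp
      then obtain K where K: "K \<ge> 0" "multi_norm_le (Suc n) (D (Suc n) x) K"
        by (rule bounded_multilinear_bound)
      have "multi_norm_le n (D' n x) K"
        using K(2,1) D'[OF x n] by (rule multi_norm_le_blinfun_curry)
      moreover have "linear (\<lambda>v. D' n x (vs[i := v]))" if len: "length vs = n" and i: "i < n" for vs i
      proof -
        have "linear (\<lambda>v. D (Suc n) x (vs[i := v] @ [u]))" for u
        proof -
          have "linear (\<lambda>v. D (Suc n) x ((vs @ [u])[i := v]))"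
            using M len i unfolding bounded_multilinear_def by simp
          then show ?thesis using len i by (simp add: list_update_append)
        qed
        then show ?thesis
          unfolding linear_iff
          by (auto intro!: blinfun_eqI simp: blinfun.add_left blinfun.scaleR_left D'[OF x n] len)
      qed
      ultimately show ?thesis unfolding bounded_multilinear_def by blast
    qed
    show "\<forall>\<^sub>F x' in at x. multi_norm_le n (\<lambda>vs. D' n x' vs - D' n x vs - D' (Suc n) x ((x' - x) # vs)) (e * norm (x' - x))"
      if n: "n < k" and e: "0 < e" for n e
    proof -
      have "\<forall>\<^sub>F x' in at x. multi_norm_le (Suc n)
          (\<lambda>vs. D (Suc n) x' vs - D (Suc n) x vs - D (Suc (Suc n)) x ((x' - x) # vs)) (e * norm (x' - x))"
        using Wx n e by simp
      then show ?thesis using inS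
      proof eventually_elim
        case (elim x')
        show ?case
          by (rule multi_norm_le_blinfun_curry[OF elim(1)])
            (use e n x elim(2) in \<open>auto simp: blinfun.diff_left D'\<close>)
      qed
    qed
    show "\<forall>\<^sub>F x' in at x. multi_norm_le k (\<lambda>vs. D' k x' vs - D' k x vs) e" if e: "0 < e" for e
    proof -
      have "\<forall>\<^sub>F x' in at x. multi_norm_le (Suc k) (\<lambda>vs. D (Suc k) x' vs - D (Suc k) x vs) e"
        using Wx e by blast
      then show ?thesis using inS
      proof eventually_elim
        case (elim x')
        show ?case
          by (rule multi_norm_le_blinfun_curry[OF elim(1)])
            (use e x elim(2) in \<open>auto simp: blinfun.diff_left D'\<close>)
      qed
    qed
  qed
  ultimately show thesis
    by (intro that[of "\<lambda>x. D' 0 x []"]) (auto simp: Ck_on_iff_witness)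
qed

text \<open>The derivative of a bilinear map at p depends linearly on p, so it is C^k without
  induction and \<open>Ck_on_SucI\<close> applies at once; composing with the pair (f, g) gives the
  claim.\<close>

lemma Ck_on_bounded_bilinear:
  assumes B: "bounded_bilinear B" and S: "open S" and f: "Ck_on k f S" and g: "Ck_on k g S"
  shows "Ck_on k (\<lambda>x. B (f x) (g x)) S"
proof -
  interpret B: bounded_bilinear B by (rule B)
  define B' where "B' = (\<lambda>p. (B.prod_right (fst p) o\<^sub>L snd_blinfun) + (B.prod_left (snd p) o\<^sub>L fst_blinfun))"
  have B': "bounded_linear B'"
    unfolding B'_def
    by (intro bounded_linear_add
        bounded_linear_compose[OF bounded_bilinear.bounded_linear_left[OF bounded_bilinear_blinfun_compose]]
        bounded_linear_compose[OF B.bounded_linear_prod_right bounded_linear_fst]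
        bounded_linear_compose[OF B.bounded_linear_prod_left bounded_linear_snd])
  have "((\<lambda>p. B (fst p) (snd p)) has_derivative blinfun_apply (B' p)) (at p)" for p
    unfolding B'_def
    by (rule has_derivative_eq_rhs[OF B.FDERIV[OF has_derivative_fst has_derivative_snd]])
      (auto simp: blinfun.add_left B.prod_right.rep_eq B.prod_left.rep_eq fun_eq_iff
        intro!: has_derivative_fst has_derivative_snd derivative_eq_intros)
  then have "Ck_on (Suc k) (\<lambda>p. B (fst p) (snd p)) UNIV"
    using Ck_on_linear[OF B'] by (rule Ck_on_SucI)
  then have "Ck_on k (\<lambda>p. B (fst p) (snd p)) UNIV" by (rule Ck_on_SucD[OF open_UNIV])
  from Ck_on_compose[OF S open_UNIV Ck_on_Pair[OF S f g] this] show ?thesis by simp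
qed

lemmas Ck_on_mult = Ck_on_bounded_bilinear[OF bounded_bilinear_mult]
lemmas Ck_on_scaleR = Ck_on_bounded_bilinear[OF bounded_bilinear_scaleR]

lemma Ck_on_diff:
  assumes "open S" "Ck_on k f S" "Ck_on k g S"
  shows "Ck_on k (\<lambda>x. f x - g x) S"
proof -
  have "Ck_on k (\<lambda>x. f x + - g x) S"
    by (intro Ck_on_add assms Ck_on_linear_post[OF bounded_linear_minus[OF bounded_linear_ident]])
  then show ?thesis by simp
qed

text \<open>The derivative is a product of copies of the function itself, so order k passes to the
  derivative and raises the order of the function.\<close>

lemma Ck_on_inverse_real: "Ck_on k (inverse :: real \<Rightarrow> real) (- {0})"
proof (induction k)
  case 0
  show ?case by (intro Ck_on_0) (auto intro!: continuous_intros)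
next
  case (Suc k)
  have "Ck_on k (\<lambda>x::real. (inverse x * inverse x) *\<^sub>R (- id_blinfun)) (- {0})"
    by (intro Ck_on_scaleR Ck_on_mult Suc Ck_on_const) auto
  moreover have "(inverse has_derivative blinfun_apply ((inverse x * inverse x) *\<^sub>R (- id_blinfun))) (at x)"
    if "x \<in> - {0}" for x :: real
    using that by (auto intro!: derivative_eq_intros simp: blinfun.scaleR_left blinfun.minus_left fun_eq_iff)
  ultimately show ?case by (rule Ck_on_SucI[rotated])
qed

lemma Ck_on_inverse:
  fixes f :: "'a::real_normed_vector \<Rightarrow> real"
  assumes "open S" "Ck_on k f S" "\<And>x. x \<in> S \<Longrightarrow> f x \<noteq> 0"
  shows "Ck_on k (\<lambda>x. inverse (f x)) S"
  using assms by (intro Ck_on_compose[OF _ _ _ Ck_on_inverse_real]) auto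

text \<open>\<tau> is already a continuous solution, so only the linearization has to be solved. It
  reads F' (s, h) = c * (s - G h); since F vanishes along the graph, the error of G as a derivative
  is small compared with the increment of (\<tau> x, x).\<close>

lemma has_derivative_implicit:
  fixes F :: "real \<times> 'a::real_normed_vector \<Rightarrow> real" and \<tau> :: "'a \<Rightarrow> real"
  assumes F: "(F has_derivative F') (at (\<tau> x, x))" and \<tau>: "isCont \<tau> x"
    and zero: "\<forall>\<^sub>F x' in nhds x. F (\<tau> x', x') = 0" and a: "F' (1, 0) \<noteq> 0"
  shows "(\<tau> has_derivative (\<lambda>h. - inverse (F' (1, 0)) * F' (0, h))) (at x)"
  unfolding has_derivative_within_alt2
proof (intro conjI allI impI)
  define c where "c = F' (1, 0)"
  have c: "c \<noteq> 0" using a by (simp add: c_def)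
  interpret F': bounded_linear F' using F by (rule has_derivative_bounded_linear)
  have BL: "bounded_linear (\<lambda>h. F' (0, h))"
    by (intro bounded_linear_compose[OF F'.bounded_linear_axioms] bounded_linear_Pair
      bounded_linear_zero bounded_linear_ident)
  then show G: "bounded_linear (\<lambda>h. - inverse (F' (1, 0)) * F' (0, h))"
    by (rule bounded_linear_const_mult)
  define G where "G h = - inverse c * F' (0, h)" for h
  have "bounded_linear G" using G unfolding G_def c_def .
  then obtain M where M: "M > 0" "\<And>h. norm (G h) \<le> norm h * M"
    using bounded_linear.pos_bounded by blast
  have split: "F' (s, h) = c * (s - G h)" for s h
  proof -
    have "F' (s, h) = F' (s *\<^sub>R (1, 0) + (0, h))" by simp
    also have "\<dots> = s * c + F' (0, h)" unfolding F'.add F'.scaleR c_def by simp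
    finally show ?thesis using c by (simp add: G_def algebra_simps)
  qed
  fix e :: real assume e: "e > 0"
  \<comment> \<open>The error u will satisfy u \<le> d * u + d * (M + 1) * norm h. The bound d \<le>
    1/2 absorbs the first term, and 2 * d * (M + 1) \<le> e controls what remains.\<close>
  define d where "d = min (1/2) (e / (2 * (M + 1)))"
  have d: "d > 0" "d \<le> 1/2" "2 * d * (M + 1) \<le> e"
  proof -
    show "d > 0" using e M by (simp add: d_def)
    show "d \<le> 1/2" unfolding d_def by (rule min.cobounded1)
    have "d \<le> e / (2 * (M + 1))" by (simp add: d_def)
    then show "2 * d * (M + 1) \<le> e" using M by (simp add: field_simps)
  qed
  have F0: "F (\<tau> x, x) = 0" using zero by (rule eventually_nhds_x_imp_x)
  have "((\<lambda>x'. (\<tau> x', x')) \<longlongrightarrow> (\<tau> x, x)) (nhds x)"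
    using \<tau> by (intro tendsto_Pair) (auto simp: isCont_def tendsto_at_iff_tendsto_nhds filterlim_ident)
  moreover have "\<forall>\<^sub>F p in nhds (\<tau> x, x). norm (F p - F (\<tau> x, x) - F' (p - (\<tau> x, x)))
      \<le> (\<bar>c\<bar> * d) * norm (p - (\<tau> x, x))"
    using F c d unfolding has_derivative_within_alt2 eventually_nhds_conv_at by simp
  ultimately have "\<forall>\<^sub>F x' in nhds x. norm (F (\<tau> x', x') - F (\<tau> x, x) - F' ((\<tau> x', x') - (\<tau> x, x)))
      \<le> (\<bar>c\<bar> * d) * norm ((\<tau> x', x') - (\<tau> x, x))"
    by (rule eventually_compose_filterlim[rotated])
  then have "\<forall>\<^sub>F x' in nhds x. \<bar>\<tau> x' - \<tau> x - G (x' - x)\<bar> \<le> e * norm (x' - x)"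
    using zero
  proof eventually_elim
    case (elim x')
    define u where "u = \<bar>\<tau> x' - \<tau> x - G (x' - x)\<bar>"
    have "\<bar>c\<bar> * u = norm (F' (\<tau> x' - \<tau> x, x' - x))" by (simp add: split u_def abs_mult)
    also have "\<dots> \<le> \<bar>c\<bar> * d * norm (\<tau> x' - \<tau> x, x' - x)" using elim F0 by simp
    finally have "\<bar>c\<bar> * u \<le> \<bar>c\<bar> * (d * norm (\<tau> x' - \<tau> x, x' - x))" by (simp only: mult.assoc)
    then have "u \<le> d * norm (\<tau> x' - \<tau> x, x' - x)" using c by simp
    also have "\<dots> \<le> d * (\<bar>\<tau> x' - \<tau> x\<bar> + norm (x' - x))"
      using d norm_Pair_le[of "\<tau> x' - \<tau> x" "x' - x"] by (intro mult_left_mono) auto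
    also have "\<dots> \<le> d * (u + norm (x' - x) * M + norm (x' - x))"
      using d M(2)[of "x' - x"] unfolding u_def by (intro mult_left_mono) auto
    finally have "u \<le> d * u + d * (M + 1) * norm (x' - x)" by (simp add: algebra_simps)
    moreover have "d * u \<le> 1/2 * u" using d by (intro mult_right_mono) (auto simp: u_def)
    ultimately have "u \<le> 2 * d * (M + 1) * norm (x' - x)" by simp
    also have "\<dots> \<le> e * norm (x' - x)" using d by (intro mult_right_mono) auto
    finally show ?case by (simp add: u_def)
  qed
  then show "\<forall>\<^sub>F y in at x. norm (\<tau> y - \<tau> x - - inverse (F' (1, 0)) * F' (0, y - x)) \<le> e * norm (y - x)"
    unfolding eventually_nhds_conv_at G_def c_def by simp
qed

lemma Ck_on_implicit:
  fixes F :: "real \<times> 'a::real_normed_vector \<Rightarrow> real" and \<tau> :: "'a \<Rightarrow> real"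
  assumes W: "open W" and F: "Ck_on k F W" and k: "1 \<le> k" and S: "open S" and \<tau>: "continuous_on S \<tau>"
    and zero: "\<And>x. x \<in> S \<Longrightarrow> (\<tau> x, x) \<in> W \<and> F (\<tau> x, x) = 0"
    and nz: "\<And>x. x \<in> S \<Longrightarrow> \<exists>d. d \<noteq> 0 \<and> ((\<lambda>t. F (t, x)) has_real_derivative d) (at (\<tau> x))"
  shows "Ck_on k \<tau> S"
proof -
  obtain j where kj: "k = Suc j" using k by (cases k) auto
  obtain F' where F': "\<And>p. p \<in> W \<Longrightarrow> (F has_derivative blinfun_apply (F' p)) (at p)" "Ck_on j F' W"
    using W F unfolding kj by (rule Ck_on_SucE) blast
  have a: "F' (\<tau> x, x) (1, 0) \<noteq> 0" if x: "x \<in> S" for x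
  proof -
    obtain d where d: "d \<noteq> 0" "((\<lambda>t. F (t, x)) has_real_derivative d) (at (\<tau> x))" using nz[OF x] by blast
    have "((\<lambda>t. F (t, x)) has_derivative (\<lambda>h. F' (\<tau> x, x) (h, 0))) (at (\<tau> x))"
    proof (rule has_derivative_compose[where f = "\<lambda>t. (t, x)" and f' = "\<lambda>h. (h, 0)" and g = F])
      show "((\<lambda>t. (t, x)) has_derivative (\<lambda>h. (h, 0))) (at (\<tau> x))"
        by (intro has_derivative_Pair has_derivative_ident has_derivative_const)
      show "(F has_derivative F' (\<tau> x, x)) (at (\<tau> x, x))" using F'(1) zero[OF x] by blast
    qed
    then have "(\<lambda>h. F' (\<tau> x, x) (h, 0)) = (*) d"
      using d(2) unfolding has_field_derivative_def by (rule has_derivative_unique)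
    from fun_cong[OF this, of 1] d(1) show ?thesis by simp
  qed
  have "bounded_linear (\<lambda>h::'a. (0::real, h))"
    by (intro bounded_linear_Pair bounded_linear_zero bounded_linear_ident)
  note J = bounded_linear_Blinfun_apply[OF this]
  define T where "T x = (- inverse (F' (\<tau> x, x) (1, 0))) *\<^sub>R (F' (\<tau> x, x) o\<^sub>L Blinfun (\<lambda>h. (0, h)))" for x
  have T: "(\<tau> has_derivative blinfun_apply (T x)) (at x)" if x: "x \<in> S" for x
  proof -
    have "isCont \<tau> x" using S \<tau> x by (simp add: continuous_on_eq_continuous_at)
    moreover have "\<forall>\<^sub>F x' in nhds x. F (\<tau> x', x') = 0"
      using S x zero by (auto simp: eventually_nhds)
    ultimately have "(\<tau> has_derivative (\<lambda>h. - inverse (F' (\<tau> x, x) (1, 0)) * F' (\<tau> x, x) (0, h))) (at x)"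
      using F'(1) zero[OF x] a[OF x] by (intro has_derivative_implicit) auto
    moreover have "blinfun_apply (T x) = (\<lambda>h. - inverse (F' (\<tau> x, x) (1, 0)) * F' (\<tau> x, x) (0, h))"
      by (simp add: T_def J blinfun.scaleR_left blinfun.minus_left fun_eq_iff)
    ultimately show ?thesis by simp
  qed
  \<comment> \<open>Bootstrapping: T contains \<tau> only through F' (\<tau> x, x), so order i of
    \<tau> gives order i of T for i < k, and this is order i + 1 of \<tau>.\<close>
  have "i \<le> k \<Longrightarrow> Ck_on i \<tau> S" for i
  proof (induction i)
    case 0 then show ?case using S \<tau> by (simp add: Ck_on_0)
  next
    case (Suc i)
    have P: "Ck_on i (\<lambda>x. (\<tau> x, x)) S" using S Suc by (intro Ck_on_Pair Ck_on_ident) auto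
    have F'i: "Ck_on i F' W" using W F'(2) by (rule Ck_on_mono) (use Suc.prems kj in simp)
    have C: "Ck_on i (\<lambda>x. F' (\<tau> x, x)) S"
      using S W P F'i by (rule Ck_on_compose) (use zero in auto)
    have "Ck_on i (\<lambda>x. F' (\<tau> x, x) (1, 0)) S"
      using C by (rule Ck_on_linear_post[rotated]) simp
    then have "Ck_on i (\<lambda>x. - inverse (F' (\<tau> x, x) (1, 0))) S"
      using a S by (intro Ck_on_linear_post[OF bounded_linear_minus[OF bounded_linear_ident]] Ck_on_inverse) auto
    moreover have "Ck_on i (\<lambda>x. F' (\<tau> x, x) o\<^sub>L Blinfun (\<lambda>h. (0, h))) S"
      using C by (rule Ck_on_linear_post[rotated])
        (rule bounded_bilinear.bounded_linear_left[OF bounded_bilinear_blinfun_compose])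
    ultimately have "Ck_on i T S" unfolding T_def using S by (intro Ck_on_scaleR)
    with T show ?case by (rule Ck_on_SucI)
  qed
  then show ?thesis by simp
qed

text \<open>\<tau> x is the place where G changes sign in t. For fixed t > 0 the inequalities t <
  \<tau> x and \<tau> x < t become G t x < 0 and G t x > 0, which are open conditions on x.\<close>

lemma continuous_on_implicit:
  fixes G :: "real \<Rightarrow> 'a::real_normed_vector \<Rightarrow> real"
  assumes S: "open S" and pos: "\<And>x. x \<in> S \<Longrightarrow> \<tau> x > 0"
    and cont: "\<And>t. t > 0 \<Longrightarrow> continuous_on S (G t)"
    and sg: "\<And>t x. t > 0 \<Longrightarrow> x \<in> S \<Longrightarrow> sgn (G t x) = sgn (t - \<tau> x)"
  shows "continuous_on S \<tau>"
proof -
  have "(\<tau> \<longlongrightarrow> \<tau> x) (at x)" if x: "x \<in> S" for x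
  proof -
    have inS: "\<forall>\<^sub>F x' in at x. x' \<in> S" using S x by (auto simp: eventually_at_topological)
    have lim: "(G t \<longlongrightarrow> G t x) (at x)" if "t > 0" for t
      using cont[OF that] S x by (simp add: continuous_on_eq_continuous_at isCont_def)
    show ?thesis
    proof (rule order_tendstoI)
      fix l assume "l < \<tau> x"
      \<comment> \<open>l may be negative while signs are known only for positive t; \<tau> x / 2 is
        a positive bound below \<tau> x.\<close>
      define t where "t = max l (\<tau> x / 2)"
      have t: "t > 0" "t < \<tau> x" "l \<le> t" using pos[OF x] \<open>l < \<tau> x\<close> by (auto simp: t_def)
      then have "sgn (G t x) = -1" using sg[OF t(1) x] by (simp add: sgn_if)
      then have "G t x < 0" by (simp add: sgn_if split: if_splits)
      then have "\<forall>\<^sub>F x' in at x. G t x' < 0" using lim[OF t(1)] by (simp add: order_tendstoD)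
      then show "\<forall>\<^sub>F x' in at x. l < \<tau> x'" using inS
      proof eventually_elim
        case (elim x')
        then have "sgn (t - \<tau> x') = -1" using sg[OF t(1), of x'] by (simp add: sgn_if)
        then show ?case using t by (simp add: sgn_if split: if_splits)
      qed
    next
      fix t assume t: "\<tau> x < t"
      then have t0: "t > 0" using pos[OF x] by simp
      then have "sgn (G t x) = 1" using sg[OF t0 x] t by (simp add: sgn_if)
      then have "G t x > 0" by (simp add: sgn_if split: if_splits)
      then have "\<forall>\<^sub>F x' in at x. G t x' > 0" using lim[OF t0] by (simp add: order_tendstoD)
      then show "\<forall>\<^sub>F x' in at x. \<tau> x' < t" using inS
      proof eventually_elim
        case (elim x')
        then have "sgn (t - \<tau> x') = 1" using sg[OF t0, of x'] by (simp add: sgn_if)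
        then show ?case by (simp add: sgn_if split: if_splits)
      qed
    qed
  qed
  then show ?thesis using S by (simp add: continuous_on_eq_continuous_at isCont_def)
qed

section \<open>The Minkowski functional of a smooth body\<close>

locale convex_nbhd =
  fixes U :: "'a::real_normed_vector set"
  assumes closed_U: "closed U" and convex_U: "convex U" and zero_interior: "0 \<in> interior U"
begin

abbreviation w :: "'a \<Rightarrow> real" where "w \<equiv> minkowski_functional U"

lemma zero_in: "0 \<in> U"
  using zero_interior interior_subset by blast

lemma ball_in: obtains r where "r > 0" "cball 0 r \<subseteq> U"
  using zero_interior mem_interior_cball by blast

lemma w_def': "w x = Inf {t. 0 < t \<and> inverse t *\<^sub>R x \<in> U}"
proof -
  have "x \<in> (\<lambda>v. t *\<^sub>R v) ` U \<longleftrightarrow> inverse t *\<^sub>R x \<in> U" if "t > 0" for t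
  proof
    assume "inverse t *\<^sub>R x \<in> U"
    then show "x \<in> (\<lambda>v. t *\<^sub>R v) ` U" using that by (intro image_eqI[of _ _ "inverse t *\<^sub>R x"]) auto
  qed (use that in auto)
  then have "{t. 0 < t \<and> x \<in> (\<lambda>v. t *\<^sub>R v) ` U} = {t. 0 < t \<and> inverse t *\<^sub>R x \<in> U}" by blast
  then show ?thesis unfolding minkowski_functional_def by simp
qed

lemma scale_in: "u \<in> U \<Longrightarrow> 0 \<le> s \<Longrightarrow> s \<le> 1 \<Longrightarrow> s *\<^sub>R u \<in> U"
  using convexD_alt[OF convex_U zero_in, of u s] by simp

lemma inverse_scale_mono:
  assumes "inverse s *\<^sub>R x \<in> U" "0 < s" "s \<le> t"
  shows "inverse t *\<^sub>R x \<in> U"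
  using scale_in[OF assms(1), of "s / t"] assms(2,3) by (simp add: field_simps)

lemma bdd: "bdd_below {t. 0 < t \<and> inverse t *\<^sub>R x \<in> U}"
  by (intro bdd_belowI[of _ 0]) auto

lemma norm_bound_in:
  assumes "cball 0 r \<subseteq> U" "r > 0" "t > 0" "norm x \<le> r * t"
  shows "inverse t *\<^sub>R x \<in> U"
proof -
  have "norm (inverse t *\<^sub>R x) \<le> r" using assms by (simp add: field_simps)
  then show ?thesis using assms(1) by auto
qed

lemma nonempty: "{t. 0 < t \<and> inverse t *\<^sub>R x \<in> U} \<noteq> {}"
proof -
  obtain r where r: "r > 0" "cball 0 r \<subseteq> U" by (rule ball_in)
  have pos: "norm x / r + 1 > 0" using r by (intro add_nonneg_pos) auto
  moreover have "norm x \<le> r * (norm x / r + 1)" using r by (simp add: distrib_left)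
  ultimately have "inverse (norm x / r + 1) *\<^sub>R x \<in> U" using r by (intro norm_bound_in)
  with pos show ?thesis by blast
qed

lemma w_nonneg: "w x \<ge> 0"
  unfolding w_def' by (rule cInf_greatest[OF nonempty]) auto

text \<open>Closedness of U brings the infimum itself into play: x / s lies in U for every s > t and
  converges to x / t as s decreases to t.\<close>

lemma w_le_iff:
  assumes t: "t > 0"
  shows "w x \<le> t \<longleftrightarrow> inverse t *\<^sub>R x \<in> U"
proof
  assume "inverse t *\<^sub>R x \<in> U"
  then show "w x \<le> t" unfolding w_def' using t bdd by (intro cInf_lower) auto
next
  assume le: "w x \<le> t"
  have above: "inverse s *\<^sub>R x \<in> U" if "s > t" for s
  proof -
    have "Inf {t. 0 < t \<and> inverse t *\<^sub>R x \<in> U} < s" using le that unfolding w_def' by simp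
    then obtain q where "0 < q" "inverse q *\<^sub>R x \<in> U" "q < s"
      using cInf_less_iff[OF nonempty bdd] by blast
    then show ?thesis using inverse_scale_mono by force
  qed
  have "((\<lambda>s. inverse s *\<^sub>R x) \<longlongrightarrow> inverse t *\<^sub>R x) (at_right t)"
    using t by (intro tendsto_intros) auto
  moreover have "\<forall>\<^sub>F s in at_right t. inverse s *\<^sub>R x \<in> U"
    using above by (auto simp: eventually_at_filter)
  ultimately show "inverse t *\<^sub>R x \<in> U"
    using closed_U by (intro Lim_in_closed_set[of U _ "at_right t"]) auto
qed

lemma w_le_1_iff: "w x \<le> 1 \<longleftrightarrow> x \<in> U"
  using w_le_iff[of 1] by simp

lemma w_le_norm:
  assumes "r > 0" "cball 0 r \<subseteq> U"
  shows "w x \<le> norm x / r"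
proof (rule field_le_epsilon)
  fix e :: real assume e: "e > 0"
  have pos: "norm x / r + e > 0" using assms e by (intro add_nonneg_pos) auto
  moreover have "norm x \<le> r * (norm x / r + e)" using assms e by (simp add: distrib_left)
  ultimately have "inverse (norm x / r + e) *\<^sub>R x \<in> U" using assms by (intro norm_bound_in)
  with pos show "w x \<le> norm x / r + e" using w_le_iff by blast
qed

lemma w_scale_pos:
  assumes s: "s > 0"
  shows "w (s *\<^sub>R x) = s * w x"
proof -
  have iff: "w (s *\<^sub>R x) \<le> t \<longleftrightarrow> s * w x \<le> t" if t: "t > 0" for t
  proof -
    have "w (s *\<^sub>R x) \<le> t \<longleftrightarrow> inverse (t / s) *\<^sub>R x \<in> U"
      using w_le_iff[OF t, of "s *\<^sub>R x"] by (simp add: divide_inverse mult.commute)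
    also have "\<dots> \<longleftrightarrow> w x \<le> t / s" using s t by (intro w_le_iff[symmetric]) simp
    also have "\<dots> \<longleftrightarrow> s * w x \<le> t" using s by (simp add: field_simps)
    finally show ?thesis .
  qed
  show ?thesis
  proof (rule antisym)
    show "w (s *\<^sub>R x) \<le> s * w x"
    proof (rule field_le_epsilon)
      fix e :: real assume "e > 0"
      then show "w (s *\<^sub>R x) \<le> s * w x + e" using iff[of "s * w x + e"] s w_nonneg[of x]
        by (simp add: add_nonneg_pos)
    qed
    show "s * w x \<le> w (s *\<^sub>R x)"
    proof (rule field_le_epsilon)
      fix e :: real assume "e > 0"
      then show "s * w x \<le> w (s *\<^sub>R x) + e" using iff[of "w (s *\<^sub>R x) + e"] w_nonneg[of "s *\<^sub>R x"]
        by (simp add: add_nonneg_pos)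
    qed
  qed
qed

lemma w_zero: "w 0 = 0"
  using w_scale_pos[of 2 0] by simp

lemma w_scale: "s \<ge> 0 \<Longrightarrow> w (s *\<^sub>R x) = s * w x"
  using w_scale_pos[of s x] w_zero by (cases "s = 0") auto

lemma w_add: "w (x + y) \<le> w x + w y"
proof (rule field_le_epsilon)
  fix e :: real assume e: "e > 0"
  define s t where "s = w x + e / 2" and "t = w y + e / 2"
  have st: "s > 0" "t > 0" using e w_nonneg[of x] w_nonneg[of y] by (auto simp: s_def t_def)
  have "inverse s *\<^sub>R x \<in> U" "inverse t *\<^sub>R y \<in> U"
    using st e by (auto simp: w_le_iff[symmetric] s_def t_def)
  then have "(s / (s + t)) *\<^sub>R (inverse s *\<^sub>R x) + (t / (s + t)) *\<^sub>R (inverse t *\<^sub>R y) \<in> U"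
    using st by (intro convexD[OF convex_U]) (auto simp: add_divide_distrib[symmetric])
  moreover have "(s / (s + t)) *\<^sub>R (inverse s *\<^sub>R x) + (t / (s + t)) *\<^sub>R (inverse t *\<^sub>R y)
      = inverse (s + t) *\<^sub>R (x + y)"
  proof -
    have "s / (s + t) * inverse s = inverse (s + t)" "t / (s + t) * inverse t = inverse (s + t)"
      using st by (simp_all add: divide_inverse)
    then show ?thesis by (simp add: scaleR_add_right)
  qed
  ultimately have "w (x + y) \<le> s + t" using st by (simp add: w_le_iff)
  then show "w (x + y) \<le> w x + w y + e" by (simp add: s_def t_def)
qed

lemma w_diff: "w x - w y \<le> w (x - y)"
  using w_add[of "x - y" y] by simp

lemma continuous_w: "continuous_on S w"
proof -
  obtain r where r: "r > 0" "cball 0 r \<subseteq> U" by (rule ball_in)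
  have "dist (w x) (w y) \<le> inverse r * dist x y" for x y
    using w_diff[of x y] w_diff[of y x] w_le_norm[OF r, of "x - y"] w_le_norm[OF r, of "y - x"]
    by (auto simp: dist_norm norm_minus_commute divide_inverse mult.commute abs_le_iff)
  then have "(inverse r)-lipschitz_on S w" using r by (intro lipschitz_onI) auto
  then show ?thesis by (rule lipschitz_on_continuous_on)
qed

lemma continuous_w' [continuous_intros]: "continuous_on S f \<Longrightarrow> continuous_on S (\<lambda>x. w (f x))"
  using continuous_on_compose2[OF continuous_w[of UNIV]] by blast

lemma interior_iff: "x \<in> interior U \<longleftrightarrow> w x < 1"
proof
  assume "x \<in> interior U"
  then obtain d where d: "d > 0" "ball x d \<subseteq> U" using mem_interior by blast
  \<comment> \<open>e is so small that (1 + e) x is still in U, and then (1 + e) * w x \<le> 1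
    forces w x < 1. The summand 1 in the denominator covers x = 0.\<close>
  define e where "e = d / (2 * (norm x + 1))"
  have e: "e > 0" using d by (auto simp: e_def add_nonneg_pos intro!: divide_pos_pos)
  have "e * norm x \<le> e * (norm x + 1)" using e by simp
  also have "\<dots> = d / 2"
    using norm_ge_zero[of x] unfolding e_def by (simp add: field_simps add_nonneg_eq_0_iff)
  finally have "e * norm x < d" using d by simp
  then have "(1 + e) *\<^sub>R x \<in> U" using d(2) e by (auto simp: dist_norm scaleR_add_left)
  then have "w ((1 + e) *\<^sub>R x) \<le> 1" using w_le_1_iff by blast
  then have le: "(1 + e) * w x \<le> 1" using w_scale[of "1 + e" x] e by simp
  show "w x < 1"
  proof (rule ccontr)
    assume "\<not> w x < 1"
    then have "(1 + e) * 1 \<le> (1 + e) * w x" using e by (intro mult_left_mono) auto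
    from order_trans[OF this le] show False using e by simp
  qed
next
  assume "w x < 1"
  moreover have "open {x. w x < 1}" by (intro open_Collect_less continuous_intros)
  moreover have "{x. w x < 1} \<subseteq> U" using w_le_1_iff by (auto intro: less_imp_le)
  ultimately show "x \<in> interior U" using interior_maximal by blast
qed

lemma frontier_iff: "x \<in> frontier U \<longleftrightarrow> w x = 1"
  using interior_iff[of x] w_le_1_iff[of x] closed_U by (auto simp: frontier_def)

text \<open>The ray in the definition of the cone may start at any a, but moving it to 0 costs only
  a constant: t * w x \<le> w (a + t x) + w (- a) \<le> 1 + w (- a) for all t \<ge> 0.\<close>

lemma w_eq_0_iff: "w x = 0 \<longleftrightarrow> x \<in> char_cone U"
proof
  assume "w x = 0"
  then have "0 + t *\<^sub>R x \<in> U" if "t \<ge> 0" for t using that w_le_1_iff[of "t *\<^sub>R x"] w_scale[of t x] by simp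
  then show "x \<in> char_cone U" unfolding char_cone_def using zero_in by blast
next
  assume "x \<in> char_cone U"
  then obtain a where a: "\<And>t. t \<ge> 0 \<Longrightarrow> a + t *\<^sub>R x \<in> U" unfolding char_cone_def by blast
  define C where "C = 1 + w (- a)"
  have C: "C > 0" using w_nonneg[of "- a"] by (simp add: C_def)
  have b: "t * w x \<le> C" if "t \<ge> 0" for t
  proof -
    have "t * w x = w ((a + t *\<^sub>R x) + - a)" using w_scale[OF that] by simp
    also have "\<dots> \<le> w (a + t *\<^sub>R x) + w (- a)" by (rule w_add)
    also have "\<dots> \<le> C" using a[OF that] w_le_1_iff by (simp add: C_def)
    finally show ?thesis .
  qed
  show "w x = 0"
  proof (rule ccontr)
    assume "w x \<noteq> 0"
    then have "w x > 0" using w_nonneg[of x] by simp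
    then show False using b[of "2 * C / w x"] C by simp
  qed
qed

lemma translate:
  assumes "c \<in> interior U"
  shows "convex_nbhd ((\<lambda>u. u - c) ` U)"
proof
  have eq: "(\<lambda>u. u - c) ` A = (+) (- c) ` A" for A by (auto simp: image_def)
  show "closed ((\<lambda>u. u - c) ` U)" unfolding eq using closed_U by (rule closed_translation)
  show "convex ((\<lambda>u. u - c) ` U)" unfolding eq using convex_U by (simp add: convex_translation)
  have "c - c \<in> (\<lambda>u. u - c) ` interior U" using assms by blast
  then show "0 \<in> interior ((\<lambda>u. u - c) ` U)" unfolding eq interior_translation by simp
qed

end

text \<open>A single small step s > 0 suffices below: by homogeneity of w the inequalities it enters
  are linear in s up to the error, so s can be cancelled.\<close>

lemma has_derivative_direction:
  assumes "(f has_derivative f') (at p)" "e > 0" "d > (0::real)"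
  obtains s where "0 < s" "s < d" "norm (f (p + s *\<^sub>R q) - f p - s *\<^sub>R f' q) \<le> e * s"
proof -
  interpret bounded_linear f' using assms(1) by (rule has_derivative_bounded_linear)
  have "((\<lambda>s. p + s *\<^sub>R q) has_derivative (\<lambda>s. s *\<^sub>R q)) (at 0)"
    by (auto intro!: derivative_eq_intros)
  then have "((\<lambda>s. f (p + s *\<^sub>R q)) has_derivative (\<lambda>s. f' (s *\<^sub>R q))) (at 0)"
    by (rule has_derivative_compose[where g = f]) (use assms(1) in simp)
  then obtain d' where d': "d' > 0" "\<And>s. norm (s - 0) < d' \<Longrightarrow>
      norm (f (p + s *\<^sub>R q) - f (p + 0 *\<^sub>R q) - f' ((s - 0) *\<^sub>R q)) \<le> e * norm (s - 0)"
    unfolding has_derivative_within_alt using assms(2) by blast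
  define s where "s = min (d / 2) (d' / 2)"
  have s: "s > 0" "s < d" "s < d'" using assms(3) d'(1) by (auto simp: s_def)
  then show thesis using d'(2)[of s] by (intro that[of s]) (auto simp: scaleR)
qed

context convex_nbhd begin

lemma derivative_w_le:
  assumes "(w has_derivative w') (at p)"
  shows "w' q \<le> w q"
proof (rule field_le_epsilon)
  fix e :: real assume e: "e > 0"
  obtain s where s: "0 < s" "norm (w (p + s *\<^sub>R q) - w p - s *\<^sub>R w' q) \<le> e * s"
    using has_derivative_direction[OF assms e zero_less_one] by blast
  have "w (p + s *\<^sub>R q) \<le> w p + s * w q" using w_add[of p "s *\<^sub>R q"] w_scale[of s q] s by simp
  moreover have "s * w' q \<le> w (p + s *\<^sub>R q) - w p + e * s" using s(2) by (simp add: abs_le_iff)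
  ultimately have "s * w' q \<le> s * (w q + e)" by (simp add: algebra_simps)
  then show "w' q \<le> w q + e" using s(1) by simp
qed

text \<open>The step goes from p towards 0, where homogeneity gives the value of w exactly.\<close>

lemma derivative_w_self:
  assumes "(w has_derivative w') (at p)"
  shows "w p \<le> w' p"
proof (rule field_le_epsilon)
  fix e :: real assume e: "e > 0"
  interpret w': bounded_linear w' using assms by (rule has_derivative_bounded_linear)
  obtain s where s: "0 < s" "s < 1" "norm (w (p + s *\<^sub>R (- p)) - w p - s *\<^sub>R w' (- p)) \<le> e * s"
    using has_derivative_direction[OF assms e zero_less_one] by blast
  have "p + s *\<^sub>R (- p) = (1 - s) *\<^sub>R p" by (simp add: algebra_simps)
  then have "w (p + s *\<^sub>R (- p)) = (1 - s) * w p" using w_scale[of "1 - s" p] s by simp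
  then have "s * w p \<le> s * (w' p + e)" using s(3) by (simp add: w'.neg abs_le_iff algebra_simps)
  then show "w p \<le> w' p + e" using s(1) by simp
qed

text \<open>If the derivative of the defining function vanished at a in the direction a, the boundary would
  contain a curve \<open>a + s a + o(s)\<close>, on which the Minkowski functional exceeds 1.\<close>

lemma boundary_transversal:
  fixes \<theta> :: "'a \<Rightarrow> 'a" and \<psi> :: "'a \<Rightarrow> real"
  assumes W: "open W" and V: "open V" and bij: "bij_betw \<theta> W V"
    and C\<theta>: "Ck_on (Suc 0) \<theta> W" and C\<iota>: "Ck_on (Suc 0) (inv_into W \<theta>) V"
    and \<psi>: "bounded_linear \<psi>" and im: "\<theta> ` (W \<inter> frontier U) = V \<inter> {v. \<psi> v = 0}"
    and a: "a \<in> W" "a \<in> frontier U"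
  obtains f' where "((\<lambda>x. \<psi> (\<theta> x)) has_derivative f') (at a)" "f' a \<noteq> 0"
proof -
  define \<iota> where "\<iota> = inv_into W \<theta>"
  interpret \<psi>: bounded_linear \<psi> by (rule \<psi>)
  obtain \<theta>' where "\<And>x. x \<in> W \<Longrightarrow> (\<theta> has_derivative blinfun_apply (\<theta>' x)) (at x)"
    using Ck_on_SucE[OF W C\<theta>] by blast
  then have \<theta>': "(\<theta> has_derivative \<theta>' a) (at a)" using a by blast
  obtain \<iota>' where "\<And>x. x \<in> V \<Longrightarrow> (\<iota> has_derivative blinfun_apply (\<iota>' x)) (at x)"
    using Ck_on_SucE[OF V C\<iota>] unfolding \<iota>_def by blast
  moreover have b: "\<theta> a \<in> V" using bij a by (auto simp: bij_betw_def)
  ultimately have \<iota>': "(\<iota> has_derivative \<iota>' (\<theta> a)) (at (\<theta> a))" by blast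
  have inv: "\<iota> (\<theta> x) = x" if "x \<in> W" for x
    using bij that unfolding \<iota>_def bij_betw_def by (simp add: inv_into_f_f)
  have "((\<lambda>x. \<iota> (\<theta> x)) has_derivative (\<lambda>h. \<iota>' (\<theta> a) (\<theta>' a h))) (at a)"
    using \<theta>' \<iota>' by (rule has_derivative_compose)
  then have "((\<lambda>x. x) has_derivative (\<lambda>h. \<iota>' (\<theta> a) (\<theta>' a h))) (at a)"
    using W a(1) inv by (rule has_derivative_transform_within_open) auto
  then have id: "\<iota>' (\<theta> a) (\<theta>' a h) = h" for h
    using has_derivative_unique[OF has_derivative_ident] by metis
  have f': "((\<lambda>x. \<psi> (\<theta> x)) has_derivative (\<lambda>h. \<psi> (\<theta>' a h))) (at a)"
    using \<theta>' by (rule \<psi>.has_derivative)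
  show thesis
  proof (rule that[OF f'], rule notI)
    assume z: "\<psi> (\<theta>' a a) = 0"
    obtain r where r: "r > 0" "cball 0 r \<subseteq> U" by (rule ball_in)
    let ?q = "\<theta>' a a"
    have "((\<lambda>s. \<theta> a + s *\<^sub>R ?q) \<longlongrightarrow> \<theta> a + 0 *\<^sub>R ?q) (at 0)" by (intro tendsto_intros)
    then have "\<forall>\<^sub>F s in at 0. \<theta> a + s *\<^sub>R ?q \<in> V" using V b by (simp add: topological_tendstoD)
    then obtain d where d: "d > 0" "\<And>s. s \<noteq> 0 \<Longrightarrow> \<bar>s\<bar> < d \<Longrightarrow> \<theta> a + s *\<^sub>R ?q \<in> V"
      unfolding eventually_at by (auto simp: dist_real_def)
    \<comment> \<open>By \<open>id\<close> the curve s -> \<iota> (\<theta> a + s q) leaves a with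
      velocity a, and by z it stays in the boundary. Its error r / 2 * s is at most s / 2 under w,
      because w \<le> norm / r; this is less than the growth s of w along the ray.\<close>
    obtain s where s: "0 < s" "s < d" "norm (\<iota> (\<theta> a + s *\<^sub>R ?q) - \<iota> (\<theta> a) - s *\<^sub>R \<iota>' (\<theta> a) ?q) \<le> (r / 2) * s"
      using has_derivative_direction[OF \<iota>' half_gt_zero[OF r(1)] d(1)] by blast
    define k where "k = \<iota> (\<theta> a + s *\<^sub>R ?q)"
    have "\<psi> (\<theta> a) = 0" using im a by blast
    then have "\<theta> a + s *\<^sub>R ?q \<in> V \<inter> {v. \<psi> v = 0}"
      using d(2)[of s] s z by (simp add: \<psi>.add \<psi>.scaleR)
    then obtain y where "y \<in> W \<inter> frontier U" "\<theta> a + s *\<^sub>R ?q = \<theta> y" unfolding im[symmetric] by blast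
    then have wk: "w k = 1" using inv frontier_iff by (auto simp: k_def)
    have wa: "w a = 1" using a frontier_iff by blast
    have "norm ((1 + s) *\<^sub>R a - k) \<le> (r / 2) * s"
      using s(3) inv[OF a(1)] id[of a] unfolding k_def[symmetric]
      by (simp add: algebra_simps norm_minus_commute)
    then have "norm ((1 + s) *\<^sub>R a - k) / r \<le> (r / 2) * s / r"
      using r(1) by (intro divide_right_mono) auto
    with w_le_norm[OF r] have "w ((1 + s) *\<^sub>R a - k) \<le> (r / 2) * s / r" by (rule order_trans)
    then have "w ((1 + s) *\<^sub>R a - k) \<le> s / 2" using r(1) by simp
    moreover have "w ((1 + s) *\<^sub>R a) = 1 + s" using w_scale[of "1 + s" a] wa s by simp
    ultimately show False using w_diff[of "(1 + s) *\<^sub>R a" k] wk s by simp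
  qed
qed

lemma open_w_pos: "open {x. w x > 0}"
  by (intro open_Collect_less continuous_intros)

text \<open>Near a point x0 the equation is \<psi> (\<theta> (x / t)) = 0 with root t = w x. Its
  derivative in t at the root is - f' a' / w x, where a' is the boundary point on the ray of x, and
  \<open>boundary_transversal\<close> gives f' a' \<noteq> 0.\<close>

lemma Ck_on_w:
  assumes p: "1 \<le> p" "enat k \<le> p" "1 \<le> k" and U: "Cp_hypersurface p (frontier U)"
  shows "Ck_on k w {x. w x > 0}"
proof (rule Ck_on_local[OF open_w_pos])
  fix x0 assume "x0 \<in> {x. w x > 0}"
  then have x0: "w x0 > 0" by simp
  define a where "a = inverse (w x0) *\<^sub>R x0"
  have nrm: "w (inverse (w x) *\<^sub>R x) = 1" if "w x > 0" for x using w_scale[of "inverse (w x)" x] that by simp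
  have aF: "a \<in> frontier U" using nrm[OF x0] frontier_iff by (simp add: a_def)
  from bspec[OF U[unfolded Cp_hypersurface_def] aF]
  obtain W V and \<theta> :: "'a \<Rightarrow> 'a" and \<psi> :: "'a \<Rightarrow> real" where
    aW: "a \<in> W" and \<theta>: "Cp_diffeomorphism p \<theta> W V" and \<psi>: "bounded_linear \<psi>"
    and "\<psi> \<noteq> (\<lambda>x. 0)" and im: "\<theta> ` (W \<inter> frontier U) = V \<inter> {v. \<psi> v = 0}"
    by (elim exE conjE) (rule that)
  have W: "open W" and V: "open V" and bij: "bij_betw \<theta> W V"
    using \<theta> unfolding Cp_diffeomorphism_def by auto
  have "enat (Suc 0) \<le> p" using p(1) by (simp add: one_enat_def)
  then have C1: "Ck_on (Suc 0) \<theta> W" "Ck_on (Suc 0) (inv_into W \<theta>) V" and Ck: "Ck_on k \<theta> W"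
    using \<theta> p unfolding Cp_diffeomorphism_def Cp_on_def by auto
  define S where "S = {x. w x > 0} \<inter> (\<lambda>x. inverse (w x) *\<^sub>R x) -` W"
  have S: "open S"
    unfolding S_def by (intro continuous_open_preimage open_w_pos W continuous_intros) auto
  define P where "P = {p :: real \<times> 'a. fst p > 0}"
  have P: "open P" unfolding P_def by (intro open_Collect_less continuous_intros)
  define Q where "Q = P \<inter> (\<lambda>p. inverse (fst p) *\<^sub>R snd p) -` W"
  have Q: "open Q"
    unfolding Q_def by (intro continuous_open_preimage P W continuous_intros) (auto simp: P_def)
  have "Ck_on k (\<lambda>p :: real \<times> 'a. inverse (fst p) *\<^sub>R snd p) Q"
    using Q by (intro Ck_on_scaleR Ck_on_inverse Ck_on_linear bounded_linear_fst bounded_linear_snd)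
      (auto simp: Q_def P_def)
  then have "Ck_on k (\<lambda>p :: real \<times> 'a. \<theta> (inverse (fst p) *\<^sub>R snd p)) Q"
    using Ck by (rule Ck_on_compose[OF Q W]) (auto simp: Q_def)
  with \<psi> have CF: "Ck_on k (\<lambda>p :: real \<times> 'a. \<psi> (\<theta> (inverse (fst p) *\<^sub>R snd p))) Q"
    by (rule Ck_on_linear_post)
  have "Ck_on k w S"
  proof (rule Ck_on_implicit[OF Q CF p(3) S continuous_w])
    fix x assume x: "x \<in> S"
    define a' where "a' = inverse (w x) *\<^sub>R x"
    have wx: "w x > 0" and a'W: "a' \<in> W" using x by (auto simp: S_def a'_def)
    have a'F: "a' \<in> frontier U" using nrm[OF wx] frontier_iff by (simp add: a'_def)
    have "\<psi> (\<theta> a') = 0" using im a'W a'F by blast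
    then show "(w x, x) \<in> Q \<and> \<psi> (\<theta> (inverse (fst (w x, x)) *\<^sub>R snd (w x, x))) = 0"
      using wx a'W by (simp add: Q_def P_def a'_def)
    obtain f' where f': "((\<lambda>x. \<psi> (\<theta> x)) has_derivative f') (at a')" "f' a' \<noteq> 0"
      using boundary_transversal[OF W V bij C1 \<psi> im a'W a'F] .
    interpret f': bounded_linear f' using f'(1) by (rule has_derivative_bounded_linear)
    have "((\<lambda>t. inverse t *\<^sub>R x) has_derivative (\<lambda>h. (- (h * inverse (w x))) *\<^sub>R a')) (at (w x))"
      using wx by (auto intro!: derivative_eq_intros simp: a'_def algebra_simps)
    then have "((\<lambda>t. \<psi> (\<theta> (inverse t *\<^sub>R x))) has_derivative (\<lambda>h. f' ((- (h * inverse (w x))) *\<^sub>R a'))) (at (w x))"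
      by (rule has_derivative_compose[where g = "\<lambda>x. \<psi> (\<theta> x)"]) (use f'(1) in \<open>simp add: a'_def\<close>)
    moreover have "(\<lambda>h. f' ((- (h * inverse (w x))) *\<^sub>R a')) = (*) (- (inverse (w x) * f' a'))"
      unfolding f'.scaleR by (auto simp: fun_eq_iff)
    ultimately have "((\<lambda>t. \<psi> (\<theta> (inverse t *\<^sub>R x))) has_real_derivative - (inverse (w x) * f' a')) (at (w x))"
      unfolding has_field_derivative_def by simp
    then show "\<exists>d. d \<noteq> 0 \<and> ((\<lambda>t. \<psi> (\<theta> (inverse (fst (t, x)) *\<^sub>R snd (t, x)))) has_real_derivative d) (at (w x))"
      using wx f'(2) by (intro exI[of _ "- (inverse (w x) * f' a')"]) simp
  qed
  moreover have "x0 \<in> S" using x0 aW by (simp add: S_def a_def)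
  ultimately show "\<exists>T. open T \<and> x0 \<in> T \<and> Ck_on k w T" using S by blast
qed

text \<open>Smoothness of w is available only where w > 0. Where w vanishes, \<gamma> cuts it off:
  the composition is 0 on the open set w < 1/2.\<close>

lemma Ck_on_comp_w:
  fixes \<gamma> :: "real \<Rightarrow> real"
  assumes w: "Ck_on k w {x. w x > 0}" and \<gamma>: "Ck_on k \<gamma> UNIV" and z: "\<And>t. t \<le> 1/2 \<Longrightarrow> \<gamma> t = 0"
  shows "Ck_on k (\<lambda>x. \<gamma> (w x)) S"
proof (rule Ck_on_subset[OF Ck_on_local[OF open_UNIV] subset_UNIV])
  fix x :: 'a
  show "\<exists>T. open T \<and> x \<in> T \<and> Ck_on k (\<lambda>x. \<gamma> (w x)) T"
  proof (cases "w x > 0")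
    case True
    have "Ck_on k (\<lambda>x. \<gamma> (w x)) {x. w x > 0}"
      using open_w_pos open_UNIV w \<gamma> by (rule Ck_on_compose) simp
    then show ?thesis using True open_w_pos by blast
  next
    case False
    have "Ck_on k (\<lambda>x. \<gamma> (w x)) {x. w x < 1/2}"
      using Ck_on_const[of k 0] by (rule Ck_on_cong) (simp add: z)
    moreover have "open {x. w x < 1/2}" by (intro open_Collect_less continuous_intros)
    ultimately show ?thesis using False w_nonneg[of x] by (intro exI[of _ "{x. w x < 1/2}"]) auto
  qed
qed

end

section \<open>The map H in coordinates\<close>

locale flattening = convex_nbhd U
  for U :: "'a::real_normed_vector set" +
  fixes y :: 'a and \<phi> :: "'a \<Rightarrow> real" and \<gamma> lam :: "real \<Rightarrow> real"
  assumes y_cone: "y \<in> char_cone U" and y_frontier: "- y \<in> frontier U"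
    and \<phi>_linear: "bounded_linear \<phi>" and \<phi>_y: "\<phi> (- y) = -1" and \<phi>_U: "\<And>x. x \<in> U \<Longrightarrow> \<phi> x \<ge> -1"
    and lam_mono: "mono lam" and lam_0: "\<And>t. t \<le> 1/2 \<Longrightarrow> lam t = 0"
    and \<gamma>_0: "\<And>t. t \<le> 1/2 \<Longrightarrow> \<gamma> t = 0" and \<gamma>_top: "filterlim \<gamma> at_top at_top"
    and \<gamma>_deriv: "\<And>t. t > 0 \<Longrightarrow> 0 \<le> deriv \<gamma> t \<and> deriv \<gamma> t < (1 / t) * (\<gamma> t + 1)"
    and lam_smooth: "\<And>k. Ck_on k lam UNIV" and \<gamma>_smooth: "\<And>k. Ck_on k \<gamma> UNIV"
begin

sublocale \<phi>: bounded_linear \<phi> by (rule \<phi>_linear)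

lemma \<phi>_y1: "\<phi> y = 1"
  using \<phi>_y \<phi>.neg[of y] by simp

text \<open>For s \<ge> 0 the point lies in the characteristic cone; for s < 0 it is a positive
  multiple of the boundary point - y.\<close>

lemma w_y: "w (s *\<^sub>R y) = max 0 (- s)"
proof (cases "s \<ge> 0")
  case True
  have "w y = 0" using y_cone w_eq_0_iff by blast
  then show ?thesis using w_scale[OF True, of y] True by simp
next
  case False
  have "w (- y) = 1" using y_frontier frontier_iff by blast
  then show ?thesis using w_scale[of "- s" "- y"] False by simp
qed

lemma real_DERIV: "Ck_on (Suc 0) f UNIV \<Longrightarrow> (f has_real_derivative deriv f t) (at t)" for f :: "real \<Rightarrow> real"
  using Ck_on_SucE[OF open_UNIV, of 0 f] unfolding DERIV_deriv_iff_real_differentiable differentiable_def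
  by (metis UNIV_I)

lemmas \<gamma>_DERIV = real_DERIV[OF \<gamma>_smooth] and lam_DERIV = real_DERIV[OF lam_smooth]

lemma \<gamma>_deriv':
  assumes "t \<ge> 0"
  shows "0 \<le> t * deriv \<gamma> t" "t * deriv \<gamma> t < \<gamma> t + 1"
  using assms \<gamma>_deriv[of t] \<gamma>_0[of 0] by (cases "t = 0"; simp add: field_simps)+

lemma \<gamma>_nonneg: "\<gamma> t \<ge> 0"
proof (cases "t \<le> 0")
  case True then show ?thesis using \<gamma>_0[of t] by simp
next
  case False
  have "\<exists>z. (\<gamma> has_real_derivative z) (at x) \<and> z \<ge> 0" if "0 \<le> x" for x
  proof (cases "x = 0")
    case True
    \<comment> \<open>The bounds on the derivative are assumed for t > 0 only; at 0 it is computed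
      from \<gamma> = 0 nearby.\<close>
    have "(\<gamma> has_real_derivative 0) (at 0)"
      by (rule has_field_derivative_transform_within_open[of "\<lambda>x. 0" 0 0 "{..<1/2}"])
        (auto simp: \<gamma>_0 intro!: derivative_eq_intros)
    then show ?thesis using True by blast
  next
    case False
    then show ?thesis using that \<gamma>_DERIV \<gamma>_deriv[of x] by auto
  qed
  with False have "\<gamma> 0 \<le> \<gamma> t"
    using DERIV_nonneg_imp_nondecreasing[where f = \<gamma> and a = 0 and b = t] by simp
  then show ?thesis using \<gamma>_0[of 0] by simp
qed

lemma lam_nonneg: "lam t \<ge> 0"
  using monoD[OF lam_mono, of "min t 0" t] lam_0[of "min t 0"] by simp

lemma lam_deriv_nonneg: "deriv lam t \<ge> 0"
  using mono_on_imp_deriv_nonneg[OF lam_mono lam_DERIV, of t] by simp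

section \<open>The coordinates (\<alpha>, z) and the bijection \<Phi>\<close>

definition proj :: "'a \<Rightarrow> 'a" where "proj x = x - \<phi> x *\<^sub>R y"

lemma proj_linear: "bounded_linear proj"
  unfolding proj_def
  by (intro bounded_linear_sub bounded_linear_ident bounded_linear_scaleR_const \<phi>_linear)

lemma proj_decomp: "proj x + \<phi> x *\<^sub>R y = x"
  by (simp add: proj_def)

lemma \<phi>_proj: "\<phi> (proj x) = 0"
  by (simp add: proj_def \<phi>.diff \<phi>.scaleR \<phi>_y1)

definition N :: "'a set" where "N = - fixed_part U y \<phi>"

text \<open>Since \<phi> u = 0 and \<phi> y = 1, a representation x = u + s y in the fixed part can
  only have u = proj x and s = \<phi> x; the cone is the zero set of w.\<close>

lemma N_iff: "x \<in> N \<longleftrightarrow> w (proj x) > 0 \<or> \<phi> x < 0"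
proof -
  have "x \<in> fixed_part U y \<phi> \<longleftrightarrow> w (proj x) = 0 \<and> \<phi> x \<ge> 0"
  proof
    assume "x \<in> fixed_part U y \<phi>"
    then obtain u s where x: "x = u + s *\<^sub>R y" "u \<in> char_cone U" "\<phi> u = 0" "0 \<le> s"
      unfolding fixed_part_def by blast
    then have "\<phi> x = s" by (simp add: \<phi>.add \<phi>.scaleR \<phi>_y1)
    then show "w (proj x) = 0 \<and> \<phi> x \<ge> 0" using x w_eq_0_iff by (simp add: proj_def)
  next
    assume "w (proj x) = 0 \<and> \<phi> x \<ge> 0"
    then have "proj x \<in> char_cone U" "\<phi> x \<ge> 0" using w_eq_0_iff by auto
    then show "x \<in> fixed_part U y \<phi>"
      unfolding fixed_part_def mem_Collect_eq
      by (intro exI[of _ "proj x"] exI[of _ "\<phi> x"]) (simp add: proj_decomp \<phi>_proj)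
  qed
  then show ?thesis using w_nonneg[of "proj x"] by (auto simp: N_def)
qed

lemma continuous_proj [continuous_intros]: "continuous_on S f \<Longrightarrow> continuous_on S (\<lambda>x. proj (f x))"
  using bounded_linear.continuous_on[OF proj_linear] .

lemma continuous_\<phi> [continuous_intros]: "continuous_on S f \<Longrightarrow> continuous_on S (\<lambda>x. \<phi> (f x))"
  using bounded_linear.continuous_on[OF \<phi>_linear] .

lemma open_N: "open N"
proof -
  have "N = {x. w (proj x) > 0} \<union> {x. \<phi> x < 0}" using N_iff by auto
  also have "open \<dots>" by (intro open_Un open_Collect_less continuous_intros)
  finally show ?thesis .
qed

text \<open>\<open>height u\<close> is the value of \<phi> at the point \<open>\<Phi> (t, z)\<close> whose projection is u, that is, at
  \<open>z = u / t - y\<close>.\<close>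

definition height :: "'a \<Rightarrow> real \<Rightarrow> real" where
  "height u t = \<gamma> (w (inverse t *\<^sub>R u)) * (1 - t) - t"

text \<open>Here the growth bound on \<gamma> enters. With s = w u / t the derivative is - s
  \<gamma>'(s) / t + s \<gamma>'(s) - \<gamma>(s) - 1; the first term is at most 0, and s
  \<gamma>'(s) < \<gamma>(s) + 1.\<close>

lemma height_DERIV:
  assumes t: "t > 0"
  shows "\<exists>d<0. (height u has_real_derivative d) (at t)"
proof -
  define s where "s = w u * inverse t"
  have s: "s \<ge> 0" using t w_nonneg[of u] by (simp add: s_def)
  define d where "d = deriv \<gamma> s * (w u * (- (inverse t * 1 * inverse t))) * (1 - t) + (- 1) * \<gamma> s - 1"
  have "((\<lambda>t. \<gamma> (w u * inverse t) * (1 - t) - t) has_real_derivative d) (at t)"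
    unfolding d_def s_def
    by (rule derivative_eq_intros DERIV_chain2[OF \<gamma>_DERIV] refl | use t in simp)+
  then have "(height u has_real_derivative d) (at t)"
  proof (rule has_field_derivative_transform_within_open[where S = "{0<..}"])
    show "\<gamma> (w u * inverse t) * (1 - t) - t = height u t" if "t \<in> {0<..}" for t
      using w_scale[of "inverse t" u] that by (simp add: height_def mult.commute)
  qed (use t in auto)
  moreover have "d < 0"
  proof -
    have "d = - (s * deriv \<gamma> s) / t + s * deriv \<gamma> s - \<gamma> s - 1"
      using t unfolding d_def s_def by (simp add: field_simps)
    moreover have "- (s * deriv \<gamma> s) / t \<le> 0" using t \<gamma>_deriv'(1)[OF s] by simp
    ultimately show ?thesis using \<gamma>_deriv'(2)[OF s] by linarith
  qed
  ultimately show ?thesis by blast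
qed

lemma height_decreasing: "0 < s \<Longrightarrow> s < t \<Longrightarrow> height u t < height u s"
  using height_DERIV[of _ u] DERIV_neg_imp_decreasing[where f = "height u"] by (meson less_le_trans)

lemma height_inj: "0 < s \<Longrightarrow> 0 < t \<Longrightarrow> height u s = height u t \<Longrightarrow> s = t"
  by (metis height_decreasing linorder_neqE_linordered_idom order_less_irrefl)

text \<open>If v = w (proj x) is positive, the height exceeds any bound as t tends to 0, since
  \<gamma> (v / t) does, and equals - t for t \<ge> 2 v. If v = 0, it is - t throughout and takes
  exactly the negative values, which is the condition on \<phi> x in \<open>N_iff\<close>.\<close>

lemma height_surj:
  assumes x: "x \<in> N"
  obtains t where "t > 0" "height (proj x) t = \<phi> x"
proof (cases "w (proj x) = 0")
  case True
  then have "\<phi> x < 0" using x N_iff by auto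
  moreover have "height (proj x) (- \<phi> x) = \<phi> x"
    using w_scale[of "inverse (- \<phi> x)" "proj x"] True \<gamma>_0[of 0] \<open>\<phi> x < 0\<close> by (simp add: height_def)
  ultimately show thesis by (intro that[of "- \<phi> x"]) auto
next
  case False
  define v where "v = w (proj x)"
  have v: "v > 0" using False w_nonneg[of "proj x"] by (simp add: v_def)
  have h: "height (proj x) t = \<gamma> (v / t) * (1 - t) - t" if "t > 0" for t
    using w_scale[of "inverse t" "proj x"] that by (simp add: height_def v_def divide_inverse mult.commute)
  \<comment> \<open>Since a \<le> 1/2 below, a value of \<gamma> of at least 2 * \<bar>\<phi>
    x\<bar> + 1 gives a height of at least (\<bar>\<phi> x\<bar> + 1/2) - 1/2.\<close>
  have "\<forall>\<^sub>F s in at_top. \<gamma> s \<ge> 2 * \<bar>\<phi> x\<bar> + 1" using \<gamma>_top by (simp add: filterlim_at_top)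
  then obtain s0 where s0: "\<And>s. s \<ge> s0 \<Longrightarrow> \<gamma> s \<ge> 2 * \<bar>\<phi> x\<bar> + 1" by (auto simp: eventually_at_top_linorder)
  define a where "a = min (1/2) (v / max s0 1)"
  have a: "a > 0" "a \<le> 1/2" "v / a \<ge> s0"
  proof -
    show "a > 0" using v by (simp add: a_def)
    show "a \<le> 1/2" unfolding a_def by (rule min.cobounded1)
    have "a \<le> v / max s0 1" by (simp add: a_def)
    then have "a * max s0 1 \<le> v" by (subst (asm) pos_le_divide_eq) auto
    then have "max s0 1 \<le> v / a" using \<open>a > 0\<close> by (simp only: pos_le_divide_eq mult.commute)
    then show "v / a \<ge> s0" by simp
  qed
  have "\<gamma> (v / a) * (1 - a) \<ge> (2 * \<bar>\<phi> x\<bar> + 1) * (1/2)"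
    using a s0[OF a(3)] by (intro mult_mono) auto
  then have ha: "height (proj x) a \<ge> \<phi> x" using h[OF a(1)] a(2) by simp
  \<comment> \<open>b \<ge> 2 v switches \<gamma> off, so the height at b is - b, and b exceeds
    \<bar>\<phi> x\<bar>. The summand 1 puts b to the right of a.\<close>
  define b where "b = max (2 * v) (\<bar>\<phi> x\<bar> + 1)"
  have b: "b \<ge> 1" "v / b \<le> 1/2" "b \<ge> \<bar>\<phi> x\<bar>"
  proof -
    show b1: "b \<ge> 1" and "b \<ge> \<bar>\<phi> x\<bar>" by (auto simp: b_def)
    have "2 * v \<le> b" by (simp add: b_def)
    then show "v / b \<le> 1/2" using b1 by (simp add: field_simps)
  qed
  have hb: "height (proj x) b \<le> \<phi> x" using h[of b] \<gamma>_0[OF b(2)] b by simp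
  have "\<exists>t\<ge>a. t \<le> b \<and> height (proj x) t = \<phi> x"
  proof (rule IVT2[where f = "height (proj x)"])
    show "height (proj x) b \<le> \<phi> x" "\<phi> x \<le> height (proj x) a" by (fact hb ha)+
    show "a \<le> b" using a b by simp
    show "\<forall>t. a \<le> t \<and> t \<le> b \<longrightarrow> isCont (height (proj x)) t"
      using height_DERIV a(1) DERIV_isCont by (meson less_le_trans)
  qed
  then show thesis using a(1) that by (meson less_le_trans)
qed

lemma c_map_eq: "c_map U y \<gamma> z = \<gamma> (w (y + z)) *\<^sub>R y"
  by (simp add: c_map_def)

text \<open>c z is a multiple of y, so the projection along y removes it and leaves t (z + y). Hence
  z is known once t is, and \<phi> gives a scalar equation for t alone.\<close>

lemma Phi_coords:
  assumes t: "t > 0" and z: "\<phi> z = -1" and x: "x = Phi_map U y \<gamma> (t, z)"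
  shows "proj x = t *\<^sub>R (y + z)" "height (proj x) t = \<phi> x" "x \<in> N"
proof -
  define g where "g = \<gamma> (w (y + z))"
  have xe: "x = g *\<^sub>R y + t *\<^sub>R (z - g *\<^sub>R y)" using x by (simp add: Phi_map_def c_map_eq g_def)
  have \<phi>x: "\<phi> x = g * (1 - t) - t"
    unfolding xe by (simp add: \<phi>.add \<phi>.diff \<phi>.scaleR \<phi>_y1 z algebra_simps)
  show p: "proj x = t *\<^sub>R (y + z)"
    unfolding proj_def \<phi>x unfolding xe by (simp add: algebra_simps)
  show h: "height (proj x) t = \<phi> x"
    unfolding height_def p \<phi>x g_def using t by simp
  have "\<phi> x < 0" if "w (proj x) = 0"
  proof -
    have "w (y + z) = 0" using that w_scale[of t "y + z"] t unfolding p by simp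
    then have "g = 0" using \<gamma>_0[of 0] by (simp add: g_def)
    then show ?thesis using t \<phi>x by simp
  qed
  then show "x \<in> N" using N_iff w_nonneg[of "proj x"] by force
qed

lemma Phi_of_coords:
  assumes t: "t > 0" and h: "height (proj x) t = \<phi> x"
  shows "Phi_map U y \<gamma> (t, inverse t *\<^sub>R proj x - y) = x"
proof -
  define g where "g = \<gamma> (w (inverse t *\<^sub>R proj x))"
  have \<phi>x: "\<phi> x = g * (1 - t) - t" using h by (simp add: height_def g_def)
  have "Phi_map U y \<gamma> (t, inverse t *\<^sub>R proj x - y) =
      g *\<^sub>R y + t *\<^sub>R (inverse t *\<^sub>R proj x - y - g *\<^sub>R y)"
    by (simp add: Phi_map_def c_map_eq g_def)
  also have "\<dots> = proj x + (g * (1 - t) - t) *\<^sub>R y" using t by (simp add: algebra_simps)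
  also have "\<dots> = x" using proj_decomp[of x] \<phi>x by simp
  finally show ?thesis .
qed

lemma bij_Phi: "bij_betw (Phi_map U y \<gamma>) ({0<..} \<times> Z_plane \<phi>) N"
  unfolding bij_betw_def
proof
  show "inj_on (Phi_map U y \<gamma>) ({0<..} \<times> Z_plane \<phi>)"
  proof (rule inj_onI, clarsimp simp: Z_plane_def)
    fix s z t z' assume s: "0 < (s::real)" "\<phi> z = -1" and t: "0 < t" "\<phi> z' = -1"
      and eq: "Phi_map U y \<gamma> (s, z) = Phi_map U y \<gamma> (t, z')"
    note 1 = Phi_coords[OF s refl] and 2 = Phi_coords[OF t refl]
    have st: "s = t" using height_inj[OF s(1) t(1)] 1(2) 2(2) unfolding eq by metis
    have "s *\<^sub>R (y + z) = t *\<^sub>R (y + z')" using 1(1) 2(1) unfolding eq by simp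
    then show "s = t \<and> z = z'" using st s(1) by simp
  qed
  show "Phi_map U y \<gamma> ` ({0<..} \<times> Z_plane \<phi>) = N"
  proof (intro equalityI subsetI)
    fix x assume "x \<in> Phi_map U y \<gamma> ` ({0<..} \<times> Z_plane \<phi>)"
    then show "x \<in> N" using Phi_coords(3) by (auto simp: Z_plane_def)
  next
    fix x assume "x \<in> N"
    then obtain t where t: "t > 0" "height (proj x) t = \<phi> x" by (rule height_surj)
    have "\<phi> (inverse t *\<^sub>R proj x - y) = -1" by (simp add: \<phi>.diff \<phi>.scaleR \<phi>_proj \<phi>_y1)
    then show "x \<in> Phi_map U y \<gamma> ` ({0<..} \<times> Z_plane \<phi>)"
      using Phi_of_coords[OF t] t(1) by (intro image_eqI[of _ _ "(t, inverse t *\<^sub>R proj x - y)"]) (auto simp: Z_plane_def)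
  qed
qed

text \<open>\<open>A\<close> and \<open>\<zeta>\<close> are the coordinates \<alpha> and z of a
  point; they carry information only on N, the range of \<Phi>.\<close>

definition A :: "'a \<Rightarrow> real" where
  "A x = fst (inv_into ({0<..} \<times> Z_plane \<phi>) (Phi_map U y \<gamma>) x)"

definition \<zeta> :: "'a \<Rightarrow> 'a" where
  "\<zeta> x = snd (inv_into ({0<..} \<times> Z_plane \<phi>) (Phi_map U y \<gamma>) x)"

lemma A_\<zeta>:
  assumes "x \<in> N"
  shows "A x > 0" "\<phi> (\<zeta> x) = -1" "Phi_map U y \<gamma> (A x, \<zeta> x) = x"
proof -
  have "inv_into ({0<..} \<times> Z_plane \<phi>) (Phi_map U y \<gamma>) x \<in> {0<..} \<times> Z_plane \<phi>"
    using assms bij_betw_imp_surj_on[OF bij_Phi] by (intro inv_into_into) simp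
  then show "A x > 0" "\<phi> (\<zeta> x) = -1" by (auto simp: A_def \<zeta>_def Z_plane_def)
  show "Phi_map U y \<gamma> (A x, \<zeta> x) = x"
    using assms bij_betw_inv_into_right[OF bij_Phi] by (simp add: A_def \<zeta>_def)
qed

lemma A_\<zeta>_Phi:
  assumes "t > 0" "\<phi> z = -1"
  shows "A (Phi_map U y \<gamma> (t, z)) = t" "\<zeta> (Phi_map U y \<gamma> (t, z)) = z"
proof -
  have "inv_into ({0<..} \<times> Z_plane \<phi>) (Phi_map U y \<gamma>) (Phi_map U y \<gamma> (t, z)) = (t, z)"
    using assms by (intro bij_betw_inv_into_left[OF bij_Phi]) (auto simp: Z_plane_def)
  then show "A (Phi_map U y \<gamma> (t, z)) = t" "\<zeta> (Phi_map U y \<gamma> (t, z)) = z"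
    by (auto simp: A_def \<zeta>_def)
qed

lemma height_A: "x \<in> N \<Longrightarrow> height (proj x) (A x) = \<phi> x"
  using Phi_coords(2)[of "A x" "\<zeta> x" x] A_\<zeta>[of x] by simp

lemma \<zeta>_eq: "x \<in> N \<Longrightarrow> \<zeta> x = inverse (A x) *\<^sub>R proj x - y"
  using Phi_coords(1)[of "A x" "\<zeta> x" x] A_\<zeta>[of x] by simp

section \<open>The shifted functional W\<close>

abbreviation W :: "'a \<Rightarrow> real" where "W \<equiv> w_shift U y \<gamma>"

lemma c_interior: "c_map U y \<gamma> z \<in> interior U"
  using \<gamma>_nonneg[of "w (y + z)"] by (simp add: interior_iff c_map_eq w_y)

text \<open>c varies with z, and so does the body whose functional W is. These equivalences describe
  W by the fixed functional w along the ray from c through z, which makes the smoothness of w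
  applicable.\<close>

lemma W_facts:
  fixes z
  defines "c \<equiv> c_map U y \<gamma> z"
  shows W_le_iff: "t > 0 \<Longrightarrow> W z \<le> t \<longleftrightarrow> w (c + inverse t *\<^sub>R (z - c)) \<le> 1"
    and W_less_iff: "t > 0 \<Longrightarrow> W z < t \<longleftrightarrow> w (c + inverse t *\<^sub>R (z - c)) < 1"
    and W_nonneg: "W z \<ge> 0"
proof -
  interpret V: convex_nbhd "(\<lambda>u. u - c) ` U" using translate c_interior unfolding c_def by blast
  have Wz: "W z = minkowski_functional ((\<lambda>u. u - c) ` U) (z - c)" unfolding w_shift_def c_def ..
  have mem: "u \<in> (\<lambda>u. u - c) ` S \<longleftrightarrow> c + u \<in> S" for u S
    by (auto intro!: image_eqI[of _ _ "c + u"])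
  have int: "interior ((\<lambda>u. u - c) ` U) = (\<lambda>u. u - c) ` interior U"
    using interior_translation[of "- c" U] by (simp add: image_def)
  show "W z \<ge> 0" unfolding Wz by (rule V.w_nonneg)
  assume t: "t > 0"
  show "W z \<le> t \<longleftrightarrow> w (c + inverse t *\<^sub>R (z - c)) \<le> 1"
    unfolding Wz V.w_le_iff[OF t] mem w_le_1_iff ..
  have "W z < t \<longleftrightarrow> minkowski_functional ((\<lambda>u. u - c) ` U) (inverse t *\<^sub>R (z - c)) < 1"
  proof -
    have "a < t \<longleftrightarrow> inverse t * a < 1" for a using t by (simp add: field_simps)
    then show ?thesis using V.w_scale[of "inverse t" "z - c"] t unfolding Wz by simp
  qed
  also have "\<dots> \<longleftrightarrow> w (c + inverse t *\<^sub>R (z - c)) < 1"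
    unfolding V.interior_iff[symmetric] int mem interior_iff ..
  finally show "W z < t \<longleftrightarrow> w (c + inverse t *\<^sub>R (z - c)) < 1" .
qed

text \<open>Points of the ray from c beyond z have \<phi> < -1, because \<phi> c \<ge> 0 and \<phi>
  z = -1; hence they are outside U.\<close>

lemma W_ge_1:
  assumes z: "\<phi> z = -1"
  shows "W z \<ge> 1"
proof (rule ccontr)
  assume "\<not> W z \<ge> 1"
  define t where "t = (W z + 1) / 2"
  have t: "t > 0" "t < 1" "W z \<le> t" using \<open>\<not> W z \<ge> 1\<close> W_nonneg[of z] by (auto simp: t_def)
  let ?g = "\<gamma> (w (y + z))" and ?c = "c_map U y \<gamma> z"
  have "?c + inverse t *\<^sub>R (z - ?c) \<in> U" using W_le_iff[OF t(1)] t(3) w_le_1_iff by blast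
  then have "\<phi> (?c + inverse t *\<^sub>R (z - ?c)) \<ge> -1" by (rule \<phi>_U)
  then have "?g + inverse t * (- 1 - ?g) \<ge> -1"
    by (simp add: \<phi>.add \<phi>.diff \<phi>.scaleR c_map_eq \<phi>_y1 z)
  then have "inverse t * (1 + ?g) \<le> 1 * (1 + ?g)" by (simp add: algebra_simps)
  moreover have "1 + ?g > 0" using \<gamma>_nonneg[of "w (y + z)"] by linarith
  ultimately have "inverse t \<le> 1" by (simp only: mult_le_cancel_right_pos)
  then show False using t by (simp add: field_simps)
qed

section \<open>The stretch of the first coordinate and the inverse of H\<close>

definition stretch :: "real \<Rightarrow> real \<Rightarrow> real" where
  "stretch v t = t * lam (t * v) * (v - 1) + t"

lemma Psi_stretch: "Psi_map U y \<gamma> lam (t, z) = (stretch (W z) t, z)"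
  by (simp add: Psi_map_def stretch_def)

lemma stretch_ge: "v \<ge> 1 \<Longrightarrow> t > 0 \<Longrightarrow> stretch v t \<ge> t"
  using lam_nonneg[of "t * v"] by (simp add: stretch_def)

text \<open>\<lambda> is nonnegative and non-decreasing and v \<ge> 1, so the derivative is at least
  1.\<close>

lemma stretch_DERIV:
  assumes "v \<ge> 1" "t > 0"
  shows "\<exists>d>0. (stretch v has_real_derivative d) (at t)"
proof -
  define d where "d = (t * (deriv lam (t * v) * (1 * v)) + 1 * lam (t * v)) * (v - 1) + 1"
  have "(stretch v has_real_derivative d) (at t)"
    unfolding d_def stretch_def
    by (rule derivative_eq_intros DERIV_chain2[OF lam_DERIV] refl | simp)+
  moreover have "(t * (deriv lam (t * v) * (1 * v)) + 1 * lam (t * v)) * (v - 1) \<ge> 0"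
    using assms lam_nonneg[of "t * v"] lam_deriv_nonneg[of "t * v"]
    by (intro mult_nonneg_nonneg add_nonneg_nonneg) auto
  then have "d > 0" by (simp add: d_def)
  ultimately show ?thesis by blast
qed

lemma stretch_increasing: "v \<ge> 1 \<Longrightarrow> 0 < s \<Longrightarrow> s < t \<Longrightarrow> stretch v s < stretch v t"
  using stretch_DERIV[of v] DERIV_pos_imp_increasing[where f = "stretch v"] by (meson less_le_trans)

lemma sgn_stretch:
  "v \<ge> 1 \<Longrightarrow> 0 < s \<Longrightarrow> 0 < t \<Longrightarrow> sgn (stretch v t - stretch v s) = sgn (t - s)"
  using stretch_increasing[of v s t] stretch_increasing[of v t s]
  by (cases s t rule: linorder_cases) auto

lemma stretch_surj:
  assumes v: "v \<ge> 1" and b: "b > 0"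
  obtains t where "t > 0" "stretch v t = b"
proof -
  \<comment> \<open>For t \<le> 1 / (2 v) the factor \<lambda> (t v) vanishes and the stretch is the
    identity, so a is mapped to itself, which is at most b.\<close>
  define a where "a = min b (1 / (2 * v))"
  have a: "a > 0" "a \<le> b" using v b by (auto simp: a_def)
  have "a \<le> 1 / (2 * v)" by (simp add: a_def)
  then have "a * v \<le> 1/2" using v by (simp add: field_simps)
  then have "stretch v a = a" using lam_0 by (simp add: stretch_def)
  then have 1: "stretch v a \<le> b" using a by simp
  have 2: "b \<le> stretch v b" using stretch_ge[OF v b] .
  have "\<exists>t\<ge>a. t \<le> b \<and> stretch v t = b"
  proof (rule IVT[where f = "stretch v"])
    show "stretch v a \<le> b" "b \<le> stretch v b" "a \<le> b" by (fact 1 2 a(2))+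
    show "\<forall>t. a \<le> t \<and> t \<le> b \<longrightarrow> isCont (stretch v) t"
      using stretch_DERIV[OF v] a(1) DERIV_isCont by (meson less_le_trans)
  qed
  then obtain t where "t \<ge> a" "stretch v t = b" by blast
  with a(1) show thesis by (intro that[of t]) auto
qed

abbreviation H :: "'a \<Rightarrow> 'a" where "H \<equiv> H_map U y \<phi> \<gamma> lam"

lemma H_not_N: "x \<notin> N \<Longrightarrow> H x = x"
  by (simp add: H_map_def N_def)

lemma H_N: "x \<in> N \<Longrightarrow> H x = Phi_map U y \<gamma> (stretch (W (\<zeta> x)) (A x), \<zeta> x)"
  using Psi_stretch[of "A x" "\<zeta> x"] by (simp add: H_map_def N_def A_def \<zeta>_def)

text \<open>\<Psi> keeps z, so W (\<zeta> x) is the same for a point and its image, and inverting H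
  amounts to inverting one scalar function. \<open>B x\<close> is the first coordinate of the
  preimage of x.\<close>

definition B :: "'a \<Rightarrow> real" where
  "B x = (SOME t. t > 0 \<and> stretch (W (\<zeta> x)) t = A x)"

lemma B_facts:
  assumes "x \<in> N"
  shows B_pos: "B x > 0" and stretch_B: "stretch (W (\<zeta> x)) (B x) = A x"
proof -
  have "\<exists>t. t > 0 \<and> stretch (W (\<zeta> x)) t = A x"
    using stretch_surj[OF W_ge_1 A_\<zeta>(1)[OF assms]] A_\<zeta>(2)[OF assms] by metis
  then have "B x > 0 \<and> stretch (W (\<zeta> x)) (B x) = A x" unfolding B_def by (rule someI_ex)
  then show "B x > 0" "stretch (W (\<zeta> x)) (B x) = A x" by auto
qed

definition K :: "'a \<Rightarrow> 'a" where
  "K x = (if x \<in> N then Phi_map U y \<gamma> (B x, \<zeta> x) else x)"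

lemma H_coords:
  assumes "x \<in> N"
  shows "H x \<in> N" "A (H x) = stretch (W (\<zeta> x)) (A x)" "\<zeta> (H x) = \<zeta> x"
proof -
  note z = A_\<zeta>(2)[OF assms] and a = A_\<zeta>(1)[OF assms]
  have s: "stretch (W (\<zeta> x)) (A x) > 0" using stretch_ge[OF W_ge_1[OF z] a] a by simp
  show "H x \<in> N" "A (H x) = stretch (W (\<zeta> x)) (A x)" "\<zeta> (H x) = \<zeta> x"
    unfolding H_N[OF assms] using Phi_coords(3)[OF s z refl] A_\<zeta>_Phi[OF s z] by auto
qed

lemma K_H: "K (H x) = x"
proof (cases "x \<in> N")
  case True
  note h = H_coords[OF True] and z = A_\<zeta>(2)[OF True] and a = A_\<zeta>(1)[OF True]
  have "stretch (W (\<zeta> x)) (B (H x)) = stretch (W (\<zeta> x)) (A x)"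
    using stretch_B[OF h(1)] h by simp
  then have "sgn (B (H x) - A x) = 0"
    using sgn_stretch[OF W_ge_1[OF z] a B_pos[OF h(1)]] by simp
  then have "B (H x) = A x" by (simp add: sgn_eq_0_iff)
  then show ?thesis using h A_\<zeta>(3)[OF True] by (simp add: K_def)
qed (simp add: H_not_N K_def)

lemma H_K: "H (K x) = x"
proof (cases "x \<in> N")
  case True
  note z = A_\<zeta>(2)[OF True]
  have Kx: "K x = Phi_map U y \<gamma> (B x, \<zeta> x)" using True by (simp add: K_def)
  have KN: "K x \<in> N" unfolding Kx using Phi_coords(3)[OF B_pos[OF True] z refl] .
  have "A (K x) = B x" "\<zeta> (K x) = \<zeta> x"
    unfolding Kx using A_\<zeta>_Phi[OF B_pos[OF True] z] by auto
  then show ?thesis using H_N[OF KN] stretch_B[OF True] A_\<zeta>(3)[OF True] by simp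
qed (simp add: H_not_N K_def)

text \<open>\<open>2 x - c\<close> lies in U exactly when \<open>\<alpha> w \<le> 1/2\<close>, and there \<lambda> vanishes.\<close>

lemma H_fix_criterion:
  assumes x: "x \<in> N" and le: "2 * w (proj x) + max 0 (\<gamma> (w (y + \<zeta> x)) - 2 * \<phi> x) \<le> 1"
  shows "H x = x"
proof -
  note z = A_\<zeta>(2)[OF x] and a = A_\<zeta>(1)[OF x]
  define g where "g = \<gamma> (w (y + \<zeta> x))"
  \<comment> \<open>For this t the point c + (z - c) / t in \<open>W_le_iff\<close> is 2 x - c,
    because x = c + \<alpha> (z - c).\<close>
  let ?c = "c_map U y \<gamma> (\<zeta> x)" and ?t = "1 / (2 * A x)"
  have xe: "x = ?c + A x *\<^sub>R (\<zeta> x - ?c)" using A_\<zeta>(3)[OF x] by (simp add: Phi_map_def)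
  have "?c + inverse ?t *\<^sub>R (\<zeta> x - ?c) = 2 *\<^sub>R (?c + A x *\<^sub>R (\<zeta> x - ?c)) - ?c"
    by (simp add: algebra_simps scaleR_2)
  also have "\<dots> = 2 *\<^sub>R x - g *\<^sub>R y" unfolding xe[symmetric] by (simp add: c_map_eq g_def)
  also have "\<dots> = 2 *\<^sub>R (proj x + \<phi> x *\<^sub>R y) - g *\<^sub>R y" unfolding proj_decomp ..
  also have "\<dots> = 2 *\<^sub>R proj x + (2 * \<phi> x - g) *\<^sub>R y" by (simp add: algebra_simps)
  finally have "w (?c + inverse ?t *\<^sub>R (\<zeta> x - ?c)) \<le> w (2 *\<^sub>R proj x) + w ((2 * \<phi> x - g) *\<^sub>R y)"
    using w_add by simp
  also have "\<dots> \<le> 1" using le w_scale[of 2 "proj x"] by (simp add: w_y g_def)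
  finally have "W (\<zeta> x) \<le> ?t" using W_le_iff[of ?t "\<zeta> x"] a by simp
  then have "A x * W (\<zeta> x) \<le> 1/2" using a by (simp add: field_simps)
  then have "stretch (W (\<zeta> x)) (A x) = A x" by (simp add: stretch_def lam_0)
  then show ?thesis using H_N[OF x] A_\<zeta>(3)[OF x] by simp
qed

text \<open>With a = A x and g = \<gamma> (w (proj x) / a), the point is g - 2 \<phi> x \<le> 1/2.
  Either g = 0, or w (proj x) / a > 1/2 and a is tiny; then g (1 - a) - a = \<phi> x gives (g - 2
  \<phi> x) (1 - a) = a - \<phi> x + 2 a \<phi> x \<le> 1/4, where 1 - a \<ge> 1/2.\<close>

lemma H_id_near_fixed:
  assumes x0: "x0 \<notin> N"
  obtains T where "open T" "x0 \<in> T" "\<And>x. x \<in> T \<Longrightarrow> H x = x"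
proof -
  have f0: "w (proj x0) = 0" "\<phi> x0 \<ge> 0" using x0 N_iff[of x0] w_nonneg[of "proj x0"] by auto
  define M where "M = \<phi> x0 + 1"
  \<comment> \<open>If a < 2 * \<epsilon>, then 2 a M + 2 a \<le> 1/8; together with - \<phi> x <
    1/8 this yields the bound 1/4 below.\<close>
  define \<epsilon> where "\<epsilon> = 1 / (32 * (M + 1))"
  have M: "M \<ge> 1" using f0 by (simp add: M_def)
  have \<epsilon>: "\<epsilon> > 0" "\<epsilon> \<le> 1/64" "2 * \<epsilon> * (2 * M + 2) = 1/8" using M by (auto simp: \<epsilon>_def field_simps)
  \<comment> \<open>If \<phi> x0 = 0, every neighbourhood of x0 contains points with negative
    \<phi>, hence the margin 1/8.\<close>
  define T where "T = {x. w (proj x) < \<epsilon>} \<inter> {x. - (1/8) < \<phi> x} \<inter> {x. \<phi> x < M}"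
  show thesis
  proof (rule that[of T])
    show "open T" unfolding T_def by (intro open_Int open_Collect_less continuous_intros)
    show "x0 \<in> T" using f0 \<epsilon> by (simp add: T_def M_def)
    fix x assume "x \<in> T"
    then have T: "w (proj x) < \<epsilon>" "- (1/8) < \<phi> x" "\<phi> x < M" by (auto simp: T_def)
    show "H x = x"
    proof (cases "x \<in> N")
      case True
      define a g where "a = A x" and "g = \<gamma> (w (y + \<zeta> x))"
      have a: "a > 0" using A_\<zeta>(1)[OF True] by (simp add: a_def)
      have ws: "w (y + \<zeta> x) = inverse a * w (proj x)"
        using \<zeta>_eq[OF True] w_scale[of "inverse a" "proj x"] a by (simp add: a_def)
      have b: "\<phi> x = g * (1 - a) - a"
        using height_A[OF True] \<zeta>_eq[OF True] by (simp add: height_def g_def a_def)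
      have "g - 2 * \<phi> x \<le> 1/2"
      proof (cases "inverse a * w (proj x) \<le> 1/2")
        case True
        then have "g = 0" unfolding g_def ws by (rule \<gamma>_0)
        then show ?thesis using b T(2) by simp
      next
        case False
        then have a2: "a < 2 * \<epsilon>" using T(1) a by (simp add: field_simps)
        have aM: "a * (2 * M + 2) \<le> 1/8"
          using mult_right_mono[of a "2 * \<epsilon>" "2 * M + 2"] a2 \<epsilon>(3) M by simp
        have "a * \<phi> x \<le> a * M" using a T(3) by (intro mult_left_mono) auto
        moreover have "(g - 2 * \<phi> x) * (1 - a) = a - \<phi> x + 2 * (a * \<phi> x)"
          using b by (simp add: algebra_simps)
        moreover have "a * (2 * M + 2) = 2 * (a * M) + 2 * a" by (simp add: algebra_simps)
        ultimately have le: "(g - 2 * \<phi> x) * (1 - a) \<le> 1/4"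
          using aM T(2) a by linarith
        have a1: "a \<le> 1/2" using a2 \<epsilon>(2) by simp
        show ?thesis
        proof (rule ccontr)
          assume "\<not> g - 2 * \<phi> x \<le> 1/2"
          then have "(1/2) * (1/2) < (g - 2 * \<phi> x) * (1 - a)"
            using a1 by (intro mult_less_le_imp_less) auto
          then show False using le by simp
        qed
      qed
      then show ?thesis using T(1) \<epsilon>(2) by (intro H_fix_criterion[OF True]) (simp add: g_def)
    qed (simp add: H_not_N)
  qed
qed

end

section \<open>Smoothness of H and its inverse\<close>

context flattening begin

abbreviation Q :: "(real \<times> 'a) set" where "Q \<equiv> {0<..} \<times> N"

lemma open_Q: "open Q"
  by (intro open_Times open_greaterThan open_N)

lemma Ck_on_snd: "Ck_on k f N \<Longrightarrow> Ck_on k (\<lambda>p. f (snd p)) Q"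
  by (rule Ck_on_subset[OF Ck_on_linear_pre[OF bounded_linear_snd open_N]]) auto

lemma Ck_on_fst: "Ck_on k (fst :: real \<times> 'a \<Rightarrow> real) Q"
  by (rule Ck_on_linear[OF bounded_linear_fst])

lemma Ck_on_inverse_fst: "Ck_on k (\<lambda>p :: real \<times> 'a. inverse (fst p)) Q"
  by (rule Ck_on_inverse[OF open_Q Ck_on_fst]) auto

section \<open>Smoothness of the coordinates, of W and of the inverse stretch at a fixed
  order\<close>

context
  fixes k :: nat
  assumes k: "1 \<le> k" and w_smooth: "Ck_on k w {x. w x > 0}"
begin

lemma Ck_on_\<gamma>_w: "Ck_on k (\<lambda>x. \<gamma> (w x)) S"
  using w_smooth \<gamma>_smooth \<gamma>_0 by (rule Ck_on_comp_w)

lemma Ck_on_\<gamma>_w': "open S \<Longrightarrow> Ck_on k f S \<Longrightarrow> Ck_on k (\<lambda>x. \<gamma> (w (f x))) S"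
  by (rule Ck_on_compose[OF _ open_UNIV _ Ck_on_\<gamma>_w]) auto

lemma Ck_on_A: "Ck_on k A N"
proof -
  \<comment> \<open>\<open>height\<close> decreases in t, so it enters with a minus sign to have the
    sign of t - A x that \<open>continuous_on_implicit\<close> asks for.\<close>
  let ?F = "\<lambda>p. \<phi> (snd p) - height (proj (snd p)) (fst p)"
  have 1: "Ck_on k (\<lambda>p. inverse (fst p) *\<^sub>R proj (snd p)) Q"
    by (intro Ck_on_scaleR[OF open_Q] Ck_on_inverse_fst Ck_on_snd Ck_on_linear proj_linear)
  have 2: "Ck_on k (\<lambda>p. 1 - fst p) Q"
    by (intro Ck_on_diff[OF open_Q] Ck_on_const Ck_on_fst)
  have F: "Ck_on k ?F Q"
    unfolding height_def
    by (intro Ck_on_diff[OF open_Q] Ck_on_mult[OF open_Q] Ck_on_\<gamma>_w'[OF open_Q 1] 2 Ck_on_fst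
        Ck_on_snd Ck_on_linear \<phi>_linear)
  have cont: "continuous_on N A"
  proof (rule continuous_on_implicit[where G = "\<lambda>t x. \<phi> x - height (proj x) t"])
    show "continuous_on N (\<lambda>x. \<phi> x - height (proj x) t)" if "t > 0" for t
    proof -
      have "Ck_on k (\<lambda>x. inverse t *\<^sub>R proj x) N"
        by (intro Ck_on_scaleR[OF open_N] Ck_on_const Ck_on_linear proj_linear)
      from Ck_on_0D[OF open_N Ck_on_\<gamma>_w'[OF open_N this]]
      show ?thesis unfolding height_def by (intro continuous_intros) auto
    qed
    show "sgn (\<phi> x - height (proj x) t) = sgn (t - A x)" if t: "t > 0" and x: "x \<in> N" for t x
      using height_A[OF x] height_decreasing[OF t, of "A x" "proj x"]
        height_decreasing[OF A_\<zeta>(1)[OF x], of t "proj x"]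
      by (cases t "A x" rule: linorder_cases) auto
  qed (auto simp: open_N A_\<zeta>)
  show ?thesis
  proof (rule Ck_on_implicit[OF open_Q F k open_N cont])
    fix x assume x: "x \<in> N"
    show "(A x, x) \<in> Q \<and> \<phi> (snd (A x, x)) - height (proj (snd (A x, x))) (fst (A x, x)) = 0"
      using x A_\<zeta>(1)[OF x] height_A[OF x] by simp
    obtain d where d: "d < 0" "(height (proj x) has_real_derivative d) (at (A x))"
      using height_DERIV[OF A_\<zeta>(1)[OF x]] by blast
    have "((\<lambda>t. \<phi> x - height (proj x) t) has_real_derivative 0 - d) (at (A x))"
      by (intro DERIV_diff DERIV_const d)
    then show "\<exists>d. d \<noteq> 0 \<and> ((\<lambda>t. \<phi> (snd (t, x)) - height (proj (snd (t, x))) (fst (t, x)))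
        has_real_derivative d) (at (A x))"
      using d(1) by (intro exI[of _ "0 - d"]) simp
  qed
qed

lemma Ck_on_\<zeta>: "Ck_on k \<zeta> N"
proof (rule Ck_on_cong)
  show "Ck_on k (\<lambda>x. inverse (A x) *\<^sub>R proj x - y) N"
    by (intro Ck_on_diff[OF open_N] Ck_on_scaleR[OF open_N] Ck_on_inverse[OF open_N Ck_on_A]
        Ck_on_const Ck_on_linear proj_linear) (use A_\<zeta>(1) in force)
qed (simp add: \<zeta>_eq)

lemma Ck_on_c: "Ck_on k (\<lambda>x. c_map U y \<gamma> (\<zeta> x)) N"
  unfolding c_map_eq
  by (intro Ck_on_scaleR[OF open_N] Ck_on_\<gamma>_w'[OF open_N] Ck_on_add[OF open_N] Ck_on_const Ck_on_\<zeta>)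

lemma Ck_on_Phi:
  assumes "Ck_on k \<beta> N"
  shows "Ck_on k (\<lambda>x. Phi_map U y \<gamma> (\<beta> x, \<zeta> x)) N"
  unfolding Phi_map_def prod.case
  by (intro Ck_on_add[OF open_N] Ck_on_scaleR[OF open_N] Ck_on_diff[OF open_N] assms Ck_on_c Ck_on_\<zeta>)

text \<open>The equation is w (c + (z - c) / t) = 1 with z = \<zeta> x and root t = W z. At the
  root, with q the point inside w, the t-derivative of 1 - w is w' q (q - c) / t. This is positive
  since w' q q \<ge> w q = 1 and w' q c \<le> w c = 0.\<close>

lemma Ck_on_W: "Ck_on k (\<lambda>x. W (\<zeta> x)) N"
proof -
  let ?c = "\<lambda>x. c_map U y \<gamma> (\<zeta> x)"
  define E where "E p = ?c (snd p) + inverse (fst p) *\<^sub>R (\<zeta> (snd p) - ?c (snd p))" for p :: "real \<times> 'a"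
  have E: "Ck_on k E Q"
    unfolding E_def
    by (intro Ck_on_add[OF open_Q] Ck_on_scaleR[OF open_Q] Ck_on_diff[OF open_Q] Ck_on_inverse_fst
        Ck_on_snd[OF Ck_on_c] Ck_on_snd[OF Ck_on_\<zeta>])
  \<comment> \<open>w is smooth only where it is positive; the roots lie in R because w = 1
    there.\<close>
  define R where "R = Q \<inter> E -` {x. w x > 0}"
  have R: "open R"
    unfolding R_def using Ck_on_0D[OF open_Q E] open_Q open_w_pos by (rule continuous_open_preimage)
  have "Ck_on k (\<lambda>p. w (E p)) R"
    by (rule Ck_on_compose[OF R open_w_pos Ck_on_subset[OF E] w_smooth]) (auto simp: R_def)
  then have F: "Ck_on k (\<lambda>p. 1 - w (E p)) R"
    by (rule Ck_on_diff[OF R Ck_on_const])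
  have pos: "W (\<zeta> x) > 0" if "x \<in> N" for x using W_ge_1[OF A_\<zeta>(2)[OF that]] by simp
  have sg: "sgn (1 - w (E (t, x))) = sgn (t - W (\<zeta> x))" if t: "t > 0" for t x
    using W_le_iff[OF t, of "\<zeta> x"] W_less_iff[OF t, of "\<zeta> x"]
    by (cases t "W (\<zeta> x)" rule: linorder_cases) (auto simp: E_def sgn_if)
  have cont: "continuous_on N (\<lambda>x. W (\<zeta> x))"
  proof (rule continuous_on_implicit[where G = "\<lambda>t x. 1 - w (E (t, x))"])
    fix t :: real assume t: "t > 0"
    show "continuous_on N (\<lambda>x. 1 - w (E (t, x)))"
      by (intro continuous_intros continuous_on_compose2[OF Ck_on_0D[OF open_Q E]]) (use t in auto)
  qed (auto simp: open_N pos sg)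
  show ?thesis
  proof (rule Ck_on_implicit[OF R F k open_N cont])
    fix x assume x: "x \<in> N"
    define v where "v = W (\<zeta> x)"
    have v: "v > 0" using pos[OF x] by (simp add: v_def)
    define q where "q = E (v, x)"
    have wq: "w q = 1" using sg[OF v, of x] by (simp add: v_def q_def sgn_eq_0_iff)
    then show "(W (\<zeta> x), x) \<in> R \<and> 1 - w (E (W (\<zeta> x), x)) = 0"
      using v x by (simp add: R_def q_def v_def)
    obtain j where "k = Suc j" using k by (cases k) auto
    then obtain w' where "\<And>x. x \<in> {x. w x > 0} \<Longrightarrow> (w has_derivative blinfun_apply (w' x)) (at x)"
      using Ck_on_SucE[OF open_w_pos] w_smooth by blast
    then have w': "(w has_derivative w' q) (at q)" using wq by simp
    define d where "d = inverse v * w' q (q - ?c x)"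
    have "w' q (?c x) \<le> 0"
      using derivative_w_le[OF w', of "?c x"] \<gamma>_nonneg[of "w (y + \<zeta> x)"] by (simp add: c_map_eq w_y)
    then have "w' q (q - ?c x) \<ge> 1" using derivative_w_self[OF w'] wq by (simp add: blinfun.diff_right)
    then have "d > 0" using v by (simp add: d_def)
    have "((\<lambda>t. E (t, x)) has_derivative (\<lambda>h. (- (inverse v * h * inverse v)) *\<^sub>R (\<zeta> x - ?c x))) (at v)"
      unfolding E_def using v by (auto intro!: derivative_eq_intros)
    moreover have "inverse v *\<^sub>R (\<zeta> x - ?c x) = q - ?c x" by (simp add: q_def E_def)
    then have "(- (inverse v * h * inverse v)) *\<^sub>R (\<zeta> x - ?c x) = (- (inverse v * h)) *\<^sub>R (q - ?c x)" for h
      by (metis scaleR_scaleR mult_minus_left)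
    ultimately have "((\<lambda>t. E (t, x)) has_derivative (\<lambda>h. (- (inverse v * h)) *\<^sub>R (q - ?c x))) (at v)"
      by simp
    then have "((\<lambda>t. w (E (t, x))) has_derivative (\<lambda>h. w' q ((- (inverse v * h)) *\<^sub>R (q - ?c x)))) (at v)"
      by (rule has_derivative_compose[where g = w]) (use w' in \<open>simp add: q_def\<close>)
    then have "((\<lambda>t. 1 - w (E (t, x))) has_derivative (\<lambda>h. 0 - w' q ((- (inverse v * h)) *\<^sub>R (q - ?c x)))) (at v)"
      by (intro has_derivative_diff has_derivative_const)
    moreover have "(\<lambda>h. 0 - w' q ((- (inverse v * h)) *\<^sub>R (q - ?c x))) = (*) d"
      unfolding blinfun.scaleR_right by (auto simp: d_def fun_eq_iff)
    ultimately have "((\<lambda>t. 1 - w (E (t, x))) has_real_derivative d) (at v)"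
      unfolding has_field_derivative_def by simp
    then show "\<exists>d. d \<noteq> 0 \<and> ((\<lambda>t. 1 - w (E (t, x))) has_real_derivative d) (at (W (\<zeta> x)))"
      using \<open>d > 0\<close> unfolding v_def by (intro exI[of _ d]) simp
  qed
qed

lemma Ck_on_stretch:
  assumes S: "open S" and v: "Ck_on k v S" and t: "Ck_on k t S"
  shows "Ck_on k (\<lambda>x. stretch (v x) (t x)) S"
proof -
  have "Ck_on k (\<lambda>x. lam (t x * v x)) S"
    by (rule Ck_on_compose[OF S open_UNIV Ck_on_mult[OF S t v] lam_smooth]) simp
  then show ?thesis
    unfolding stretch_def by (intro Ck_on_add[OF S] Ck_on_mult[OF S] Ck_on_diff[OF S] Ck_on_const v t)
qed

lemma Ck_on_B: "Ck_on k B N"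
proof -
  let ?F = "\<lambda>p. stretch (W (\<zeta> (snd p))) (fst p) - A (snd p)"
  have F: "Ck_on k ?F Q"
    by (intro Ck_on_diff[OF open_Q] Ck_on_stretch[OF open_Q] Ck_on_fst Ck_on_snd[OF Ck_on_W]
        Ck_on_snd[OF Ck_on_A])
  have v1: "W (\<zeta> x) \<ge> 1" if "x \<in> N" for x using W_ge_1[OF A_\<zeta>(2)[OF that]] .
  have cont: "continuous_on N B"
  proof (rule continuous_on_implicit[where G = "\<lambda>t x. stretch (W (\<zeta> x)) t - A x"])
    show "continuous_on N (\<lambda>x. stretch (W (\<zeta> x)) t - A x)" if "t > 0" for t
      by (intro Ck_on_0D[OF open_N, of k] Ck_on_diff[OF open_N] Ck_on_stretch[OF open_N] Ck_on_W
          Ck_on_const Ck_on_A)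
    show "sgn (stretch (W (\<zeta> x)) t - A x) = sgn (t - B x)" if "t > 0" "x \<in> N" for t x
      using sgn_stretch[OF v1[OF that(2)] B_pos[OF that(2)] that(1)] stretch_B[OF that(2)] by simp
  qed (auto simp: open_N B_pos)
  show ?thesis
  proof (rule Ck_on_implicit[OF open_Q F k open_N cont])
    fix x assume x: "x \<in> N"
    show "(B x, x) \<in> Q \<and> stretch (W (\<zeta> (snd (B x, x)))) (fst (B x, x)) - A (snd (B x, x)) = 0"
      using x B_pos[OF x] stretch_B[OF x] by simp
    obtain d where d: "d > 0" "(stretch (W (\<zeta> x)) has_real_derivative d) (at (B x))"
      using stretch_DERIV[OF v1[OF x] B_pos[OF x]] by blast
    have "((\<lambda>t. stretch (W (\<zeta> x)) t - A x) has_real_derivative d - 0) (at (B x))"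
      by (intro DERIV_diff DERIV_const d)
    then show "\<exists>d. d \<noteq> 0 \<and> ((\<lambda>t. stretch (W (\<zeta> (snd (t, x)))) (fst (t, x)) - A (snd (t, x)))
        has_real_derivative d) (at (B x))"
      using d(1) by (intro exI[of _ "d - 0"]) simp
  qed
qed

text \<open>The second assumption refers to the fixed points of H so that the lemma serves both H
  and its inverse, which has the same fixed points.\<close>

lemma Ck_on_extend_by_id:
  assumes "Ck_on k f N" and fix_near: "\<And>x. H x = x \<Longrightarrow> f x = x"
  shows "Ck_on k f UNIV"
proof (rule Ck_on_local[OF open_UNIV])
  fix x :: 'a
  show "\<exists>T. open T \<and> x \<in> T \<and> Ck_on k f T"
  proof (cases "x \<in> N")
    case True
    then show ?thesis using assms(1) open_N by blast
  next
    case False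
    then obtain T where T: "open T" "x \<in> T" "\<And>x. x \<in> T \<Longrightarrow> H x = x" by (rule H_id_near_fixed) blast
    have "Ck_on k f T"
      using Ck_on_ident by (rule Ck_on_cong) (simp add: T fix_near)
    then show ?thesis using T by blast
  qed
qed

lemma Ck_on_H: "Ck_on k H UNIV"
proof (rule Ck_on_extend_by_id)
  show "Ck_on k H N"
    using Ck_on_Phi[OF Ck_on_stretch[OF open_N Ck_on_W Ck_on_A]] by (rule Ck_on_cong) (simp add: H_N)
qed

lemma Ck_on_K: "Ck_on k K UNIV"
proof (rule Ck_on_extend_by_id)
  show "Ck_on k K N"
    using Ck_on_Phi[OF Ck_on_B] by (rule Ck_on_cong) (simp add: K_def)
  show "K x = x" if "H x = x" for x using K_H[of x] that by simp
qed

end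

end

theorem mainTheorem2:
  fixes U :: "'a::banach set" and y :: 'a and \<phi> :: "'a \<Rightarrow> real"
    and \<gamma> lam :: "real \<Rightarrow> real" and p :: enat
  assumes "1 \<le> p"
    and "Cp_smooth_body p U"
    and "\<not> subspace (char_cone U)"
    and "0 \<in> interior U"
    and "y \<in> char_cone U" and "- y \<notin> char_cone U" and "- y \<in> frontier U"
    and "bounded_linear \<phi>" and "\<phi> (- y) = -1" and "\<forall>x\<in>U. \<phi> x \<ge> -1"
    and "Cp_on \<infinity> lam UNIV" and "mono lam"
    and "\<forall>t\<le>1/2. lam t = 0" and "\<forall>t\<ge>1. lam t = 1"
    and "Cp_on \<infinity> \<gamma> UNIV" and "\<forall>t\<le>1/2. \<gamma> t = 0"
    and "filterlim \<gamma> at_top at_top"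
    and "\<forall>t>0. 0 \<le> deriv \<gamma> t \<and> deriv \<gamma> t < (1 / t) * (\<gamma> t + 1)"
  shows "Cp_diffeomorphism p (H_map U y \<phi> \<gamma> lam) UNIV UNIV"
proof -
  have body: "closed U" "convex U" "Cp_hypersurface p (frontier U)"
    using assms(2) unfolding Cp_smooth_body_def closed_convex_body_def by auto
  interpret flattening U y \<phi> \<gamma> lam
  proof (rule flattening.intro)
    show "convex_nbhd U" using body assms(4) by (simp add: convex_nbhd_def)
    show "flattening_axioms U y \<phi> \<gamma> lam"
      using assms by (intro flattening_axioms.intro) (simp_all add: Cp_on_def)
  qed
  have inv: "inv H = K"
    using H_K K_H by (intro inv_equality)
  have CH: "Ck_on k H UNIV" and CK: "Ck_on k K UNIV" if k: "1 \<le> k" "enat k \<le> p" for k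
    using Ck_on_w[OF assms(1) k(2,1) body(3)] Ck_on_H[OF k(1)] Ck_on_K[OF k(1)] by auto
  have "Ck_on k H UNIV \<and> Ck_on k K UNIV" if k: "enat k \<le> p" for k
  proof (cases "k = 0")
    case True
    \<comment> \<open>The implicit function argument starts at order 1, so order 0 is deduced from
      order 1, which is available since 1 \<le> p.\<close>
    have "enat 1 \<le> p" using assms(1) by (simp add: one_enat_def)
    then show ?thesis
      using CH[of 1] CK[of 1] Ck_on_mono[OF open_UNIV, of 1 H 0] Ck_on_mono[OF open_UNIV, of 1 K 0] True by simp
  next
    case False
    then show ?thesis using CH[of k] CK[of k] k by simp
  qed
  moreover have "bij H"
    using H_K K_H by (intro o_bij[of K]) (auto simp: fun_eq_iff)
  ultimately show ?thesis
    unfolding Cp_diffeomorphism_def Cp_on_def inv by simp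
qed

end
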